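(* Consider a linear map $Q:\mathcal{M}_{d_B}\to\mathcal{M}_{d_A}$ factoring through a Lorentz cone $\mathsf{L}_k$. For any entanglement annihilating map $P:\mathcal{M}_{d_A}\to\mathcal{M}_{d_B}$ the composition $Q\circ P:\mathcal{M}_{d_A}\to\mathcal{M}_{d_A}$ is entanglement breaking.
   Context: $\mathcal{M}_d$ is the set of complex $d\times d$ matrices, $\mathcal{M}_d^{sa}$ its real subspace of self-adjoint matrices, and $\mathsf{PSD}(\mathbb{C}^d)\subset\mathcal{M}_d^{sa}$ the cone of positive semidefinite matrices. $\mathsf{L}_k=\{(t,x)\in\mathbb{R}\oplus\mathbb{R}^k:\|x\|_2\le t\}$ is the Lorentz cone. For cones $\mathsf{C}\subset V$, $\mathsf{C}'\subset V'$ a linear map $R:V\to V'$ is $(\mathsf{C},\mathsf{C}')$-positive if $R(\mathsf{C})\subseteq\mathsf{C}'$. Positive maps between matrix algebras preserve self-adjointness and are identified with their restrictions to self-adjoint matrices. The map $Q$ factors through $\mathsf{L}_k$ if it is a finite sum $Q=\sum_i S_i\circ R_i$ where each $R_i:\mathcal{M}_{d_B}^{sa}\to\mathbb{R}^{k+1}$ is $(\mathsf{PSD}(\mathbb{C}^{d_B}),\mathsf{L}_k)$-positive and each $S_i:\mathbb{R}^{k+1}\to\mathcal{M}_{d_A}^{sa}$ is $(\mathsf{L}_k,\mathsf{PSD}(\mathbb{C}^{d_A}))$-positive. Set $\mathsf{PSD}(\mathbb{C}^{m})\otimes_{\min}\mathsf{PSD}(\mathbb{C}^{n})=\mathrm{conv}\{x\otimes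 y: x\in\mathsf{PSD}(\mathbb{C}^m),y\in\mathsf{PSD}(\mathbb{C}^n)\}$, $\mathsf{PSD}(\mathbb{C}^{d})^{\otimes_{\min}m}=\mathrm{conv}\{x_1\otimes\cdots\otimes x_m: x_i\in\mathsf{PSD}(\mathbb{C}^d)\}$, and $\mathsf{PSD}(\mathbb{C}^{d})^{\otimes_{\max}m}=(\mathsf{PSD}(\mathbb{C}^{d})^{\otimes_{\min}m})^*$, the dual cone with respect to $\langle x,y\rangle=\mathrm{Tr}[xy]$ on self-adjoint elements of $\mathcal{M}_d^{\otimes m}$. A linear map $P:\mathcal{M}_{d_A}\to\mathcal{M}_{d_B}$ is entanglement breaking if $(\mathrm{id}_n\otimes P)(\mathsf{PSD}(\mathbb{C}^n\otimes\mathbb{C}^{d_A}))\subseteq\mathsf{PSD}(\mathbb{C}^n)\otimes_{\min}\mathsf{PSD}(\mathbb{C}^{d_B})$ for every $n\in\mathbb{N}$, and entanglement annihilating if $P^{\otimes m}(\mathsf{PSD}(\mathbb{C}^{d_A})^{\otimes_{\max}m})\subseteq\mathsf{PSD}(\mathbb{C}^{d_B})^{\otimes_{\min}m}$ for every $m\in\mathbb{N}$. *)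

theory Defs
  imports "Jordan_Normal_Form.Schur_Decomposition" "HOL-Library.Complex_Order"
begin

text \<open>
  The dimensions \<open>n\<close> and \<open>d ^ m\<close> are quantified over inside the definitions below, so matrices
  are those of \<open>Jordan_Normal_Form\<close>, with explicit carriers. A map between matrix spaces is a
  function on all of \<open>complex mat\<close> of which only the values on the carrier matter.
\<close>


subsection \<open>Matrices and cones\<close>

definition herm :: "nat \<Rightarrow> complex mat set" where
  "herm d = {A \<in> carrier_mat d d. mat_adjoint A = A}"

text \<open>The order on \<open>complex\<close> is that of \<open>Complex_Order\<close>: \<open>0 \<le> z\<close> says that \<open>z\<close> is real and
  nonnegative.\<close>

definition PSD :: "nat \<Rightarrow> complex mat set" where
  "PSD d = {A \<in> herm d. \<forall>v \<in> carrier_vec d. 0 \<le> (A *\<^sub>v v) \<bullet>c v}"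

definition mat_trace :: "complex mat \<Rightarrow> complex" where
  "mat_trace A = (\<Sum>i<dim_row A. A $$ (i, i))"

text \<open>Sum of a family of \<open>d \<times> d\<close> matrices; the type of matrices of all sizes has no zero, so
  \<^const>\<open>sum\<close> does not apply.\<close>

definition msum :: "nat \<Rightarrow> 'i set \<Rightarrow> ('i \<Rightarrow> complex mat) \<Rightarrow> complex mat" where
  "msum d I f = mat d d (\<lambda>(r, s). \<Sum>i\<in>I. f i $$ (r, s))"

definition mconv :: "nat \<Rightarrow> complex mat set \<Rightarrow> complex mat set" where
  "mconv d S = {msum d {..<N} (\<lambda>l. complex_of_real (c l) \<cdot>\<^sub>m A l) | (N :: nat) c A.
     (\<forall>l<N. 0 \<le> c l \<and> A l \<in> S) \<and> (\<Sum>l<N. c l) = 1}"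

text \<open>Coordinate \<open>0\<close> of a vector in \<open>\<real>\<^bsup>k+1\<^esup>\<close> is \<open>t\<close>, coordinates \<open>1, \<dots>, k\<close> form \<open>x\<close>.\<close>

definition Lorentz :: "nat \<Rightarrow> real vec set" where
  "Lorentz k = {v \<in> carrier_vec (k + 1). sqrt (\<Sum>i = 1..k. (v $ i)\<^sup>2) \<le> v $ 0}"


subsection \<open>Tensor products\<close>

text \<open>\<open>\<complex>\<^bsup>a\<^esup> \<otimes> \<complex>\<^bsup>c\<^esup>\<close> is identified with \<open>\<complex>\<^bsup>a c\<^esup>\<close> by \<open>e\<^sub>i \<otimes> e\<^sub>j \<mapsto> e\<^bsub>i c + j\<^esub>\<close>; the first tensor
  factor is the more significant digit.\<close>

definition kron :: "complex mat \<Rightarrow> complex mat \<Rightarrow> complex mat" where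
  "kron A B = mat (dim_row A * dim_row B) (dim_col A * dim_col B)
     (\<lambda>(r, s). A $$ (r div dim_row B, s div dim_col B) * B $$ (r mod dim_row B, s mod dim_col B))"

fun kron_list :: "complex mat list \<Rightarrow> complex mat" where
  "kron_list [] = 1\<^sub>m 1"
| "kron_list (A # As) = kron A (kron_list As)"

definition min_tensor :: "nat \<Rightarrow> nat \<Rightarrow> complex mat set" where
  "min_tensor m n = mconv (m * n) {kron x y | x y. x \<in> PSD m \<and> y \<in> PSD n}"

definition min_tensor_pow :: "nat \<Rightarrow> nat \<Rightarrow> complex mat set" where
  "min_tensor_pow d m = mconv (d ^ m) {kron_list xs | xs. length xs = m \<and> set xs \<subseteq> PSD d}"

definition max_tensor_pow :: "nat \<Rightarrow> nat \<Rightarrow> complex mat set" where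
  "max_tensor_pow d m =
     {x \<in> herm (d ^ m). \<forall>y \<in> min_tensor_pow d m. 0 \<le> mat_trace (x * y)}"


subsection \<open>Linear maps and their tensor products\<close>

definition mat_linear :: "nat \<Rightarrow> nat \<Rightarrow> (complex mat \<Rightarrow> complex mat) \<Rightarrow> bool" where
  "mat_linear a b P \<longleftrightarrow>
     (\<forall>X \<in> carrier_mat a a. P X \<in> carrier_mat b b) \<and>
     (\<forall>X \<in> carrier_mat a a. \<forall>Y \<in> carrier_mat a a. P (X + Y) = P X + P Y) \<and>
     (\<forall>z. \<forall>X \<in> carrier_mat a a. P (z \<cdot>\<^sub>m X) = z \<cdot>\<^sub>m P X)"

definition munit :: "nat \<Rightarrow> nat \<Rightarrow> nat \<Rightarrow> complex mat" where
  "munit d i j = mat d d (\<lambda>(r, s). if r = i \<and> s = j then 1 else 0)"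

text \<open>The tensor product of \<open>P : M\<^sub>a \<rightarrow> M\<^sub>b\<close> and \<open>R : M\<^sub>c \<rightarrow> M\<^sub>e\<close>, by its values on the basis
  \<open>E\<^bsub>i i'\<^esub> \<otimes> E\<^bsub>j j'\<^esub>\<close> of \<open>M\<^bsub>a c\<^esub>\<close>.\<close>

definition tensor_map :: "nat \<Rightarrow> nat \<Rightarrow> (complex mat \<Rightarrow> complex mat) \<Rightarrow>
    nat \<Rightarrow> nat \<Rightarrow> (complex mat \<Rightarrow> complex mat) \<Rightarrow> complex mat \<Rightarrow> complex mat" where
  "tensor_map a b P c e R X =
     msum (b * e) (({..<a} \<times> {..<a}) \<times> ({..<c} \<times> {..<c}))
       (\<lambda>((i, i'), (j, j')).
          X $$ (i * c + j, i' * c + j') \<cdot>\<^sub>m kron (P (munit a i i')) (R (munit c j j')))"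

fun tensor_pow :: "nat \<Rightarrow> nat \<Rightarrow> (complex mat \<Rightarrow> complex mat) \<Rightarrow> nat \<Rightarrow>
    complex mat \<Rightarrow> complex mat" where
  "tensor_pow a b P 0 = (\<lambda>X. X)"
| "tensor_pow a b P (Suc m) = tensor_map a b P (a ^ m) (b ^ m) (tensor_pow a b P m)"

text \<open>\<^const>\<open>tensor_map\<close> is the linear map determined by \<open>(P \<otimes> R) (X \<otimes> Y) = P X \<otimes> R Y\<close>.\<close>

lemma mat_linear_expand:
  assumes P: "mat_linear a b P" and X: "X \<in> carrier_mat a a"
  shows "P X = msum b ({..<a} \<times> {..<a}) (\<lambda>(i, i'). X $$ (i, i') \<cdot>\<^sub>m P (munit a i i'))"
proof -
  have u: "munit a i j \<in> carrier_mat a a" for i j by (simp add: munit_def)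
  have msum: "P (msum a I (\<lambda>(i, i'). X $$ (i, i') \<cdot>\<^sub>m munit a i i'))
      = msum b I (\<lambda>(i, i'). X $$ (i, i') \<cdot>\<^sub>m P (munit a i i'))" if "finite I" for I
    using that
  proof (induction I rule: finite_induct)
    case empty
    have z: "msum a {} (\<lambda>(i, i'). X $$ (i, i') \<cdot>\<^sub>m munit a i i') = 0 \<cdot>\<^sub>m 0\<^sub>m a a"
      by (auto simp: msum_def)
    have "P (0 \<cdot>\<^sub>m 0\<^sub>m a a) = 0 \<cdot>\<^sub>m P (0\<^sub>m a a)" "P (0\<^sub>m a a) \<in> carrier_mat b b"
      using P zero_carrier_mat[of a a] unfolding mat_linear_def by blast+
    then have "P (0 \<cdot>\<^sub>m 0\<^sub>m a a) = msum b {} (\<lambda>(i, i'). X $$ (i, i') \<cdot>\<^sub>m P (munit a i i'))"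
      by (intro eq_matI) (simp_all add: msum_def del: smult_zero_mat)
    then show ?case unfolding z .
  next
    case (insert q I)
    obtain i i' where q: "q = (i, i')" by force
    let ?f = "\<lambda>(i, i'). X $$ (i, i') \<cdot>\<^sub>m munit a i i'"
    let ?g = "\<lambda>(i, i'). X $$ (i, i') \<cdot>\<^sub>m P (munit a i i')"
    have c: "msum a I ?f \<in> carrier_mat a a" "?f q \<in> carrier_mat a a"
      by (auto simp: msum_def q munit_def)
    have "?g q \<in> carrier_mat b b" using P u by (auto simp: mat_linear_def q)
    then have g: "?g q + msum b I ?g = msum b (insert q I) ?g"
      using insert.hyps by (auto simp: msum_def)
    have "msum a (insert q I) ?f = ?f q + msum a I ?f"
      using insert.hyps c by (auto simp: msum_def)
    then have "P (msum a (insert q I) ?f) = P (?f q) + P (msum a I ?f)"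
      using P c by (auto simp: mat_linear_def)
    also have "P (?f q) = ?g q" using P u by (auto simp: mat_linear_def q)
    finally show ?case using insert.IH g by simp
  qed
  have "msum a ({..<a} \<times> {..<a}) (\<lambda>(i, i'). X $$ (i, i') \<cdot>\<^sub>m munit a i i') = X"
  proof (rule eq_matI)
    fix r s assume rs: "r < dim_row X" "s < dim_col X"
    have "(\<Sum>(i, i')\<in>{..<a} \<times> {..<a}. X $$ (i, i') * (if r = i \<and> s = i' then 1 else 0)) =
          (\<Sum>p\<in>{..<a} \<times> {..<a}. if p = (r, s) then X $$ (r, s) else 0)"
      by (rule sum.cong) (auto split: if_splits)
    also have "\<dots> = X $$ (r, s)" using rs X by (simp add: sum.delta)
    finally show "msum a ({..<a} \<times> {..<a}) (\<lambda>(i, i'). X $$ (i, i') \<cdot>\<^sub>m munit a i i') $$ (r, s)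
        = X $$ (r, s)"
      using rs X by (simp add: msum_def munit_def split_def)
  qed (use X in \<open>auto simp: msum_def\<close>)
  then show ?thesis using msum[of "{..<a} \<times> {..<a}"] by simp
qed

lemma digit_less: "i * c + j < a * c" if "i < a" "j < c" for i j a c :: nat
  using mult_le_mono1[of "Suc i" a c] that by simp

lemma tensor_map_kron:
  assumes P: "mat_linear a b P" and R: "mat_linear c e R"
    and X: "X \<in> carrier_mat a a" and Y: "Y \<in> carrier_mat c c"
  shows "tensor_map a b P c e R (kron X Y) = kron (P X) (R Y)"
proof (rule eq_matI)
  have PX: "P Z \<in> carrier_mat b b" if "Z \<in> carrier_mat a a" for Z
    using P that by (auto simp: mat_linear_def)
  have RY: "R Z \<in> carrier_mat e e" if "Z \<in> carrier_mat c c" for Z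
    using R that by (auto simp: mat_linear_def)
  have u: "munit a i j \<in> carrier_mat a a" "munit c i j \<in> carrier_mat c c" for i j
    by (auto simp: munit_def)
  note d = carrier_matD[OF PX[OF X]] carrier_matD[OF RY[OF Y]]
    carrier_matD[OF PX[OF u(1)]] carrier_matD[OF RY[OF u(2)]] carrier_matD[OF X] carrier_matD[OF Y]
  show "dim_row (tensor_map a b P c e R (kron X Y)) = dim_row (kron (P X) (R Y))"
    "dim_col (tensor_map a b P c e R (kron X Y)) = dim_col (kron (P X) (R Y))"
    using d by (auto simp: tensor_map_def msum_def kron_def)
  fix r s assume rs0: "r < dim_row (kron (P X) (R Y))" "s < dim_col (kron (P X) (R Y))"
  then have rs: "r < b * e" "s < b * e" using d by (auto simp: kron_def)
  then have e: "e > 0" by (cases e) auto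
  have dm: "r div e < b" "s div e < b" "r mod e < e" "s mod e < e"
    using rs e by (auto simp: less_mult_imp_div_less)
  let ?f = "\<lambda>p. X $$ p * P (munit a (fst p) (snd p)) $$ (r div e, s div e)"
  let ?g = "\<lambda>q. Y $$ q * R (munit c (fst q) (snd q)) $$ (r mod e, s mod e)"
  have "tensor_map a b P c e R (kron X Y) $$ (r, s) =
     (\<Sum>(p, q)\<in>({..<a} \<times> {..<a}) \<times> ({..<c} \<times> {..<c}). ?f p * ?g q)"
    unfolding tensor_map_def msum_def using rs
    by (auto simp: kron_def d digit_less intro!: sum.cong)
  also have "\<dots> = (\<Sum>p\<in>{..<a} \<times> {..<a}. ?f p) * (\<Sum>q\<in>{..<c} \<times> {..<c}. ?g q)"
    by (simp add: sum_product sum.cartesian_product)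
  also have "(\<Sum>p\<in>{..<a} \<times> {..<a}. ?f p) = P X $$ (r div e, s div e)"
    by (subst mat_linear_expand[OF P X]) (use dm in \<open>simp add: msum_def split_def d\<close>)
  also have "(\<Sum>q\<in>{..<c} \<times> {..<c}. ?g q) = R Y $$ (r mod e, s mod e)"
    by (subst mat_linear_expand[OF R Y]) (use dm in \<open>simp add: msum_def split_def d\<close>)
  finally show "tensor_map a b P c e R (kron X Y) $$ (r, s) = kron (P X) (R Y) $$ (r, s)"
    using rs by (simp add: kron_def d)
qed

lemma mat_linear_tensor_map: "mat_linear (a * c) (b * e) (tensor_map a b P c e R)"
  if P: "mat_linear a b P" and R: "mat_linear c e R"
proof -
  let ?T = "tensor_map a b P c e R"
  let ?B = "({..<a} \<times> {..<a}) \<times> ({..<c} \<times> {..<c})"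
  let ?K = "\<lambda>i i' j j'. kron (P (munit a i i')) (R (munit c j j'))"
  have K: "?K i i' j j' \<in> carrier_mat (b * e) (b * e)" for i i' j j'
  proof -
    have "P (munit a i i') \<in> carrier_mat b b" "R (munit c j j') \<in> carrier_mat e e"
      using P R by (simp_all add: mat_linear_def munit_def)
    then show ?thesis by (auto simp: kron_def)
  qed
  note Kd = carrier_matD[OF K]
  have T: "?T X \<in> carrier_mat (b * e) (b * e)" for X
    by (simp add: tensor_map_def msum_def)
  note Td = carrier_matD[OF T]
  have entry: "?T X $$ (r, s) = (\<Sum>((i, i'), (j, j')) \<in> ?B.
      X $$ (i * c + j, i' * c + j') * ?K i i' j j' $$ (r, s))"
    if "r < b * e" "s < b * e" for X r s
    using that by (auto simp: tensor_map_def msum_def Kd intro!: sum.cong)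
  show ?thesis
    unfolding mat_linear_def
  proof (intro conjI ballI allI)
    show "?T X \<in> carrier_mat (b * e) (b * e)" for X by (rule T)
  next
    fix X Y :: "complex mat"
    assume XY: "X \<in> carrier_mat (a * c) (a * c)" "Y \<in> carrier_mat (a * c) (a * c)"
    show "?T (X + Y) = ?T X + ?T Y"
    proof (rule eq_matI)
      fix r s assume "r < dim_row (?T X + ?T Y)" "s < dim_col (?T X + ?T Y)"
      then have rs: "r < b * e" "s < b * e" by (simp_all add: Td)
      have "?T (X + Y) $$ (r, s) = ?T X $$ (r, s) + ?T Y $$ (r, s)"
        unfolding entry[OF rs] sum.distrib[symmetric]
        by (rule sum.cong) (use XY in \<open>auto simp: digit_less distrib_right\<close>)
      then show "?T (X + Y) $$ (r, s) = (?T X + ?T Y) $$ (r, s)"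
        using rs by (simp add: Td)
    qed (simp_all add: Td)
  next
    fix z and X :: "complex mat"
    assume X: "X \<in> carrier_mat (a * c) (a * c)"
    show "?T (z \<cdot>\<^sub>m X) = z \<cdot>\<^sub>m ?T X"
    proof (rule eq_matI)
      fix r s assume "r < dim_row (z \<cdot>\<^sub>m ?T X)" "s < dim_col (z \<cdot>\<^sub>m ?T X)"
      then have rs: "r < b * e" "s < b * e" by (simp_all add: Td)
      have "?T (z \<cdot>\<^sub>m X) $$ (r, s) = z * ?T X $$ (r, s)"
        unfolding entry[OF rs] sum_distrib_left
        by (rule sum.cong) (use X in \<open>auto simp: digit_less mult.assoc\<close>)
      then show "?T (z \<cdot>\<^sub>m X) $$ (r, s) = (z \<cdot>\<^sub>m ?T X) $$ (r, s)"
        using rs by (simp add: Td)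
    qed (simp_all add: Td)
  qed
qed

lemma mat_linear_tensor_pow: "mat_linear (a ^ m) (b ^ m) (tensor_pow a b P m)"
  if "mat_linear a b P"
  using that by (induction m) (simp_all add: mat_linear_tensor_map, simp add: mat_linear_def)

lemma tensor_pow_kron_list:
  assumes P: "mat_linear a b P" and "set xs \<subseteq> carrier_mat a a"
  shows "kron_list xs \<in> carrier_mat (a ^ length xs) (a ^ length xs)"
    and "tensor_pow a b P (length xs) (kron_list xs) = kron_list (map P xs)"
  using assms(2)
proof (induction xs)
  case (Cons x xs)
  { case 1 then show ?case using Cons.IH(1) by (auto simp: kron_def) }
  { case 2 then show ?case using Cons.IH
      by (simp add: tensor_map_kron[OF P mat_linear_tensor_pow[OF P]]) }
qed simp_all


subsection \<open>Classes of maps\<close>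

definition entanglement_breaking ::
    "nat \<Rightarrow> nat \<Rightarrow> (complex mat \<Rightarrow> complex mat) \<Rightarrow> bool" where
  "entanglement_breaking a b P \<longleftrightarrow> mat_linear a b P \<and>
     (\<forall>n\<ge>1. tensor_map n n (\<lambda>X. X) a b P ` PSD (n * a) \<subseteq> min_tensor n b)"

text \<open>The restriction \<open>m \<ge> 1\<close> matters: the empty tensor product is \<open>1\<close>, so \<^term>\<open>min_tensor_pow d 0\<close>
  is a point and not a cone.\<close>

definition entanglement_annihilating ::
    "nat \<Rightarrow> nat \<Rightarrow> (complex mat \<Rightarrow> complex mat) \<Rightarrow> bool" where
  "entanglement_annihilating a b P \<longleftrightarrow> mat_linear a b P \<and>
     (\<forall>m\<ge>1. tensor_pow a b P m ` max_tensor_pow a m \<subseteq> min_tensor_pow b m)"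

definition herm_vec_linear :: "nat \<Rightarrow> nat \<Rightarrow> (complex mat \<Rightarrow> real vec) \<Rightarrow> bool" where
  "herm_vec_linear d n R \<longleftrightarrow>
     (\<forall>X \<in> herm d. R X \<in> carrier_vec n) \<and>
     (\<forall>X \<in> herm d. \<forall>Y \<in> herm d. R (X + Y) = R X + R Y) \<and>
     (\<forall>t. \<forall>X \<in> herm d. R (complex_of_real t \<cdot>\<^sub>m X) = t \<cdot>\<^sub>v R X)"

definition vec_herm_linear :: "nat \<Rightarrow> nat \<Rightarrow> (real vec \<Rightarrow> complex mat) \<Rightarrow> bool" where
  "vec_herm_linear n d S \<longleftrightarrow>
     (\<forall>v \<in> carrier_vec n. S v \<in> herm d) \<and>
     (\<forall>v \<in> carrier_vec n. \<forall>w \<in> carrier_vec n. S (v + w) = S v + S w) \<and>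
     (\<forall>t. \<forall>v \<in> carrier_vec n. S (t \<cdot>\<^sub>v v) = complex_of_real t \<cdot>\<^sub>m S v)"

text \<open>A complex linear map is identified with its restriction to the self-adjoint matrices.\<close>

definition factors_through_Lorentz ::
    "nat \<Rightarrow> nat \<Rightarrow> nat \<Rightarrow> (complex mat \<Rightarrow> complex mat) \<Rightarrow> bool" where
  "factors_through_Lorentz k a b Q \<longleftrightarrow>
     (\<exists>(N :: nat) R S.
        (\<forall>l<N. herm_vec_linear a (k + 1) (R l) \<and> R l ` PSD a \<subseteq> Lorentz k \<and>
               vec_herm_linear (k + 1) b (S l) \<and> S l ` Lorentz k \<subseteq> PSD b) \<and>
        (\<forall>X \<in> herm a. Q X = msum b {..<N} (\<lambda>l. S l (R l X))))"

end

(*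
  By duality it suffices to show that Tr(R P B) >= 0 whenever R : PSD -> L_k and B : L_k -> PSD are
  positive and P is entanglement annihilating. Put A = R P B, an operator on R^(k+1). For tensors w, z
  that are nonnegative on products of Lorentz vectors, B^(m) z lies in the maximal tensor power,
  so P^(m) B^(m) z is separable and <w, A^(m) z> >= 0. Take w = t_1 ... t_m + G_U and
  z = t_1 ... t_m +- G_U with G_U = <e_U, M(x_m) ... M(x_1) e_{}>, where M(x) is Clifford
  multiplication by x on a space of dimension 2^k with basis e_U: since M(x) is |x| times an isometry,
  these multilinear forms are nonnegative on Lorentz vectors (t_i, x_i). Averaging over sign flips of
  the coordinates in each factor and summing over U yields 2^k a^m +- c^m >= 0 for all m, where a is
  the time entry and c the trace of the spatial block of A. As 2^k does not depend on m, this forces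
  |c| <= a, that is, Tr A >= 0.
*)
theory Submission
  imports Defs "HOL-Analysis.Function_Topology"
begin

subsection \<open>Separation from cones with a compact base\<close>

text \<open>\<open>min_tensor\<close> is a bare convex hull, so duality needs the separable cone to
  be closed: it has a compact base, and Caratheodory bounds the number of terms. The map B comes
  from a witness \<Phi> that is nonnegative on products and a positive X: it sends a Lorentz vector
  v to the contraction, over the auxiliary factor, of X against \<Phi>(. \<otimes> S v). Positivity
  of X, of S and of \<Phi> on products makes B positive, and the witness evaluated at (id \<otimes>
  Q P) X becomes the sum of the traces of R P B, one for each term of the factorization.

  The hypothesis for m = 1 is too weak: it yields only that A maps L_k to itself, which diag(1, -1,
  ..., -1) does although its trace 1 - k is negative for k > 1. High powers help because the
  averaging keeps only the index words that are purely temporal or purely spatial, and a constant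
  independent of m disappears on taking m-th roots. The sign flips cost nothing: they are symmetries
  of the cone and can be absorbed into R and B.\<close>

lemma linear_dependence:
  fixes f :: "'j \<Rightarrow> 'i \<Rightarrow> real"
  assumes "finite I" "finite J" "card I < card J"
  shows "\<exists>d. (\<exists>j\<in>J. d j \<noteq> 0) \<and> (\<forall>i\<in>I. (\<Sum>j\<in>J. d j * f j i) = 0)"
  using assms
proof (induction I arbitrary: J f rule: finite_induct)
  case empty
  then obtain j where "j \<in> J" by fastforce
  then show ?case by (intro exI[of _ "\<lambda>_. 1"]) auto
next
  case (insert i I)
  show ?case
  proof (cases "\<forall>j\<in>J. f j i = 0")
    case True
    with insert show ?thesis by fastforce
  next
    case False
    then obtain j0 where j0: "j0 \<in> J" "f j0 i \<noteq> 0" by auto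
    \<comment> \<open>Gaussian elimination with pivot \<open>j0\<close>: coordinate \<open>i\<close>
      vanishes on all the modified vectors, so the induction hypothesis on the remaining coordinates
      suffices. \<open>?d\<close> below chooses the coefficient of \<open>j0\<close> to undo the
      modification.\<close>
    let ?f = "\<lambda>j i'. f j i' - f j i / f j0 i * f j0 i'"
    have "card I < card (J - {j0})" using insert j0 by (simp add: card_Diff_singleton)
    then obtain d where d: "\<exists>j\<in>J - {j0}. d j \<noteq> 0"
      "\<And>i'. i' \<in> I \<Longrightarrow> (\<Sum>j\<in>J - {j0}. d j * ?f j i') = 0"
      using insert.IH[of "J - {j0}" ?f] insert.prems by blast
    let ?s = "\<Sum>j\<in>J - {j0}. d j * f j i"
    let ?d = "d(j0 := - ?s / f j0 i)"
    have split: "(\<Sum>j\<in>J. ?d j * f j i') = (\<Sum>j\<in>J - {j0}. d j * f j i') - ?s / f j0 i * f j0 i'" for i'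
    proof -
      have "(\<Sum>j\<in>J - {j0}. ?d j * f j i') = (\<Sum>j\<in>J - {j0}. d j * f j i')"
        by (intro sum.cong) auto
      then show ?thesis by (simp add: sum.remove[OF insert.prems(1) j0(1)])
    qed
    have "(\<Sum>j\<in>J. ?d j * f j i') = 0" if "i' \<in> insert i I" for i'
    proof (cases "i' = i")
      case True
      then show ?thesis using j0 unfolding split by simp
    next
      case False
      have "(\<Sum>j\<in>J - {j0}. d j * ?f j i')
          = (\<Sum>j\<in>J - {j0}. d j * f j i') - ?s / f j0 i * f j0 i'"
        by (simp add: right_diff_distrib sum_subtractf sum_distrib_right sum_divide_distrib mult.assoc)
      then show ?thesis using d(2)[of i'] that False unfolding split by simp
    qed
    moreover have "\<exists>j\<in>J. ?d j \<noteq> 0" using d(1) by auto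
    ultimately show ?thesis by blast
  qed
qed

text \<open>Moving the coefficients along a linear dependence until one of them reaches zero removes
  a vector. The bound on \<open>card J'\<close> does not depend on \<open>J\<close>; this lets a
  nearest point be sought over a compact set of parameters.\<close>

lemma conic_caratheodory:
  fixes f :: "'j \<Rightarrow> 'i \<Rightarrow> real"
  assumes "finite I" "finite J" "\<And>j. j \<in> J \<Longrightarrow> 0 \<le> c j"
  shows "\<exists>J' c'. J' \<subseteq> J \<and> card J' \<le> card I \<and> (\<forall>j\<in>J'. 0 \<le> c' j) \<and>
    (\<forall>i\<in>I. (\<Sum>j\<in>J. c j * f j i) = (\<Sum>j\<in>J'. c' j * f j i))"
  using assms(2,3)
proof (induction J arbitrary: c rule: finite_psubset_induct)
  case (psubset J)
  show ?case
  proof (cases "card J \<le> card I")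
    case True
    with psubset.prems show ?thesis by blast
  next
    case False
    then obtain d0 where d0: "\<exists>j\<in>J. d0 j \<noteq> 0" "\<And>i. i \<in> I \<Longrightarrow> (\<Sum>j\<in>J. d0 j * f j i) = 0"
      using linear_dependence[OF assms(1) psubset.hyps, of f] by auto
    \<comment> \<open>Up to a global sign the dependence has a positive coefficient, so that
      subtracting multiples of it eventually exhausts some \<open>c j\<close>.\<close>
    obtain d where d: "\<exists>j\<in>J. d j > 0" "\<And>i. i \<in> I \<Longrightarrow> (\<Sum>j\<in>J. d j * f j i) = 0"
    proof (cases "\<exists>j\<in>J. d0 j > 0")
      case True
      then show ?thesis using d0 that by blast
    next
      case False
      then have "\<exists>j\<in>J. 0 < - d0 j" using d0(1) by (metis neg_0_less_iff_less not_less_iff_gr_or_eq)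
      then show ?thesis using d0(2) by (intro that[of "\<lambda>j. - d0 j"]) (auto simp: sum_negf)
    qed
    let ?J = "{j \<in> J. d j > 0}"
    \<comment> \<open>The largest step for which all \<open>c j - ?t * d j\<close> stay nonnegative;
      the minimizing index \<open>j1\<close> drops out.\<close>
    let ?t = "Min ((\<lambda>j. c j / d j) ` ?J)"
    have fin: "finite ((\<lambda>j. c j / d j) ` ?J)" "(\<lambda>j. c j / d j) ` ?J \<noteq> {}"
      using psubset.hyps d by auto
    obtain j1 where j1: "j1 \<in> J" "d j1 > 0" "?t = c j1 / d j1"
      using Min_in[OF fin] by auto
    have t0: "0 \<le> ?t" using j1 psubset.prems by simp
    have nn: "0 \<le> c j - ?t * d j" if "j \<in> J" for j
    proof (cases "d j > 0")
      case True
      then have "?t \<le> c j / d j" using fin that by (intro Min_le) auto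
      then show ?thesis using True by (simp add: field_simps)
    next
      case False
      then have "?t * d j \<le> 0" using t0 by (simp add: mult_nonneg_nonpos)
      then show ?thesis using psubset.prems[OF that] by simp
    qed
    have z: "c j1 - ?t * d j1 = 0" using j1 by simp
    have eq: "(\<Sum>j\<in>J. c j * f j i) = (\<Sum>j\<in>J - {j1}. (c j - ?t * d j) * f j i)" if "i \<in> I" for i
    proof -
      have "(\<Sum>j\<in>J. (c j - ?t * d j) * f j i) = (\<Sum>j\<in>J. c j * f j i) - ?t * (\<Sum>j\<in>J. d j * f j i)"
        by (simp add: left_diff_distrib sum_subtractf sum_distrib_left mult.assoc)
      then show ?thesis
        using d(2)[OF that] z sum.remove[OF psubset.hyps j1(1), of "\<lambda>j. (c j - ?t * d j) * f j i"]
        by simp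
    qed
    have "J - {j1} \<subset> J" using j1 by auto
    from psubset.IH[OF this, of "\<lambda>j. c j - ?t * d j"] nn
    obtain J' c' where "J' \<subseteq> J - {j1}" "card J' \<le> card I" "\<forall>j\<in>J'. 0 \<le> c' j"
      "\<forall>i\<in>I. (\<Sum>j\<in>J - {j1}. (c j - ?t * d j) * f j i) = (\<Sum>j\<in>J'. c' j * f j i)"
      by auto
    then show ?thesis using eq by (intro exI[of _ J'] exI[of _ c']) auto
  qed
qed

text \<open>Tychonoff's theorem. Vectors are encoded as functions on a whole type, so compactness is
  that of the product topology.\<close>

lemma compact_functions:
  assumes "compact (G :: 'b :: topological_space set)"
  shows "compact {f :: 'a \<Rightarrow> 'b. \<forall>a. f a \<in> G}"
proof -
  have "compactin (product_topology (\<lambda>_. euclidean) UNIV) (Pi\<^sub>E UNIV (\<lambda>_ :: 'a. G))"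
    using assms by (subst compactin_PiE) auto
  moreover have "Pi\<^sub>E UNIV (\<lambda>_ :: 'a. G) = {f. \<forall>a. f a \<in> G}" by (auto simp: PiE_def Pi_def)
  ultimately show ?thesis by (simp add: euclidean_product_topology)
qed

text \<open>The right-hand side of \<open>min\<close> is a quadratic polynomial in \<open>t\<close>
  whose derivative at 0 is twice this sum, and a derivative at a minimum cannot be negative.\<close>

lemma nearest_point_variational:
  fixes p x y :: "'i \<Rightarrow> real"
  assumes min: "\<And>t. 0 < t \<Longrightarrow> t \<le> 1 \<Longrightarrow>
    (\<Sum>i\<in>I. (p i - x i)\<^sup>2) \<le> (\<Sum>i\<in>I. ((1 - t) * p i + t * y i - x i)\<^sup>2)"
  shows "0 \<le> (\<Sum>i\<in>I. (p i - x i) * (y i - p i))"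
proof (rule ccontr)
  let ?a = "\<Sum>i\<in>I. (p i - x i) * (y i - p i)" and ?b = "\<Sum>i\<in>I. (y i - p i)\<^sup>2"
  assume neg: "\<not> 0 \<le> ?a"
  have b: "?b \<ge> 0" by (simp add: sum_nonneg)
  have ex: "(\<Sum>i\<in>I. ((1 - t) * p i + t * y i - x i)\<^sup>2)
      = (\<Sum>i\<in>I. (p i - x i)\<^sup>2) + (2 * t * ?a + t\<^sup>2 * ?b)" for t
  proof -
    have "((1 - t) * p i + t * y i - x i)\<^sup>2
        = (p i - x i)\<^sup>2 + (2 * t * ((p i - x i) * (y i - p i)) + t\<^sup>2 * (y i - p i)\<^sup>2)" for i
      by (simp add: power2_eq_square algebra_simps)
    then show ?thesis by (simp only: sum.distrib sum_distrib_left)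
  qed
  have pos: "0 \<le> 2 * ?a + t * ?b" if "0 < t" "t \<le> 1" for t
  proof -
    have "0 \<le> t * (2 * ?a + t * ?b)"
      using min[OF that] unfolding ex by (simp add: power2_eq_square algebra_simps)
    then show ?thesis using that by (simp add: zero_le_mult_iff)
  qed
  \<comment> \<open>Small enough for the quadratic term to be dominated: \<open>t * ?b\<close> is at
    most \<open>- ?a\<close>, hence \<open>2 * ?a + t * ?b\<close> is at most \<open>?a\<close>,
    which is negative. The summand 1 keeps the denominator positive when
    \<open>?b = 0\<close>.\<close>
  define t where "t = min 1 (- ?a / (?b + 1))"
  have "t \<le> - ?a / (?b + 1)" by (simp add: t_def)
  then have "t * (?b + 1) \<le> - ?a" using b by (subst (asm) pos_le_divide_eq) auto
  then have t: "0 < t" "t \<le> 1" "t * (?b + 1) \<le> - ?a"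
    using neg b by (auto simp: t_def intro!: divide_neg_pos)
  have "t * ?b \<le> - ?a" using t by (simp add: distrib_left)
  then show False using pos[OF t(1,2)] neg by simp
qed

text \<open>Bipolar theorem for the cone generated by a compact base \<open>G\<close>. If \<open>p\<close> is the point nearest to \<open>x\<close>
  among the conic combinations of total weight at most \<open>M\<close>, where \<open>M\<close> exceeds the value of the
  normalizing functional \<open>h\<close> at \<open>x\<close>, then \<open>p - x\<close> becomes nonnegative on \<open>G\<close> after adding the
  multiple \<open>- \<langle>p - x, p\<rangle> / M\<close> of \<open>h\<close>, and it separates \<open>x\<close> unless \<open>p = x\<close>.\<close>

lemma conic_separation:
  fixes G :: "('i \<Rightarrow> real) set" and x h :: "'i \<Rightarrow> real"
  assumes I: "finite I" and G: "compact G"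
    and h: "\<And>g. g \<in> G \<Longrightarrow> (\<Sum>i\<in>I. h i * g i) = 1"
    and dual: "\<And>w. (\<And>g. g \<in> G \<Longrightarrow> 0 \<le> (\<Sum>i\<in>I. w i * g i)) \<Longrightarrow> 0 \<le> (\<Sum>i\<in>I. w i * x i)"
  obtains N :: nat and c g where "\<And>l. l < N \<Longrightarrow> 0 \<le> c l" "\<And>l. l < N \<Longrightarrow> g l \<in> G"
    "\<And>i. i \<in> I \<Longrightarrow> x i = (\<Sum>l<N. c l * g l i)"
proof (cases "G = {}")
  case True
  have "0 \<le> - (\<Sum>i\<in>I. x i * x i)"
    using dual[of "\<lambda>i. - x i"] True by (simp add: sum_negf)
  then have "(\<Sum>i\<in>I. x i * x i) = 0" using sum_nonneg[of I "\<lambda>i. x i * x i"] by fastforce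
  then have "\<forall>i\<in>I. x i = 0" using I by (subst (asm) sum_nonneg_eq_0_iff) auto
  then show ?thesis using that[of 0] by simp
next
  case False
  then obtain g0 where g0: "g0 \<in> G" by auto
  define D where "D = card I"
  define M where "M = \<bar>\<Sum>i\<in>I. h i * x i\<bar> + 1"
  have M: "M > 0" "(\<Sum>i\<in>I. h i * x i) < M" by (auto simp: M_def)
  \<comment> \<open>Together with a family in \<open>G\<close>, an element of \<open>C\<close>
    describes a conic combination of \<open>D\<close> generators. Entries from \<open>D\<close> on
    do not affect \<open>F\<close>; they are confined to a bounded interval only for the sake of
    compactness.\<close>
  define C :: "(nat \<Rightarrow> real) set" where "C = {c. \<forall>j. c j \<in> {0..M}} \<inter> {c. (\<Sum>j<D. c j) \<le> M}"
  define F :: "(nat \<Rightarrow> real) \<times> (nat \<Rightarrow> 'i \<Rightarrow> real) \<Rightarrow> real" where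
    "F = (\<lambda>(c, g). \<Sum>i\<in>I. ((\<Sum>j<D. c j * g j i) - x i)\<^sup>2)"
  have "closed {c :: nat \<Rightarrow> real. (\<Sum>j<D. c j) \<le> M}"
    by (intro closed_Collect_le continuous_intros continuous_on_product_coordinates)
  then have "compact C" unfolding C_def by (intro compact_Int_closed compact_functions) auto
  then have cpt: "compact (C \<times> {g :: nat \<Rightarrow> _. \<forall>j. g j \<in> G})"
    by (intro compact_Times compact_functions G)
  have ne: "C \<times> {g :: nat \<Rightarrow> _. \<forall>j. g j \<in> G} \<noteq> {}"
  proof -
    have "(\<lambda>_. 0) \<in> C" using M by (auto simp: C_def)
    then show ?thesis using g0 by auto
  qed
  have ev: "continuous_on UNIV (\<lambda>g :: nat \<Rightarrow> 'i \<Rightarrow> real. g j i)" for j i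
    using continuous_on_compose2[OF continuous_on_product_coordinates[of i]
        continuous_on_product_coordinates[of j]] by auto
  have "continuous_on (C \<times> {g :: nat \<Rightarrow> _. \<forall>j. g j \<in> G}) F"
    unfolding F_def case_prod_unfold
    by (intro continuous_intros continuous_on_compose2[OF ev continuous_on_snd]
        continuous_on_compose2[OF continuous_on_product_coordinates continuous_on_fst]) auto
  from continuous_attains_inf[OF cpt ne this]
  obtain c g where cg: "c \<in> C" "\<And>j. g j \<in> G"
    and min: "\<And>c' g'. c' \<in> C \<Longrightarrow> (\<And>j. g' j \<in> G) \<Longrightarrow> F (c, g) \<le> F (c', g')" by fastforce
  have c0: "0 \<le> c j" for j using cg by (auto simp: C_def)
  define p where "p = (\<lambda>i. \<Sum>j<D. c j * g j i)"
  have hsum: "(\<Sum>i\<in>I. h i * (\<Sum>j\<in>J. e j * f j i)) = (\<Sum>j\<in>J. e j)"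
    if "\<And>j. j \<in> J \<Longrightarrow> f j \<in> G" for J :: "nat set" and e f
  proof -
    have "(\<Sum>i\<in>I. h i * (\<Sum>j\<in>J. e j * f j i)) = (\<Sum>j\<in>J. e j * (\<Sum>i\<in>I. h i * f j i))"
      unfolding sum_distrib_left by (subst sum.swap) (simp add: mult_ac)
    also have "\<dots> = (\<Sum>j\<in>J. e j)" using that h by simp
    finally show ?thesis .
  qed
  have near: "(\<Sum>i\<in>I. (p i - x i)\<^sup>2) \<le> (\<Sum>i\<in>I. ((\<Sum>j\<in>J. e j * f j i) - x i)\<^sup>2)"
    if J: "finite J" "\<And>j. j \<in> J \<Longrightarrow> 0 \<le> e j \<and> f j \<in> G" "(\<Sum>j\<in>J. e j) \<le> M"
    for J :: "nat set" and e f
  proof -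
    obtain J' e' where J': "J' \<subseteq> J" "card J' \<le> D" "\<And>j. j \<in> J' \<Longrightarrow> 0 \<le> e' j"
      and eq: "\<And>i. i \<in> I \<Longrightarrow> (\<Sum>j\<in>J. e j * f j i) = (\<Sum>j\<in>J'. e' j * f j i)"
      using conic_caratheodory[OF I J(1), of e f] J(2) unfolding D_def by blast
    have fin: "finite J'" using J' J finite_subset by blast
    \<comment> \<open>Since \<open>h\<close> is 1 on \<open>G\<close>, it reads the total weight off
      the point itself, so the reduction to at most \<open>D\<close> terms preserves the
      weight.\<close>
    have "(\<Sum>j\<in>J'. e' j) = (\<Sum>i\<in>I. h i * (\<Sum>j\<in>J'. e' j * f j i))"
      by (rule hsum[symmetric]) (use J J' in blast)
    also have "\<dots> = (\<Sum>j\<in>J. e j)" using hsum[of J f e] J eq by simp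
    finally have le: "(\<Sum>j\<in>J'. e' j) \<le> M" using J by simp
    obtain b where b: "bij_betw b {..<card J'} J'"
      using ex_bij_betw_nat_finite[OF fin] by (auto simp: atLeast0LessThan)
    let ?c = "\<lambda>l. if l < card J' then e' (b l) else 0"
    let ?g = "\<lambda>l. if l < card J' then f (b l) else g0"
    have bJ: "b l \<in> J'" if "l < card J'" for l using b that by (auto simp: bij_betw_def)
    have sub: "(\<Sum>l<D. if l < card J' then u (b l) else 0) = (\<Sum>j\<in>J'. u j)" for u :: "nat \<Rightarrow> real"
    proof -
      have "(\<Sum>l<D. if l < card J' then u (b l) else 0) = (\<Sum>l<card J'. u (b l))"
        using J' by (intro sum.mono_neutral_cong_right) auto
      also have "\<dots> = (\<Sum>j\<in>J'. u j)" by (rule sum.reindex_bij_betw[OF b])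
      finally show ?thesis .
    qed
    have "e' j \<le> M" if "j \<in> J'" for j
      using member_le_sum[of j J' e'] that fin J' le by fastforce
    then have "?c \<in> C" using J' bJ le sub[of e'] M by (auto simp: C_def)
    moreover have "?g l \<in> G" for l using bJ J J' g0 by auto
    ultimately have le: "F (c, g) \<le> F (?c, ?g)" by (rule min)
    have "(\<Sum>l<D. ?c l * ?g l i) = (\<Sum>l<D. if l < card J' then e' (b l) * f (b l) i else 0)" for i
      by (intro sum.cong) auto
    then have "(\<Sum>l<D. ?c l * ?g l i) = (\<Sum>j\<in>J'. e' j * f j i)" for i
      using sub[of "\<lambda>j. e' j * f j i"] by simp
    then have "F (?c, ?g) = (\<Sum>i\<in>I. ((\<Sum>j\<in>J. e j * f j i) - x i)\<^sup>2)"
      using eq by (simp add: F_def)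
    with le show ?thesis by (simp add: F_def p_def)
  qed
  have var: "0 \<le> (\<Sum>i\<in>I. (p i - x i) * (s * y i - p i))" if y: "y \<in> G" and s: "0 \<le> s" "s \<le> M" for y s
  proof (rule nearest_point_variational)
    fix t :: real assume t: "0 < t" "t \<le> 1"
    \<comment> \<open>A point on the segment from \<open>p\<close> to \<open>s * y\<close>: the
      \<open>D\<close> generators of \<open>p\<close> are damped by \<open>1 - t\<close>, and
      \<open>y\<close> enters as an extra generator at index \<open>D\<close>. The extra term is
      harmless because \<open>near\<close> allows any finite number.\<close>
    let ?e = "\<lambda>j. if j < D then (1 - t) * c j else t * s" and ?f = "\<lambda>j. if j < D then g j else y"
    have "(\<Sum>j<D. c j) \<le> M" using cg by (auto simp: C_def)
    then have "(1 - t) * (\<Sum>j<D. c j) + t * s \<le> (1 - t) * M + t * M"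
      using t s by (intro add_mono mult_left_mono) auto
    then have "(\<Sum>j<Suc D. ?e j) \<le> M" by (simp add: sum_distrib_left algebra_simps)
    then have "(\<Sum>i\<in>I. (p i - x i)\<^sup>2) \<le> (\<Sum>i\<in>I. ((\<Sum>j<Suc D. ?e j * ?f j i) - x i)\<^sup>2)"
      using t s c0 cg y by (intro near) auto
    moreover have "(\<Sum>j<Suc D. ?e j * ?f j i) = (1 - t) * p i + t * (s * y i)" for i
      by (simp add: p_def sum_distrib_left mult.assoc del: mult_cancel_left)
    ultimately show "(\<Sum>i\<in>I. (p i - x i)\<^sup>2) \<le> (\<Sum>i\<in>I. ((1 - t) * p i + t * (s * y i) - x i)\<^sup>2)"
      by (simp only:)
  qed
  define a where "a = (\<Sum>i\<in>I. (p i - x i) * p i)"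
  \<comment> \<open>Taking \<open>s = 0\<close> moves \<open>p\<close> towards the apex of the
    cone.\<close>
  have a0: "a \<le> 0" using var[OF g0, of 0] M by (simp add: a_def sum_negf)
  let ?w = "\<lambda>i. p i - x i - a / M * h i"
  have ex: "(\<Sum>i\<in>I. ?w i * y i) = (\<Sum>i\<in>I. (p i - x i) * y i) - a / M * (\<Sum>i\<in>I. h i * y i)" for y
    by (simp add: left_diff_distrib sum_subtractf sum_distrib_left mult.assoc)
  have "0 \<le> (\<Sum>i\<in>I. ?w i * x i)"
  proof (rule dual)
    fix y assume y: "y \<in> G"
    have "0 \<le> M * (\<Sum>i\<in>I. (p i - x i) * y i) - a"
      using var[OF y, of M] M
      by (simp add: a_def right_diff_distrib sum_subtractf sum_distrib_left mult_ac)
    then show "0 \<le> (\<Sum>i\<in>I. ?w i * y i)" unfolding ex h[OF y] using M by (simp add: field_simps)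
  qed
  moreover have "(\<Sum>i\<in>I. (p i - x i) * x i) = a - (\<Sum>i\<in>I. (p i - x i)\<^sup>2)"
    unfolding a_def by (simp add: power2_eq_square algebra_simps flip: sum_subtractf)
  moreover have "a \<le> a / M * (\<Sum>i\<in>I. h i * x i)"
  proof -
    have "a * M \<le> a * (\<Sum>i\<in>I. h i * x i)" using a0 M by (intro mult_left_mono_neg) auto
    then show ?thesis using M by (simp add: field_simps)
  qed
  ultimately have "(\<Sum>i\<in>I. (p i - x i)\<^sup>2) \<le> 0" unfolding ex by linarith
  then have "(\<Sum>i\<in>I. (p i - x i)\<^sup>2) = 0" by (intro antisym sum_nonneg) auto
  then have "\<forall>i\<in>I. p i = x i" using I by (subst (asm) sum_nonneg_eq_0_iff) auto
  then show ?thesis using that[of D c g] c0 cg by (simp add: p_def)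
qed

subsection \<open>Positive semidefinite and separable matrices\<close>

definition qform :: "nat \<Rightarrow> (nat \<Rightarrow> nat \<Rightarrow> complex) \<Rightarrow> (nat \<Rightarrow> complex) \<Rightarrow> complex" where
  "qform d M v = (\<Sum>i<d. \<Sum>j<d. M i j * v j * cnj (v i))"

lemma qform_two_point:
  assumes "i < d" "j < d" "i \<noteq> j"
  shows "qform d M (\<lambda>l. if l = i then x else if l = j then y else 0) =
    M i i * x * cnj x + M i j * y * cnj x + M j i * x * cnj y + M j j * y * cnj y"
proof -
  let ?v = "\<lambda>l. if l = i then x else if l = j then y else 0"
  have pick: "(\<Sum>l<d. f l) = f i + f j" if "\<And>l. l \<noteq> i \<Longrightarrow> l \<noteq> j \<Longrightarrow> f l = 0" for f :: "nat \<Rightarrow> complex"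
  proof -
    have "(\<Sum>l<d. f l) = (\<Sum>l\<in>{i, j}. f l)"
      using that assms by (intro sum.mono_neutral_right) auto
    then show ?thesis using assms by simp
  qed
  have "(\<Sum>l'<d. M l l' * ?v l' * cnj (?v l)) = (M l i * x + M l j * y) * cnj (?v l)" for l
    using assms by (subst pick) (auto simp: algebra_simps)
  then have "qform d M ?v = (\<Sum>l<d. (M l i * x + M l j * y) * cnj (?v l))"
    by (simp only: qform_def)
  also have "\<dots> = (M i i * x + M i j * y) * cnj x + (M j i * x + M j j * y) * cnj y"
    using assms by (subst pick) auto
  finally show ?thesis by (simp add: algebra_simps)
qed

lemma qform_one_point:
  assumes "i < d"
  shows "qform d M (\<lambda>l. if l = i then x else 0) = M i i * x * cnj x"
proof -
  let ?v = "\<lambda>l. if l = i then x else 0"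
  have "(\<Sum>l'<d. M l l' * ?v l' * cnj (?v l)) = (if l = i then M i i * x * cnj x else 0)" for l
  proof -
    have "(\<Sum>l'<d. M l l' * ?v l' * cnj (?v l)) = (\<Sum>l'<d. if l' = i then M l i * x * cnj (?v l) else 0)"
      by (intro sum.cong) auto
    then show ?thesis using assms by simp
  qed
  then show ?thesis using assms by (simp add: qform_def)
qed

text \<open>Polarization with entries 1 and y at the positions \<open>i\<close> and
  \<open>j\<close>: y = 1 makes the sum of the two off-diagonal entries real, and y = \<i> makes
  their difference purely imaginary.\<close>

lemma hermitian_if_qform_real:
  assumes real: "\<And>v. qform d M v \<in> \<real>" and ij: "i < d" "j < d"
  shows "M j i = cnj (M i j)"
proof (cases "i = j")
  case True
  have "M i i \<in> \<real>" using real[of "\<lambda>l. if l = i then 1 else 0"] ij qform_one_point[of i d M 1] by simp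
  then show ?thesis using True by (simp add: Reals_cnj_iff)
next
  case False
  have d: "M l l \<in> \<real>" if "l < d" for l
    using real[of "\<lambda>l'. if l' = l then 1 else 0"] that qform_one_point[of l d M 1] by simp
  have "M i i + M i j * y + M j i * cnj y + M j j * y * cnj y \<in> \<real>" for y
    using real[of "\<lambda>l. if l = i then 1 else if l = j then y else 0"] qform_two_point[OF ij False, of M 1 y]
    by simp
  from this[of 1] this[of \<i>] d[OF ij(1)] d[OF ij(2)]
  show ?thesis by (simp add: complex_is_Real_iff complex_eq_iff)
qed

lemma mat_adjoint_index:
  assumes "A \<in> carrier_mat d d" "i < d" "j < d"
  shows "mat_adjoint A $$ (i, j) = cnj (A $$ (j, i))"
  using assms by (simp add: mat_adjoint_def mat_of_rows_index)

lemma hermD: "A \<in> herm d \<Longrightarrow> i < d \<Longrightarrow> j < d \<Longrightarrow> A $$ (j, i) = cnj (A $$ (i, j))"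
proof -
  assume "A \<in> herm d" and ij: "i < d" "j < d"
  then have "A \<in> carrier_mat d d" "mat_adjoint A = A" by (simp_all add: herm_def)
  with mat_adjoint_index[of A d j i] ij show ?thesis by metis
qed

lemma hermI:
  assumes "A \<in> carrier_mat d d" "\<And>i j. i < d \<Longrightarrow> j < d \<Longrightarrow> A $$ (j, i) = cnj (A $$ (i, j))"
  shows "A \<in> herm d"
proof -
  have "mat_adjoint A = A"
  proof (rule eq_matI)
    fix i j assume "i < dim_row A" "j < dim_col A"
    then have ij: "i < d" "j < d" using assms(1) by auto
    show "mat_adjoint A $$ (i, j) = A $$ (i, j)"
      unfolding mat_adjoint_index[OF assms(1) ij] by (rule assms(2)[OF ij(2,1), symmetric])
  qed (use assms(1) in \<open>auto simp: mat_adjoint_def\<close>)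
  then show ?thesis using assms by (simp add: herm_def)
qed

text \<open>Replaces vectors with a carrier by functions on \<open>nat\<close>, whose entries from
  \<open>d\<close> on are ignored. Self-adjointness is recovered from the reality of the
  form.\<close>

lemma PSD_iff:
  "A \<in> PSD d \<longleftrightarrow> A \<in> carrier_mat d d \<and> (\<forall>v. 0 \<le> qform d (\<lambda>i j. A $$ (i, j)) v)"
proof -
  have form: "(A *\<^sub>v v) \<bullet>c v = qform d (\<lambda>i j. A $$ (i, j)) (($) v)"
    if "A \<in> carrier_mat d d" "v \<in> carrier_vec d" for v
    using that
    by (auto simp: qform_def scalar_prod_def mult_mat_vec_def row_def sum_distrib_right
        atLeast0LessThan intro!: sum.cong)
  have q: "qform d M (($) (vec d v)) = qform d M v" for M v
    by (auto simp: qform_def intro!: sum.cong)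
  show ?thesis
  proof (intro iffI conjI allI; (elim conjE)?)
    assume A: "A \<in> PSD d"
    then show c: "A \<in> carrier_mat d d" by (simp add: PSD_def herm_def)
    show "0 \<le> qform d (\<lambda>i j. A $$ (i, j)) v" for v
    proof -
      have "0 \<le> (A *\<^sub>v vec d v) \<bullet>c vec d v" using A vec_carrier[of d v] unfolding PSD_def by blast
      then show ?thesis using form[OF c vec_carrier] by (simp only: q)
    qed
  next
    assume A: "A \<in> carrier_mat d d" "\<forall>v. 0 \<le> qform d (\<lambda>i j. A $$ (i, j)) v"
    have "A \<in> herm d"
      using A by (intro hermI hermitian_if_qform_real[of d "\<lambda>i j. A $$ (i, j)"])
        (auto simp: complex_is_Real_iff less_eq_complex_def)
    then show "A \<in> PSD d" using A form by (simp add: PSD_def)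
  qed
qed

lemma PSD_carrier: "A \<in> PSD d \<Longrightarrow> A \<in> carrier_mat d d"
  by (simp add: PSD_iff)

text \<open>Cholesky decomposition: \<open>M\<close> is reduced to the Schur complement of its last diagonal entry.
  If that entry vanishes then so does its row, and the divisions by \<open>0\<close> give the right value.\<close>

lemma cholesky:
  assumes "\<And>v. 0 \<le> qform n M v"
  shows "\<exists>u. \<forall>r<n. \<forall>s<n. M r s = (\<Sum>l<n. u l r * cnj (u l s))"
  using assms
proof (induction n arbitrary: M)
  case (Suc n)
  have herm: "M s r = cnj (M r s)" if "r < Suc n" "s < Suc n" for r s
    using Suc.prems that
    by (intro hermitian_if_qform_real[of "Suc n" M]) (auto simp: complex_is_Real_iff less_eq_complex_def)
  have diag: "0 \<le> M r r" if "r < Suc n" for r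
    using Suc.prems[of "\<lambda>l. if l = r then 1 else 0"] that by (simp add: qform_one_point)
  define m where "m = M n n"
  have m: "0 \<le> m" "m = complex_of_real (Re m)" "0 \<le> Re m"
    using diag[of n] by (auto simp: m_def less_eq_complex_def complex_eq_iff)
  have z: "M r n = 0" if "m = 0" "r < n" for r
  proof (rule ccontr)
    assume nz: "M r n \<noteq> 0"
    \<comment> \<open>The vector with entry 1 at \<open>r\<close> and
      \<open>- t * cnj (M r n)\<close> at \<open>n\<close> has form value
      \<open>M r r - 2 * t * ?b\<close>, and the choice of \<open>t\<close> turns its real part into
      \<open>- Re (M r r) - 2\<close>.\<close>
    let ?b = "(cmod (M r n))\<^sup>2"
    define t where "t = (Re (M r r) + 1) / ?b"
    have "0 \<le> M r r - 2 * complex_of_real t * (M r n * cnj (M r n))"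
      using Suc.prems[of "\<lambda>l. if l = r then 1 else if l = n then - of_real t * cnj (M r n) else 0"]
        that qform_two_point[of r "Suc n" n M 1 "- of_real t * cnj (M r n)"] herm[of r n]
      by (simp add: m_def algebra_simps)
    then have "0 \<le> Re (M r r) - 2 * t * ?b"
      by (simp add: less_eq_complex_def flip: complex_norm_square)
    then have "0 \<le> - Re (M r r) - 2" using nz by (simp add: t_def)
    then show False using diag[of r] that by (simp add: less_eq_complex_def)
  qed
  define M' where "M' = (\<lambda>r s. M r s - M r n * M n s / m)"
  have "0 \<le> qform n M' v" for v
  proof -
    define b where "b = (\<Sum>j<n. M n j * v j)"
    \<comment> \<open>Completing the square: for nonzero \<open>m\<close> this last coordinate
      minimizes the form, and the minimum is the form of the Schur complement. For
      \<open>m = 0\<close> it is 0, and the correction term vanishes as well.\<close>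
    define y where "y = - b / m"
    have cb: "(\<Sum>i<n. M i n * cnj (v i)) = cnj b"
      unfolding b_def by (auto simp: cnj_sum intro!: sum.cong herm[of n])
    have "qform (Suc n) M (v(n := y)) =
        qform n M v + (\<Sum>i<n. M i n * cnj (v i)) * y + b * cnj y + m * y * cnj y"
      by (simp add: qform_def b_def m_def sum.distrib sum_distrib_right sum_distrib_left mult_ac)
    also have "\<dots> = qform n M v - cnj b * b / m"
    proof (cases "m = 0")
      case True
      then show ?thesis by (simp add: y_def)
    next
      case False
      have "cnj m = m" using m(2) complex_cnj_complex_of_real[of "Re m"] by simp
      then show ?thesis using False unfolding cb by (simp add: y_def field_simps)
    qed
    also have "cnj b * b = (\<Sum>i<n. \<Sum>j<n. (M i n * cnj (v i)) * (M n j * v j))"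
      unfolding cb[symmetric] unfolding b_def by (rule sum_product)
    also have "qform n M v - \<dots> / m = qform n M' v"
      unfolding qform_def M'_def
      by (simp add: left_diff_distrib right_diff_distrib sum_subtractf sum_divide_distrib mult_ac)
    finally show ?thesis using Suc.prems by metis
  qed
  then obtain u where u: "\<And>r s. r < n \<Longrightarrow> s < n \<Longrightarrow> M' r s = (\<Sum>l<n. u l r * cnj (u l s))"
    using Suc.IH[of M'] by blast
  \<comment> \<open>The vectors obtained for the Schur complement are extended by 0, and the last
    column of \<open>M\<close>, scaled by the square root of the pivot, is added as the vector with
    index \<open>n\<close>. For \<open>m = 0\<close> the division makes this vector zero.\<close>
  define w where "w = (\<lambda>l r. if l < n then (if r < n then u l r else 0) else M r n / of_real (sqrt (Re m)))"
  have rt: "complex_of_real (sqrt (Re m)) * complex_of_real (sqrt (Re m)) = m"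
    using m by (simp flip: of_real_mult)
  have w: "(\<Sum>l<Suc n. w l r * cnj (w l s)) =
      (if r < n \<and> s < n then M' r s else 0) + M r n * M n s / m" if "r < Suc n" "s < Suc n" for r s
  proof -
    have "w n r * cnj (w n s) = M r n * M n s / m"
      unfolding w_def using herm[of s n] that rt by simp
    then show ?thesis using u[of r s] by (simp add: w_def)
  qed
  have "M r s = (\<Sum>l<Suc n. w l r * cnj (w l s))" if rs: "r < Suc n" "s < Suc n" for r s
  proof (cases "r < n \<and> s < n")
    case True
    then show ?thesis using w[OF rs] by (simp add: M'_def)
  next
    case False
    then consider "r = n" | "s = n" using rs by linarith
    then show ?thesis
    proof cases
      case 1
      have "M n s = 0" if "m = 0"
        using z[OF that, of s] herm[of s n] rs that by (cases "s = n") (auto simp: m_def)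
      then show ?thesis using w[OF rs] 1 by (auto simp: m_def)
    next
      case 2
      have "M r n = 0" if "m = 0"
        using z[OF that, of r] rs that by (cases "r = n") (auto simp: m_def)
      then show ?thesis using w[OF rs] 2 by (auto simp: m_def)
    qed
  qed
  then show ?case by blast
qed simp

lemma PSD_rank_one_sum:
  assumes "x \<in> PSD d"
  obtains u where "\<And>r s. r < d \<Longrightarrow> s < d \<Longrightarrow> x $$ (r, s) = (\<Sum>l<d. u l r * cnj (u l s))"
  using cholesky[of d "\<lambda>i j. x $$ (i, j)"] assms unfolding PSD_iff by blast

text \<open>Writing \<open>y\<close> as a sum of rank-one matrices u u^* turns the trace into a sum
  of values of the quadratic form of \<open>x\<close>.\<close>

lemma PSD_mult_trace_nonneg:
  assumes "x \<in> PSD d" "y \<in> PSD d"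
  shows "0 \<le> mat_trace (x * y)"
proof -
  obtain u where u: "\<And>r s. r < d \<Longrightarrow> s < d \<Longrightarrow> y $$ (r, s) = (\<Sum>l<d. u l r * cnj (u l s))"
    using PSD_rank_one_sum[OF assms(2)] by blast
  have "mat_trace (x * y) = (\<Sum>i<d. \<Sum>j<d. x $$ (i, j) * y $$ (j, i))"
    using assms[THEN PSD_carrier] by (auto simp: mat_trace_def scalar_prod_def atLeast0LessThan intro!: sum.cong)
  also have "\<dots> = (\<Sum>i<d. \<Sum>j<d. \<Sum>l<d. x $$ (i, j) * u l j * cnj (u l i))"
    by (simp add: u sum_distrib_left mult.assoc)
  also have "\<dots> = (\<Sum>i<d. \<Sum>l<d. \<Sum>j<d. x $$ (i, j) * u l j * cnj (u l i))"
    by (intro sum.cong refl sum.swap)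
  also have "\<dots> = (\<Sum>l<d. qform d (\<lambda>i j. x $$ (i, j)) (u l))"
    unfolding qform_def by (rule sum.swap)
  also have "0 \<le> \<dots>" using assms(1) by (intro sum_nonneg) (simp add: PSD_iff)
  finally show ?thesis .
qed

definition rank_one :: "nat \<Rightarrow> (nat \<Rightarrow> complex) \<Rightarrow> complex mat" where
  "rank_one d u = mat d d (\<lambda>(r, s). u r * cnj (u s))"

lemma mult_cnj_nonneg: "0 \<le> z * cnj z" for z :: complex
  by (simp add: less_eq_complex_def)

lemma smult_rank_one_PSD:
  assumes "0 \<le> c"
  shows "complex_of_real c \<cdot>\<^sub>m rank_one d u \<in> PSD d"
proof -
  have "qform d (\<lambda>i j. (complex_of_real c \<cdot>\<^sub>m rank_one d u) $$ (i, j)) v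
      = of_real c * ((\<Sum>i<d. u i * cnj (v i)) * cnj (\<Sum>i<d. u i * cnj (v i)))" for v
  proof -
    have "(\<Sum>i<d. u i * cnj (v i)) * cnj (\<Sum>i<d. u i * cnj (v i))
        = (\<Sum>i<d. \<Sum>j<d. (u i * cnj (v i)) * (cnj (u j) * v j))"
      by (simp add: sum_product)
    also have "of_real c * \<dots> = (\<Sum>i<d. \<Sum>j<d. of_real c * ((u i * cnj (v i)) * (cnj (u j) * v j)))"
      by (simp only: sum_distrib_left)
    also have "\<dots> = qform d (\<lambda>i j. (complex_of_real c \<cdot>\<^sub>m rank_one d u) $$ (i, j)) v"
      unfolding qform_def by (intro sum.cong refl) (simp add: rank_one_def)
    finally show ?thesis by (rule sym)
  qed
  moreover have "0 \<le> of_real c * (z * cnj z)" for z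
    using assms by (intro mult_nonneg_nonneg[of "of_real c" "z * cnj z"]) (simp_all add: less_eq_complex_def)
  ultimately show ?thesis by (simp only: PSD_iff) (simp add: rank_one_def)
qed

section \<open>Product vectors and the compact base of the separable cone\<close>

lemma sum_digits:
  "(\<Sum>r<n * d. f (r div d) (r mod d)) = (\<Sum>i<n. \<Sum>j<d. f i j)" for f :: "nat \<Rightarrow> nat \<Rightarrow> 'a :: comm_monoid_add"
proof -
  have "(\<Sum>r = i * d..<i * d + d. f (r div d) (r mod d)) = (\<Sum>j<d. f i j)" for i
    using sum.shift_bounds_nat_ivl[of "\<lambda>r. f (r div d) (r mod d)" 0 "i * d" d]
    by (simp add: atLeast0LessThan add.commute)
  then show ?thesis using sum.nat_group[of "\<lambda>r. f (r div d) (r mod d)" d n] by simp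
qed

text \<open>The product vector u \<otimes> v in the index convention of \<open>kron\<close>.\<close>

definition pure_vec :: "nat \<Rightarrow> (nat \<Rightarrow> complex) \<Rightarrow> (nat \<Rightarrow> complex) \<Rightarrow> nat \<Rightarrow> complex" where
  "pure_vec d u v r = u (r div d) * v (r mod d)"

lemma digit_bounds:
  fixes r n d :: nat
  assumes "r < n * d"
  shows "r div d < n" "r mod d < d"
proof -
  from assms show "r div d < n" by (simp add: less_mult_imp_div_less)
  from assms have "d > 0" by (cases d) auto
  then show "r mod d < d" by simp
qed

lemma kron_rank_one:
  "kron (c \<cdot>\<^sub>m rank_one n u) (rank_one d v) = c \<cdot>\<^sub>m rank_one (n * d) (pure_vec d u v)"
  by (rule eq_matI) (auto simp: kron_def rank_one_def pure_vec_def digit_bounds)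

lemma compact_disc_complex: "compact {z. cmod z \<le> r}"
proof -
  let ?f = "\<lambda>p. complex_of_real (fst p) + \<i> * complex_of_real (snd p)"
  have "compact (?f ` ({- r..r} \<times> {- r..r}))"
    by (intro compact_continuous_image compact_Times compact_Icc continuous_intros)
  then have "compact (?f ` ({- r..r} \<times> {- r..r}) \<inter> {z. cmod z \<le> r})"
    by (rule compact_Int_closed) (intro closed_Collect_le continuous_intros)
  moreover have "{z. cmod z \<le> r} \<subseteq> ?f ` ({- r..r} \<times> {- r..r})"
  proof
    fix z :: complex assume "z \<in> {z. cmod z \<le> r}"
    then have "(Re z, Im z) \<in> {- r..r} \<times> {- r..r}"
      using abs_Re_le_cmod[of z] abs_Im_le_cmod[of z] by auto
    moreover have "z = ?f (Re z, Im z)" by (simp add: complex_eq_iff)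
    ultimately show "z \<in> ?f ` ({- r..r} \<times> {- r..r})" by blast
  qed
  ultimately show ?thesis by (simp add: Int_absorb1)
qed

text \<open>The bound on every entry, also on those beyond \<open>n\<close>, places the set inside a
  product of compact discs; the norm condition alone would leave the tail free.\<close>

lemma compact_unit_vectors:
  "compact {u :: nat \<Rightarrow> complex. (\<forall>i. cmod (u i) \<le> 1) \<and> (\<Sum>i<n. (cmod (u i))\<^sup>2) = 1}"
proof -
  have "closed {u :: nat \<Rightarrow> complex. (\<Sum>i<n. (cmod (u i))\<^sup>2) = 1}"
    by (intro closed_Collect_eq continuous_intros continuous_on_product_coordinates)
  then have "compact ({u :: nat \<Rightarrow> complex. \<forall>i. u i \<in> {z. cmod z \<le> 1}} \<inter> {u. (\<Sum>i<n. (cmod (u i))\<^sup>2) = 1})"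
    by (intro compact_Int_closed compact_functions compact_disc_complex)
  then show ?thesis by (simp add: Collect_conj_eq)
qed

text \<open>The zero vector has no normalization and is represented by \<open>a = 0\<close> with an
  unconstrained \<open>u'\<close>.\<close>

lemma normalize_vector:
  fixes u :: "nat \<Rightarrow> complex"
  obtains a u' where "\<And>i. i < n \<Longrightarrow> u i = of_real a * u' i" "a = 0 \<or> (\<forall>i. cmod (u' i) \<le> 1) \<and> (\<Sum>i<n. (cmod (u' i))\<^sup>2) = 1"
proof (cases "\<forall>i<n. u i = 0")
  case True
  then show ?thesis using that[of 0 u] by simp
next
  case False
  define S where "S = (\<Sum>i<n. (cmod (u i))\<^sup>2)"
  from False obtain i where i: "i < n" "u i \<noteq> 0" by auto
  then have "0 < (cmod (u i))\<^sup>2" "(cmod (u i))\<^sup>2 \<le> S"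
    unfolding S_def by (auto intro: member_le_sum)
  then have S: "0 < S" by linarith
  let ?u = "\<lambda>i. if i < n then u i / of_real (sqrt S) else 0"
  have "(\<Sum>i<n. (cmod (?u i))\<^sup>2) = (\<Sum>i<n. (cmod (u i))\<^sup>2 / S)"
    using S by (intro sum.cong) (auto simp: norm_divide power_divide)
  also have "\<dots> = 1" using S by (simp add: S_def flip: sum_divide_distrib)
  finally have one: "(\<Sum>i<n. (cmod (?u i))\<^sup>2) = 1" .
  have "cmod (?u i) \<le> 1" for i
  proof (cases "i < n")
    case True
    then have "(cmod (?u i))\<^sup>2 \<le> (\<Sum>i<n. (cmod (?u i))\<^sup>2)" by (intro member_le_sum) auto
    then show ?thesis unfolding one by (auto intro: power2_le_imp_le[of _ 1] simp del: if_split)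
  qed simp
  with one S that[of "sqrt S" ?u] show ?thesis by auto
qed

text \<open>Selecting the real or imaginary part by a Boolean makes a complex matrix a real function
  on triples, the format of \<open>conic_separation\<close>.\<close>

definition cpart :: "bool \<Rightarrow> complex \<Rightarrow> real" where
  "cpart b z = (if b then Re z else Im z)"

text \<open>Products of positive matrices are stable under nonnegative scaling, so conic
  combinations are already convex ones: all weights are made equal, and the coefficients are
  absorbed into the first tensor factor.\<close>

lemma min_tensor_if_rank_one_sum:
  fixes N :: nat and c :: "nat \<Rightarrow> real" and u v :: "nat \<Rightarrow> nat \<Rightarrow> complex"
  assumes X: "X \<in> carrier_mat (n * d) (n * d)"
    and c: "\<And>l. l < N \<Longrightarrow> 0 \<le> c l"
    and eq: "\<And>r s. r < n * d \<Longrightarrow> s < n * d \<Longrightarrow> X $$ (r, s) =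
      (\<Sum>l<N. of_real (c l) * (pure_vec d (u l) (v l) r * cnj (pure_vec d (u l) (v l) s)))"
  shows "X \<in> min_tensor n d"
proof -
  \<comment> \<open>Padding by a zero term avoids a case distinction for the empty combination.\<close>
  let ?c = "\<lambda>l. if l < N then real (Suc N) * c l else 0"
  let ?A = "\<lambda>l. kron (complex_of_real (?c l) \<cdot>\<^sub>m rank_one n (u l)) (rank_one d (v l))"
  let ?t = "\<lambda>l r s. pure_vec d (u l) (v l) r * cnj (pure_vec d (u l) (v l) s)"
  have entry: "(complex_of_real (1 / real (Suc N)) \<cdot>\<^sub>m ?A l) $$ (r, s) =
      (if l < N then of_real (c l) * ?t l r s else 0)" if "r < n * d" "s < n * d" for l r s
  proof -
    have "(complex_of_real (1 / real (Suc N)) \<cdot>\<^sub>m ?A l) $$ (r, s)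
        = of_real (1 / real (Suc N) * ?c l) * ?t l r s"
      unfolding kron_rank_one of_real_mult using that by (simp add: rank_one_def)
    also have "1 / real (Suc N) * ?c l = (if l < N then c l else 0)" by simp
    finally show ?thesis by simp
  qed
  have "X = msum (n * d) {..<Suc N} (\<lambda>l. complex_of_real (1 / real (Suc N)) \<cdot>\<^sub>m ?A l)"
  proof (rule eq_matI)
    fix r s assume "r < dim_row (msum (n * d) {..<Suc N} (\<lambda>l. complex_of_real (1 / real (Suc N)) \<cdot>\<^sub>m ?A l))"
      "s < dim_col (msum (n * d) {..<Suc N} (\<lambda>l. complex_of_real (1 / real (Suc N)) \<cdot>\<^sub>m ?A l))"
    then have rs: "r < n * d" "s < n * d" by (simp_all add: msum_def)
    have "msum (n * d) {..<Suc N} (\<lambda>l. complex_of_real (1 / real (Suc N)) \<cdot>\<^sub>m ?A l) $$ (r, s)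
        = (\<Sum>l<Suc N. if l < N then of_real (c l) * ?t l r s else 0)"
      unfolding msum_def using rs by (simp only: entry index_mat split)
    then show "X $$ (r, s) = msum (n * d) {..<Suc N} (\<lambda>l. complex_of_real (1 / real (Suc N)) \<cdot>\<^sub>m ?A l) $$ (r, s)"
      using eq[OF rs] by simp
  qed (use X in \<open>simp_all add: msum_def\<close>)
  moreover have "?A l \<in> {kron x y | x y. x \<in> PSD n \<and> y \<in> PSD d}" for l
  proof -
    have "rank_one d (v l) = complex_of_real 1 \<cdot>\<^sub>m rank_one d (v l)" by (auto simp: rank_one_def)
    then have "rank_one d (v l) \<in> PSD d" by (metis smult_rank_one_PSD zero_le_one)
    moreover have "complex_of_real (?c l) \<cdot>\<^sub>m rank_one n (u l) \<in> PSD n"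
      using c by (intro smult_rank_one_PSD) auto
    ultimately show ?thesis by blast
  qed
  ultimately show ?thesis unfolding min_tensor_def mconv_def
    by (intro CollectI exI[of _ "Suc N"] exI[of _ "\<lambda>_. 1 / real (Suc N)"] exI[of _ ?A]) auto
qed

text \<open>The products of rank-one projections form a compact set on which the trace is \<open>1\<close>, so that
  \<open>conic_separation\<close> applies.\<close>

lemma min_tensorI:
  assumes X: "X \<in> carrier_mat (n * d) (n * d)"
    and dual: "\<And>C. (\<And>u v. 0 \<le> (\<Sum>r<n * d. \<Sum>s<n * d. C r s * (pure_vec d u v r * cnj (pure_vec d u v s)))) \<Longrightarrow>
      0 \<le> (\<Sum>r<n * d. \<Sum>s<n * d. C r s * X $$ (r, s))"
  shows "X \<in> min_tensor n d"
proof -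
  let ?N = "n * d"
  \<comment> \<open>Rank-one witnesses give positivity of \<open>X\<close>, and thereby its
    self-adjointness. The latter makes the pairing with a self-adjoint witness real, so that real
    separation applies.\<close>
  have "0 \<le> qform ?N (\<lambda>r s. X $$ (r, s)) t" for t
  proof -
    have "0 \<le> (\<Sum>r<?N. \<Sum>s<?N. (t s * cnj (t r)) * X $$ (r, s))"
    proof (rule dual)
      fix u v
      let ?z = "\<Sum>r<?N. pure_vec d u v r * cnj (t r)"
      have "(\<Sum>r<?N. \<Sum>s<?N. (t s * cnj (t r)) * (pure_vec d u v r * cnj (pure_vec d u v s)))
          = ?z * cnj ?z"
        unfolding cnj_sum sum_product by (intro sum.cong refl) simp
      then show "0 \<le> (\<Sum>r<?N. \<Sum>s<?N. (t s * cnj (t r)) * (pure_vec d u v r * cnj (pure_vec d u v s)))"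
        by (simp only: mult_cnj_nonneg)
    qed
    then show ?thesis by (simp add: qform_def mult_ac)
  qed
  then have "X \<in> herm ?N" using X PSD_iff[of X ?N] by (simp add: PSD_def)
  note herm = hermD[OF this]
  let ?I = "UNIV \<times> {..<?N} \<times> {..<?N} :: (bool \<times> nat \<times> nat) set"
  let ?S = "\<lambda>n. {u :: nat \<Rightarrow> complex. (\<forall>i. cmod (u i) \<le> 1) \<and> (\<Sum>i<n. (cmod (u i))\<^sup>2) = 1}"
  let ?K = "\<lambda>u v r s. pure_vec d u v r * cnj (pure_vec d u v s)"
  define g where "g = (\<lambda>(u, v) (b, r, s). cpart b (?K u v r s))"
  have sumI: "(\<Sum>i\<in>?I. f i) = (\<Sum>r<?N. \<Sum>s<?N. f (True, r, s) + f (False, r, s))" for f :: "_ \<Rightarrow> real"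
  proof -
    have "(\<Sum>i\<in>?I. f i) = (\<Sum>b\<in>UNIV. \<Sum>r<?N. \<Sum>s<?N. f (b, r, s))"
      by (simp add: sum.cartesian_product)
    then show ?thesis by (simp add: UNIV_bool sum.distrib add.commute)
  qed
  have "continuous_on (?S n \<times> ?S d) (\<lambda>p. g p i)" for i
  proof -
    obtain b r s where "i = (b, r, s)" by (cases i)
    then show ?thesis unfolding g_def case_prod_unfold cpart_def pure_vec_def
      by (cases b) (auto intro!: continuous_intros
          continuous_on_compose2[OF continuous_on_product_coordinates continuous_on_fst]
          continuous_on_compose2[OF continuous_on_product_coordinates continuous_on_snd])
  qed
  then have "continuous_on (?S n \<times> ?S d) g" by (rule continuous_on_coordinatewise_then_product)
  then have G: "compact (g ` (?S n \<times> ?S d))"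
    by (intro compact_continuous_image compact_Times compact_unit_vectors)
  have norm: "(\<Sum>i\<in>?I. (\<lambda>(b, r, s). if b \<and> r = s then 1 else 0) i * y i) = 1"
    if "y \<in> g ` (?S n \<times> ?S d)" for y
  proof -
    from that obtain u v where uv: "u \<in> ?S n" "v \<in> ?S d" "y = g (u, v)" by auto
    have "(\<Sum>i\<in>?I. (\<lambda>(b, r, s). if b \<and> r = s then 1 else 0) i * y i)
        = (\<Sum>r<?N. (\<lambda>i j. (cmod (u i))\<^sup>2 * (cmod (v j))\<^sup>2) (r div d) (r mod d))"
    proof -
      have "Re (?K u v r r) = (cmod (u (r div d)))\<^sup>2 * (cmod (v (r mod d)))\<^sup>2" for r
      proof -
        have "?K u v r r = of_real ((cmod (pure_vec d u v r))\<^sup>2)" by (simp only: complex_norm_square)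
        then show ?thesis by (simp add: pure_vec_def norm_mult power_mult_distrib)
      qed
      then show ?thesis unfolding sumI
        by (simp add: uv(3) g_def cpart_def if_distrib[of "\<lambda>c. c * _"] cong: if_cong)
    qed
    also have "\<dots> = (\<Sum>i<n. (cmod (u i))\<^sup>2) * (\<Sum>j<d. (cmod (v j))\<^sup>2)"
      by (subst sum_digits) (rule sum_product[symmetric])
    finally show ?thesis using uv by simp
  qed
  define x where "x = (\<lambda>(b, r, s). cpart b (X $$ (r, s)))"
  have pos: "0 \<le> (\<Sum>i\<in>?I. w i * x i)" if w: "\<And>y. y \<in> g ` (?S n \<times> ?S d) \<Longrightarrow> 0 \<le> (\<Sum>i\<in>?I. w i * y i)" for w
  proof -
    \<comment> \<open>\<open>A\<close> encodes the real functional \<open>w\<close> as the real part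
      of a complex pairing, whence the sign of its imaginary part. Its self-adjoint part
      \<open>C\<close> has the same value on self-adjoint matrices, without taking the real
      part.\<close>
    define A where "A = (\<lambda>r s. Complex (w (True, r, s)) (- w (False, r, s)))"
    define C where "C = (\<lambda>r s. (A r s + cnj (A s r)) / 2)"
    have re: "(\<Sum>i\<in>?I. w i * (\<lambda>(b, r, s). cpart b (Z r s)) i) = Re (\<Sum>r<?N. \<Sum>s<?N. A r s * Z r s)" for Z
      unfolding sumI by (simp add: A_def cpart_def)
    have C: "(\<Sum>r<?N. \<Sum>s<?N. C r s * Z r s) = of_real (Re (\<Sum>r<?N. \<Sum>s<?N. A r s * Z r s))"
      if Z: "\<And>r s. r < ?N \<Longrightarrow> s < ?N \<Longrightarrow> Z s r = cnj (Z r s)" for Z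
    proof -
      let ?a = "\<Sum>r<?N. \<Sum>s<?N. A r s * Z r s"
      have "(\<Sum>r<?N. \<Sum>s<?N. cnj (A s r) * Z r s) = (\<Sum>s<?N. \<Sum>r<?N. cnj (A s r) * Z r s)"
        by (rule sum.swap)
      also have "\<dots> = cnj ?a"
        unfolding cnj_sum
        by (intro sum.cong refl) (metis Z complex_cnj_mult complex_cnj_cnj lessThan_iff)
      finally have sw: "(\<Sum>r<?N. \<Sum>s<?N. cnj (A s r) * Z r s) = cnj ?a" .
      have "C r s * Z r s = (A r s * Z r s + cnj (A s r) * Z r s) / 2" for r s
        by (simp add: C_def distrib_right)
      then have "(\<Sum>r<?N. \<Sum>s<?N. C r s * Z r s) = (?a + (\<Sum>r<?N. \<Sum>s<?N. cnj (A s r) * Z r s)) / 2"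
        by (simp only: sum.distrib flip: sum_divide_distrib)
      also have "\<dots> = of_real (Re ?a)" unfolding sw complex_add_cnj by simp
      finally show ?thesis .
    qed
    have "0 \<le> (\<Sum>r<?N. \<Sum>s<?N. C r s * X $$ (r, s))"
    proof (rule dual)
      fix u v
      obtain a u' where u: "\<And>i. i < n \<Longrightarrow> u i = of_real a * u' i"
        "a = 0 \<or> (\<forall>i. cmod (u' i) \<le> 1) \<and> (\<Sum>i<n. (cmod (u' i))\<^sup>2) = 1"
        using normalize_vector[of n u] by blast
      obtain b v' where v: "\<And>i. i < d \<Longrightarrow> v i = of_real b * v' i"
        "b = 0 \<or> (\<forall>i. cmod (v' i) \<le> 1) \<and> (\<Sum>i<d. (cmod (v' i))\<^sup>2) = 1"
        using normalize_vector[of d v] by blast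
      have "pure_vec d u v r = of_real (a * b) * pure_vec d u' v' r" if "r < ?N" for r
        using u(1) v(1) digit_bounds[OF that] by (simp add: pure_vec_def)
      then have "(\<Sum>r<?N. \<Sum>s<?N. C r s * ?K u v r s)
          = (\<Sum>r<?N. \<Sum>s<?N. of_real ((a * b)\<^sup>2) * (C r s * ?K u' v' r s))"
        by (intro sum.cong refl) (simp add: power2_eq_square)
      also have "\<dots> = of_real ((a * b)\<^sup>2) * of_real (Re (\<Sum>r<?N. \<Sum>s<?N. A r s * ?K u' v' r s))"
      proof -
        have "(\<Sum>r<?N. \<Sum>s<?N. C r s * ?K u' v' r s) = of_real (Re (\<Sum>r<?N. \<Sum>s<?N. A r s * ?K u' v' r s))"
          by (rule C) simp
        then show ?thesis by (simp only: flip: sum_distrib_left)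
      qed
      finally have eq: "(\<Sum>r<?N. \<Sum>s<?N. C r s * ?K u v r s)
        = of_real ((a * b)\<^sup>2 * Re (\<Sum>r<?N. \<Sum>s<?N. A r s * ?K u' v' r s))" by simp
      have "0 \<le> (a * b)\<^sup>2 * Re (\<Sum>r<?N. \<Sum>s<?N. A r s * ?K u' v' r s)"
      proof (cases "a = 0 \<or> b = 0")
        case False
        then have "g (u', v') \<in> g ` (?S n \<times> ?S d)" using u v by auto
        from w[OF this] re[of "?K u' v'"] show ?thesis by (simp add: g_def case_prod_unfold)
      qed auto
      then show "0 \<le> (\<Sum>r<?N. \<Sum>s<?N. C r s * ?K u v r s)" unfolding eq by (simp add: less_eq_complex_def)
    qed
    moreover have "(\<Sum>r<?N. \<Sum>s<?N. C r s * X $$ (r, s)) = of_real (Re (\<Sum>r<?N. \<Sum>s<?N. A r s * X $$ (r, s)))"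
      by (rule C) (rule herm)
    ultimately show ?thesis using re[of "\<lambda>r s. X $$ (r, s)"]
      by (simp add: x_def less_eq_complex_def)
  qed
  have finI: "finite ?I" by simp
  from conic_separation[OF finI G norm, of x] pos
  obtain N :: nat and c h where ch: "\<And>l. l < N \<Longrightarrow> 0 \<le> c l" "\<And>l. l < N \<Longrightarrow> h l \<in> g ` (?S n \<times> ?S d)"
    "\<And>i. i \<in> ?I \<Longrightarrow> x i = (\<Sum>l<N. c l * h l i)" by blast
  then have "\<forall>l. \<exists>u v. l < N \<longrightarrow> h l = g (u, v)" by blast
  then obtain u v where uv: "\<And>l. l < N \<Longrightarrow> h l = g (u l, v l)" by metis
  show ?thesis
  proof (rule min_tensor_if_rank_one_sum[OF X ch(1)])
    fix r s assume rs: "r < ?N" "s < ?N"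
    have "cpart b (X $$ (r, s)) = (\<Sum>l<N. c l * cpart b (?K (u l) (v l) r s))" for b
      using ch(3)[of "(b, r, s)"] rs uv by (simp add: x_def g_def)
    from this[of True] this[of False]
    show "X $$ (r, s) = (\<Sum>l<N. of_real (c l) * ?K (u l) (v l) r s)"
      by (simp add: cpart_def complex_eq_iff)
  qed
qed

subsection \<open>Clifford forms on the Lorentz cone\<close>

lemma sum_PiE_Suc:
  fixes A :: "'a set" and f :: "(nat \<Rightarrow> 'a) \<Rightarrow> 'b :: comm_monoid_add"
  shows "(\<Sum>I\<in>PiE {..<Suc m} (\<lambda>_. A). f I) = (\<Sum>i\<in>A. \<Sum>I\<in>PiE {..<m} (\<lambda>_. A). f (I(m := i)))"
proof -
  have "PiE {..<Suc m} (\<lambda>_. A) = (\<lambda>(y, g). g(m := y)) ` (A \<times> PiE {..<m} (\<lambda>_. A))"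
    unfolding lessThan_Suc by (rule PiE_insert_eq)
  moreover have "inj_on (\<lambda>(y, g). g(m := y)) (A \<times> PiE {..<m} (\<lambda>_. A))"
    by (rule inj_combinator) simp
  ultimately show ?thesis by (simp add: sum.reindex sum.cartesian_product case_prod_unfold)
qed

definition toggle :: "'a \<Rightarrow> 'a set \<Rightarrow> 'a set" where
  "toggle i U = (if i \<in> U then U - {i} else insert i U)"

lemma toggle_toggle [simp]: "toggle i (toggle i U) = U"
  by (auto simp: toggle_def)

lemma toggle_commute: "toggle i (toggle j U) = toggle j (toggle i U)"
  by (auto simp: toggle_def)

lemma sum_Pow_toggle:
  assumes "i \<in> K"
  shows "(\<Sum>U\<in>Pow K. f (toggle i U)) = (\<Sum>U\<in>Pow K. f U)"
  using assms by (intro sum.reindex_bij_witness[of _ "toggle i" "toggle i"]) (auto simp: toggle_def)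

text \<open>The generators \<open>(E\<^sub>i \<psi>) U = clifford_sign i U * \<psi> (toggle i U)\<close> of the Clifford algebra, acting
  on functions of subsets \<open>U\<close>, are anticommuting involutions; \<open>clifford m I\<close> is the result of
  applying the generators with indices \<open>I 0, \<dots>, I (m - 1)\<close> to the indicator function of \<open>{}\<close>.\<close>

definition clifford_sign :: "nat \<Rightarrow> nat set \<Rightarrow> real" where
  "clifford_sign i U = (-1) ^ card {j \<in> U. j < i}"

fun clifford :: "nat \<Rightarrow> (nat \<Rightarrow> nat) \<Rightarrow> nat set \<Rightarrow> real" where
  "clifford 0 I U = (if U = {} then 1 else 0)"
| "clifford (Suc m) I U = clifford_sign (I m) U * clifford m I (toggle (I m) U)"

lemma clifford_sign_square [simp]: "clifford_sign i U * clifford_sign i U = 1"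
  by (simp add: clifford_sign_def flip: power_add mult_2)

text \<open>Toggling \<open>j\<close> changes the number of elements below \<open>i\<close> by one
  if \<open>j < i\<close> and not at all otherwise. This asymmetry between \<open>i\<close> and
  \<open>j\<close> is the source of anticommutation.\<close>

lemma clifford_sign_toggle:
  assumes "finite U"
  shows "clifford_sign i (toggle j U) = (if j < i then - 1 else 1) * clifford_sign i U"
proof (cases "j < i")
  case True
  show ?thesis
  proof (cases "j \<in> U")
    case j: True
    have "{l \<in> U. l < i} = insert j {l \<in> U - {j}. l < i}" using True j by auto
    then have "card {l \<in> U. l < i} = Suc (card {l \<in> U - {j}. l < i})"
      using assms by simp
    then show ?thesis using True j by (simp add: clifford_sign_def toggle_def)
  next
    case j: False
    have "{l \<in> insert j U. l < i} = insert j {l \<in> U. l < i}" using True j by auto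
    then have "card {l \<in> insert j U. l < i} = Suc (card {l \<in> U. l < i})"
      using assms j by simp
    then show ?thesis using True j by (simp add: clifford_sign_def toggle_def)
  qed
next
  case False
  then have "{l \<in> toggle j U. l < i} = {l \<in> U. l < i}" by (auto simp: toggle_def)
  then show ?thesis using False by (simp add: clifford_sign_def)
qed

text \<open>After expanding the square, the substitution of \<open>toggle i (toggle j U)\<close> for
  \<open>U\<close> negates every term with i \<noteq> j, because exactly one of \<open>j < i\<close>
  and \<open>i < j\<close> holds. Only the diagonal terms survive, and there the signs square to
  1.\<close>

lemma clifford_norm:
  fixes \<psi> :: "nat set \<Rightarrow> real"
  assumes K: "finite K"
  shows "(\<Sum>U\<in>Pow K. (\<Sum>i\<in>K. y i * (clifford_sign i U * \<psi> (toggle i U)))\<^sup>2)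
    = (\<Sum>i\<in>K. (y i)\<^sup>2) * (\<Sum>U\<in>Pow K. (\<psi> U)\<^sup>2)"
proof -
  let ?g = "\<lambda>i j U. (clifford_sign i U * \<psi> (toggle i U)) * (clifford_sign j U * \<psi> (toggle j U))"
  have diag: "(\<Sum>U\<in>Pow K. ?g i i U) = (\<Sum>U\<in>Pow K. (\<psi> U)\<^sup>2)" if "i \<in> K" for i
  proof -
    have "?g i i U = (\<psi> (toggle i U))\<^sup>2" for U
      using clifford_sign_square[of i U] by (simp add: power2_eq_square)
    then show ?thesis using sum_Pow_toggle[OF that, of "\<lambda>U. (\<psi> U)\<^sup>2"] by simp
  qed
  have off: "(\<Sum>U\<in>Pow K. ?g i j U) = 0" if ij: "i \<in> K" "j \<in> K" "i \<noteq> j" for i j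
  proof -
    have "(\<Sum>U\<in>Pow K. ?g i j U) = (\<Sum>U\<in>Pow K. ?g i j (toggle i (toggle j U)))"
      using sum_Pow_toggle[OF ij(1), of "?g i j"]
        sum_Pow_toggle[OF ij(2), of "\<lambda>U. ?g i j (toggle i U)"] by simp
    also have "\<dots> = (\<Sum>U\<in>Pow K. - ?g i j U)"
    proof (rule sum.cong)
      fix U assume "U \<in> Pow K"
      then have fin: "finite U" "finite (toggle j U)"
        using K by (auto simp: toggle_def intro: finite_subset)
      have "toggle i (toggle i (toggle j U)) = toggle j U"
        "toggle j (toggle i (toggle j U)) = toggle i U"
        by (simp, simp add: toggle_commute[of i j])
      then show "?g i j (toggle i (toggle j U)) = - ?g i j U"
        using ij(3) by (auto simp: clifford_sign_toggle fin)
    qed simp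
    finally show ?thesis by (simp add: sum_negf)
  qed
  have "(\<Sum>U\<in>Pow K. (\<Sum>i\<in>K. y i * (clifford_sign i U * \<psi> (toggle i U)))\<^sup>2)
      = (\<Sum>U\<in>Pow K. \<Sum>i\<in>K. \<Sum>j\<in>K. (y i * y j) * ?g i j U)"
    unfolding power2_eq_square sum_product by (intro sum.cong refl) (simp add: mult_ac)
  also have "\<dots> = (\<Sum>i\<in>K. \<Sum>U\<in>Pow K. \<Sum>j\<in>K. (y i * y j) * ?g i j U)" by (rule sum.swap)
  also have "\<dots> = (\<Sum>i\<in>K. \<Sum>j\<in>K. \<Sum>U\<in>Pow K. (y i * y j) * ?g i j U)"
    by (intro sum.cong refl sum.swap)
  also have "\<dots> = (\<Sum>i\<in>K. \<Sum>j\<in>K. if i = j then (y i)\<^sup>2 * (\<Sum>U\<in>Pow K. (\<psi> U)\<^sup>2) else 0)"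
  proof (intro sum.cong refl)
    fix i j assume ij: "i \<in> K" "j \<in> K"
    have "(\<Sum>U\<in>Pow K. (y i * y j) * ?g i j U) = (y i * y j) * (\<Sum>U\<in>Pow K. ?g i j U)"
      by (simp only: sum_distrib_left)
    then show "(\<Sum>U\<in>Pow K. (y i * y j) * ?g i j U)
        = (if i = j then (y i)\<^sup>2 * (\<Sum>U\<in>Pow K. (\<psi> U)\<^sup>2) else 0)"
      using diag[OF ij(1)] off[OF ij] by (cases "i = j") (simp_all add: power2_eq_square)
  qed
  also have "\<dots> = (\<Sum>i\<in>K. (y i)\<^sup>2 * (\<Sum>U\<in>Pow K. (\<psi> U)\<^sup>2))" using K by simp
  finally show ?thesis by (simp only: sum_distrib_right)
qed

lemma clifford_cong: "(\<And>t. t < m \<Longrightarrow> I t = J t) \<Longrightarrow> clifford m I U = clifford m J U"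
  by (induction m arbitrary: U) auto

text \<open>Every generator maps a basis vector to plus or minus a basis vector, so a word in the
  generators has a single nonzero coefficient, equal to 1 or -1.\<close>

lemma clifford_coeff_norm:
  assumes "finite K" "\<And>t. t < m \<Longrightarrow> I t \<in> K"
  shows "(\<Sum>U\<in>Pow K. (clifford m I U)\<^sup>2) = 1"
  using assms(2)
proof (induction m)
  case 0
  have "(\<Sum>U\<in>Pow K. (clifford 0 I U)\<^sup>2) = (\<Sum>U\<in>Pow K. if U = {} then 1 else 0)"
    by (intro sum.cong) auto
  then show ?case using assms(1) by simp
next
  case (Suc m)
  have "(clifford (Suc m) I U)\<^sup>2 = (clifford m I (toggle (I m) U))\<^sup>2" for U
    using clifford_sign_square[of "I m" U] by (simp add: power_mult_distrib power2_eq_square)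
  then show ?case
    using Suc sum_Pow_toggle[of "I m" K "\<lambda>U. (clifford m I U)\<^sup>2"] by simp
qed

text \<open>The component at \<open>U\<close> of the vector obtained from the indicator of
  \<open>{}\<close> by Clifford multiplication with x_0, ..., x_(m-1) in turn, expanded into words
  of generators.\<close>

definition clifford_form :: "nat set \<Rightarrow> nat \<Rightarrow> (nat \<Rightarrow> nat \<Rightarrow> real) \<Rightarrow> nat set \<Rightarrow> real" where
  "clifford_form K m x U = (\<Sum>I\<in>PiE {..<m} (\<lambda>_. K). clifford m I U * (\<Prod>t<m. x t (I t)))"

lemma clifford_form_Suc:
  "clifford_form K (Suc m) x U =
    (\<Sum>i\<in>K. x m i * (clifford_sign i U * clifford_form K m x (toggle i U)))"
proof -
  have "clifford (Suc m) (I(m := i)) U * (\<Prod>t<Suc m. x t ((I(m := i)) t)) =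
      x m i * (clifford_sign i U * (clifford m I (toggle i U) * (\<Prod>t<m. x t (I t))))" for I i
  proof -
    have "clifford m (I(m := i)) (toggle i U) = clifford m I (toggle i U)"
      by (rule clifford_cong) simp
    moreover have "(\<Prod>t<m. x t ((I(m := i)) t)) = (\<Prod>t<m. x t (I t))" by (rule prod.cong) auto
    ultimately show ?thesis by (simp add: mult_ac)
  qed
  then show ?thesis
    unfolding clifford_form_def sum_PiE_Suc sum_distrib_left by (intro sum.cong refl) simp
qed

lemma clifford_form_norm:
  assumes "finite K"
  shows "(\<Sum>U\<in>Pow K. (clifford_form K m x U)\<^sup>2) = (\<Prod>t<m. \<Sum>i\<in>K. (x t i)\<^sup>2)"
proof (induction m)
  case 0
  have "(\<Sum>U\<in>Pow K. (clifford_form K 0 x U)\<^sup>2) = (\<Sum>U\<in>Pow K. if U = {} then 1 else 0)"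
    by (intro sum.cong) (auto simp: clifford_form_def)
  then show ?case using assms by simp
next
  case (Suc m)
  then show ?case unfolding clifford_form_Suc clifford_norm[OF assms] by (simp add: mult.commute)
qed

text \<open>Coefficients of the multilinear form \<open>t\<^sub>1 \<cdots> t\<^sub>m \<plusminus> \<langle>e\<^sub>U, M(x\<^sub>m) \<cdots> M(x\<^sub>1) e\<^bsub>{}\<^esub>\<rangle>\<close> with
  \<open>M(x) = \<Sum>i. x\<^sub>i E\<^sub>i\<close>. It is nonnegative on Lorentz vectors because \<open>M(x)\<close> is \<open>\<parallel>x\<parallel>\<close> times an isometry.\<close>

definition clifford_tensor :: "nat \<Rightarrow> nat \<Rightarrow> real \<Rightarrow> nat set \<Rightarrow> (nat \<Rightarrow> nat) \<Rightarrow> real" where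
  "clifford_tensor k m s U I =
     (if \<forall>t<m. I t = 0 then 1 else 0) + s * (if \<forall>t<m. I t \<in> {1..k} then clifford m I U else 0)"

lemma sum_PiE_restrict:
  fixes f :: "(nat \<Rightarrow> 'a) \<Rightarrow> 'b :: comm_monoid_add"
  assumes "finite A" "B \<subseteq> A"
  shows "(\<Sum>I\<in>PiE {..<m} (\<lambda>_. A). if \<forall>t<m. I t \<in> B then f I else 0) = (\<Sum>I\<in>PiE {..<m} (\<lambda>_. B). f I)"
  using assms by (intro sum.mono_neutral_cong_right finite_PiE) (auto simp: PiE_iff)

lemma clifford_tensor_nonneg:
  fixes s :: real and x :: "nat \<Rightarrow> nat \<Rightarrow> real"
  assumes x: "\<And>t. t < m \<Longrightarrow> sqrt (\<Sum>i = 1..k. (x t i)\<^sup>2) \<le> x t 0"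
    and s: "\<bar>s\<bar> = 1" and U: "U \<subseteq> {1..k}"
  shows "0 \<le> (\<Sum>I\<in>PiE {..<m} (\<lambda>_. {0..k}). clifford_tensor k m s U I * (\<Prod>t<m. x t (I t)))"
proof -
  let ?P = "PiE {..<m} (\<lambda>_. {0..k})" and ?p = "\<lambda>I. \<Prod>t<m. x t (I t)"
  have "(\<Sum>I\<in>?P. clifford_tensor k m s U I * ?p I) =
      (\<Sum>I\<in>?P. if \<forall>t<m. I t \<in> {0} then ?p I else 0) +
      s * (\<Sum>I\<in>?P. if \<forall>t<m. I t \<in> {1..k} then clifford m I U * ?p I else 0)"
  proof -
    have "((if A then 1 else 0) + s * (if B then c else 0)) * p
        = (if A then p else 0) + s * (if B then c * p else 0)" for A B and c p :: real
      by (simp add: distrib_right)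
    then show ?thesis
      by (simp only: clifford_tensor_def singleton_iff sum_distrib_left sum.distrib[symmetric])
  qed
  also have "\<dots> = (\<Sum>I\<in>PiE {..<m} (\<lambda>_. {0}). ?p I) + s * clifford_form {1..k} m x U"
    unfolding clifford_form_def by (subst (1 2) sum_PiE_restrict) auto
  also have "(\<Sum>I\<in>PiE {..<m} (\<lambda>_. {0}). ?p I) = (\<Prod>t<m. x t 0)"
    using prod_sum_PiE[of "{..<m}" "\<lambda>_. {0}" x] by simp
  finally have eq: "(\<Sum>I\<in>?P. clifford_tensor k m s U I * ?p I)
      = (\<Prod>t<m. x t 0) + s * clifford_form {1..k} m x U" .
  \<comment> \<open>A single component is bounded by the norm of the whole vector, which is the
    product of the spatial norms.\<close>
  have "(clifford_form {1..k} m x U)\<^sup>2 \<le> (\<Sum>V\<in>Pow {1..k}. (clifford_form {1..k} m x V)\<^sup>2)"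
    using U by (intro member_le_sum) auto
  also have "\<dots> = (\<Prod>t<m. \<Sum>i = 1..k. (x t i)\<^sup>2)" by (rule clifford_form_norm) simp
  also have "\<dots> \<le> (\<Prod>t<m. (x t 0)\<^sup>2)"
    using x by (intro prod_mono) (auto simp: sum_nonneg real_sqrt_le_iff sqrt_le_D)
  also have "\<dots> = (\<Prod>t<m. x t 0)\<^sup>2" by (simp add: prod_power_distrib)
  finally have "\<bar>clifford_form {1..k} m x U\<bar> \<le> (\<Prod>t<m. x t 0)"
  proof (rule abs_le_square_iff[THEN iffD2, THEN order_trans])
    show "\<bar>\<Prod>t<m. x t 0\<bar> \<le> (\<Prod>t<m. x t 0)"
    proof -
      have "0 \<le> x t 0" if "t < m" for t
        using x[OF that] by (rule order_trans[rotated]) (simp add: sum_nonneg)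
      then have "0 \<le> (\<Prod>t<m. x t 0)" by (intro prod_nonneg) simp
      then show ?thesis by simp
    qed
  qed
  moreover have "- \<bar>clifford_form {1..k} m x U\<bar> \<le> s * clifford_form {1..k} m x U"
    using s by (metis abs_ge_minus_self abs_minus_cancel abs_mult mult_1 minus_le_iff)
  ultimately show ?thesis unfolding eq by linarith
qed

section \<open>Averaging over sign flips\<close>

definition flip :: "nat set \<Rightarrow> nat \<Rightarrow> real" where
  "flip E i = (if i \<in> E then - 1 else 1)"

text \<open>Orthogonality of characters. Of two distinct indices at least one is spatial, and
  toggling it in \<open>E\<close> negates the summand; the index 0 is never flipped and gives the
  trivial character.\<close>

lemma sum_flip:
  assumes "i \<in> {0..k}" "j \<in> {0..k}"
  shows "(\<Sum>E\<in>Pow {1..k}. flip E i * flip E j) = (if i = j then 2 ^ k else 0)"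
proof (cases "i = j")
  case True
  have "flip E j * flip E j = 1" for E by (simp add: flip_def)
  then show ?thesis using True by (simp add: card_Pow)
next
  case False
  obtain p where p: "p \<in> {1..k}" "p = i \<or> p = j"
  proof (cases "i = 0")
    case True
    then show ?thesis using that[of j] assms False by auto
  next
    case False
    then show ?thesis using that[of i] assms by auto
  qed
  have "flip (toggle p E) i * flip (toggle p E) j = - (flip E i * flip E j)" for E
    using p False by (auto simp: flip_def toggle_def)
  then have "(\<Sum>E\<in>Pow {1..k}. flip E i * flip E j) = - (\<Sum>E\<in>Pow {1..k}. flip E i * flip E j)"
    using sum_Pow_toggle[OF p(1), of "\<lambda>E. flip E i * flip E j"] by (simp add: sum_negf)
  then show ?thesis using False by simp
qed

text \<open>The factor \<open>2 ^ k\<close> counts the sets \<open>U\<close>, each of which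
  contributes 1 on the purely temporal word. On purely spatial words the Clifford coefficients have
  square sum 1. With \<open>0 < m\<close> no word is of both kinds, so there are no cross
  terms.\<close>

lemma clifford_tensor_sum:
  assumes "0 < m" "I \<in> PiE {..<m} (\<lambda>_. {0..k})"
  shows "(\<Sum>U\<in>Pow {1..k}. clifford_tensor k m 1 U I * clifford_tensor k m s U I) =
    (if \<forall>t<m. I t = 0 then 2 ^ k else 0) + s * (if \<forall>t<m. I t \<in> {1..k} then 1 else 0)"
proof -
  consider "\<forall>t<m. I t = 0" | "\<forall>t<m. I t \<in> {1..k}" "\<not> (\<forall>t<m. I t = 0)"
    | "\<not> (\<forall>t<m. I t = 0)" "\<not> (\<forall>t<m. I t \<in> {1..k})" by blast
  then show ?thesis
  proof cases
    case 1
    then have n: "\<not> (\<forall>t<m. I t \<in> {1..k})" using assms(1) by force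
    show ?thesis unfolding clifford_tensor_def if_P[OF 1] if_not_P[OF n] by (simp add: card_Pow)
  next
    case 2
    have "(\<Sum>U\<in>Pow {1..k}. clifford m I U * (s * clifford m I U))
        = s * (\<Sum>U\<in>Pow {1..k}. (clifford m I U)\<^sup>2)"
      by (simp add: sum_distrib_left power2_eq_square mult.left_commute)
    also have "\<dots> = s" using clifford_coeff_norm[of "{1..k}" m I] 2(1) by simp
    finally show ?thesis unfolding clifford_tensor_def if_P[OF 2(1)] if_not_P[OF 2(2)] by simp
  next
    case 3
    show ?thesis unfolding clifford_tensor_def if_not_P[OF 3(1)] if_not_P[OF 3(2)] by simp
  qed
qed

lemma sum_swap_inner:
  "(\<Sum>a\<in>A. \<Sum>b\<in>B. \<Sum>c\<in>C. f a b c) = (\<Sum>b\<in>B. \<Sum>c\<in>C. \<Sum>a\<in>A. f a b c)"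
  by (rule trans[OF sum.swap]) (intro sum.cong refl sum.swap)

lemma sum_swap_pairs:
  "(\<Sum>a\<in>A. \<Sum>b\<in>B. \<Sum>c\<in>C. \<Sum>d\<in>D. f a b c d) = (\<Sum>c\<in>C. \<Sum>d\<in>D. \<Sum>a\<in>A. \<Sum>b\<in>B. f a b c d)"
  by (rule trans[OF sum.cong[OF refl sum_swap_inner] sum_swap_inner])

text \<open>Independent sign flips of the spatial coordinates in every tensor factor cancel all terms with
  \<open>I \<noteq> J\<close>; summation over \<open>U\<close> then turns the squared coefficients into \<open>1\<close>.\<close>

lemma clifford_average:
  fixes k m :: nat and s :: real and \<alpha> :: "nat \<Rightarrow> nat \<Rightarrow> complex"
  assumes m: "0 < m"
  defines "P \<equiv> PiE {..<m} (\<lambda>_. {0..k})"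
  shows "(\<Sum>U\<in>Pow {1..k}. \<Sum>E\<in>PiE {..<m} (\<lambda>_. Pow {1..k}). \<Sum>I\<in>P. \<Sum>J\<in>P.
      of_real (clifford_tensor k m 1 U I * clifford_tensor k m s U J) *
      (\<Prod>t<m. of_real (flip (E t) (I t) * flip (E t) (J t)) * \<alpha> (I t) (J t)))
    = 2 ^ (k * m) * (2 ^ k * \<alpha> 0 0 ^ m + of_real s * (\<Sum>i = 1..k. \<alpha> i i) ^ m)"
proof -
  let ?c = "\<lambda>U I J. clifford_tensor k m 1 U I * clifford_tensor k m s U J"
  let ?f = "\<lambda>E I J. \<Prod>t<m. flip (E t) (I t) * flip (E t) (J t)"
  let ?a = "\<lambda>I J. \<Prod>t<m. \<alpha> (I t) (J t)"
  let ?E = "PiE {..<m} (\<lambda>_. Pow {1..k})"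
  have finP: "finite P" by (simp add: P_def finite_PiE)
  \<comment> \<open>The flips are chosen independently in each factor, so the sum over them
    factorizes and every factor separately forces \<open>I t = J t\<close>.\<close>
  have flips: "(\<Sum>E\<in>?E. ?f E I J) = (if I = J then 2 ^ (k * m) else 0)" if "I \<in> P" "J \<in> P" for I J
  proof -
    have "(\<Sum>E\<in>?E. ?f E I J) = (\<Prod>t<m. \<Sum>E\<in>Pow {1..k}. flip E (I t) * flip E (J t))"
      by (rule prod_sum_PiE[symmetric]) auto
    also have "\<dots> = (\<Prod>t<m. if I t = J t then 2 ^ k else 0)"
      using that by (intro prod.cong refl sum_flip) (auto simp: P_def PiE_iff)
    also have "\<dots> = (if I = J then 2 ^ (k * m) else 0)"
    proof (cases "I = J")
      case False
      have "\<exists>t<m. I t \<noteq> J t"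
      proof (rule ccontr)
        assume "\<not> (\<exists>t<m. I t \<noteq> J t)"
        then have "I = J" using that unfolding P_def by (intro PiE_ext[of I "{..<m}" _ J]) auto
        then show False using False by simp
      qed
      then obtain t where "t < m" "I t \<noteq> J t" by blast
      then have "(\<Prod>t<m. if I t = J t then 2 ^ k else 0 :: real) = 0" by (intro prod_zero) auto
      then show ?thesis using False by simp
    qed (simp add: power_mult)
    finally show ?thesis .
  qed
  have "(\<Sum>U\<in>Pow {1..k}. \<Sum>E\<in>?E. \<Sum>I\<in>P. \<Sum>J\<in>P. of_real (?c U I J) *
      (\<Prod>t<m. of_real (flip (E t) (I t) * flip (E t) (J t)) * \<alpha> (I t) (J t)))
    = (\<Sum>U\<in>Pow {1..k}. \<Sum>E\<in>?E. \<Sum>I\<in>P. \<Sum>J\<in>P. of_real (?c U I J) * of_real (?f E I J) * ?a I J)"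
    by (simp add: prod.distrib mult.assoc)
  also have "\<dots> = (\<Sum>I\<in>P. \<Sum>J\<in>P. \<Sum>U\<in>Pow {1..k}. \<Sum>E\<in>?E. of_real (?c U I J) * of_real (?f E I J) * ?a I J)"
    by (rule sum_swap_pairs)
  also have "\<dots> = (\<Sum>I\<in>P. \<Sum>J\<in>P. of_real (\<Sum>U\<in>Pow {1..k}. ?c U I J) * of_real (\<Sum>E\<in>?E. ?f E I J) * ?a I J)"
    unfolding of_real_sum sum_product unfolding sum_distrib_right by (rule refl)
  also have "\<dots> = (\<Sum>I\<in>P. \<Sum>J\<in>P. if I = J then 2 ^ (k * m) * (of_real (\<Sum>U\<in>Pow {1..k}. ?c U I I) * ?a I I) else 0)"
  proof (intro sum.cong refl)
    fix I J assume IJ: "I \<in> P" "J \<in> P"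
    have "x * of_real (if I = J then 2 ^ (k * m) else 0) * y I J
        = (if I = J then 2 ^ (k * m) * (x' * y I I) else 0)" if "I = J \<Longrightarrow> x = x'" for x x' :: complex and y
      using that by simp
    note e = this
    show "of_real (\<Sum>U\<in>Pow {1..k}. ?c U I J) * of_real (\<Sum>E\<in>?E. ?f E I J) * ?a I J =
        (if I = J then 2 ^ (k * m) * (of_real (\<Sum>U\<in>Pow {1..k}. ?c U I I) * ?a I I) else 0)"
      unfolding flips[OF IJ] by (rule e[of _ _ ?a]) simp
  qed
  also have "\<dots> = 2 ^ (k * m) * (\<Sum>I\<in>P. of_real (\<Sum>U\<in>Pow {1..k}. ?c U I I) * ?a I I)"
    using finP by (simp add: sum_distrib_left)
  also have "(\<Sum>I\<in>P. of_real (\<Sum>U\<in>Pow {1..k}. ?c U I I) * ?a I I)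
     = (\<Sum>I\<in>P. 2 ^ k * (if \<forall>t<m. I t \<in> {0} then ?a I I else 0)
         + of_real s * (if \<forall>t<m. I t \<in> {1..k} then ?a I I else 0))"
    by (intro sum.cong refl, subst clifford_tensor_sum[OF m]) (auto simp: P_def distrib_right)
  also have "\<dots> = 2 ^ k * (\<Sum>I\<in>PiE {..<m} (\<lambda>_. {0}). ?a I I) + of_real s * (\<Sum>I\<in>PiE {..<m} (\<lambda>_. {1..k}). ?a I I)"
    unfolding sum.distrib sum_distrib_left[symmetric] P_def by (subst (1 2) sum_PiE_restrict) auto
  also have "(\<Sum>I\<in>PiE {..<m} (\<lambda>_. {0}). ?a I I) = \<alpha> 0 0 ^ m"
    using prod_sum_PiE[of "{..<m}" "\<lambda>_. {0}" "\<lambda>_ i. \<alpha> i i"] by simp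
  also have "(\<Sum>I\<in>PiE {..<m} (\<lambda>_. {1..k}). ?a I I) = (\<Sum>i = 1..k. \<alpha> i i) ^ m"
    using prod_sum_PiE[of "{..<m}" "\<lambda>_. {1..k}" "\<lambda>_ i. \<alpha> i i"] by simp
  finally show ?thesis .
qed

text \<open>If \<open>q < r\<close>, the powers of \<open>r / q\<close> exceed any constant; the
  exponent 1 excludes \<open>q = 0\<close>. The passage to \<open>Suc m\<close> in the proof keeps
  the exponent positive.\<close>

lemma base_le_if_powers_le:
  fixes q r C :: real
  assumes r: "0 \<le> r" and q: "0 \<le> q" and le: "\<And>m. 0 < m \<Longrightarrow> r ^ m \<le> C * q ^ m"
  shows "r \<le> q"
proof (rule ccontr)
  assume "\<not> r \<le> q"
  then have rq: "q < r" by simp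
  have "0 < q" using le[of 1] rq q by (cases "q = 0") auto
  then obtain m where m: "C < (r / q) ^ m" using real_arch_pow[of "r / q" C] rq by auto
  have "(r / q) ^ m \<le> (r / q) ^ Suc m" using rq \<open>0 < q\<close> by (intro power_increasing) auto
  also have "\<dots> = r ^ Suc m / q ^ Suc m" by (rule power_divide)
  also have "\<dots> \<le> C" using le[of "Suc m"] \<open>0 < q\<close> by (subst pos_divide_le_eq) auto
  finally show False using m by simp
qed

lemma trace_nonneg_if_tensor_powers_nonneg:
  fixes \<alpha> :: "nat \<Rightarrow> nat \<Rightarrow> complex"
  assumes nonneg: "\<And>m s U E. 0 < m \<Longrightarrow> \<bar>s\<bar> = 1 \<Longrightarrow> U \<subseteq> {1..k} \<Longrightarrow> (\<And>t. t < m \<Longrightarrow> E t \<subseteq> {1..k}) \<Longrightarrow>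
    0 \<le> (\<Sum>I\<in>PiE {..<m} (\<lambda>_. {0..k}). \<Sum>J\<in>PiE {..<m} (\<lambda>_. {0..k}).
      of_real (clifford_tensor k m 1 U I * clifford_tensor k m s U J) *
      (\<Prod>t<m. of_real (flip (E t) (I t) * flip (E t) (J t)) * \<alpha> (I t) (J t)))"
  shows "0 \<le> (\<Sum>i = 0..k. \<alpha> i i)"
proof -
  let ?b = "\<Sum>i = 1..k. \<alpha> i i"
  have pos: "0 \<le> 2 ^ k * \<alpha> 0 0 ^ m + of_real s * ?b ^ m" if m: "0 < m" and s: "\<bar>s\<bar> = 1" for m s
  proof -
    have "0 \<le> 2 ^ (k * m) * (2 ^ k * \<alpha> 0 0 ^ m + of_real s * ?b ^ m)"
      unfolding clifford_average[OF m, of k, symmetric]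
      using m s by (intro sum_nonneg nonneg) (auto simp: PiE_iff)
    then have p: "0 \<le> complex_of_real (2 ^ (k * m)) * (2 ^ k * \<alpha> 0 0 ^ m + of_real s * ?b ^ m)"
      by simp
    have cancel: "0 \<le> z" if "0 \<le> complex_of_real c * z" "0 < c" for c z
      using that by (auto simp: less_eq_complex_def zero_le_mult_iff)
    show ?thesis by (rule cancel[OF p]) simp
  qed
  define a b where "a = Re (\<alpha> 0 0)" and "b = Re ?b"
  \<comment> \<open>The order on complex numbers includes reality, so the two signs at exponent 1
    already show that \<open>\<alpha> 0 0\<close> and \<open>?b\<close> are real and that
    \<open>a\<close> is nonnegative.\<close>
  have "0 \<le> 2 ^ k * \<alpha> 0 0 + ?b" "0 \<le> 2 ^ k * \<alpha> 0 0 - ?b" using pos[of 1 1] pos[of 1 "-1"] by simp_all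
  then have "0 \<le> complex_of_real (2 ^ k) * \<alpha> 0 0 + ?b" "0 \<le> complex_of_real (2 ^ k) * \<alpha> 0 0 - ?b" by simp_all
  then have re: "0 \<le> a" "\<alpha> 0 0 = of_real a" "?b = of_real b"
    by (auto simp: less_eq_complex_def a_def b_def complex_eq_iff simp del: of_real_power)
      (smt (verit) zero_le_mult_iff zero_less_power)+
  have "\<bar>b\<bar> ^ m \<le> 2 ^ k * a ^ m" if "0 < m" for m
  proof -
    have r: "0 \<le> 2 ^ k * a ^ m + s * b ^ m" if "\<bar>s\<bar> = 1" for s
    proof -
      have "0 \<le> complex_of_real (2 ^ k * a ^ m + s * b ^ m)"
        using pos[OF \<open>0 < m\<close> that] unfolding re by simp
      then show ?thesis by (simp only: less_eq_complex_def) simp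
    qed
    show ?thesis using r[of 1] r[of "-1"] unfolding power_abs[symmetric] by linarith
  qed
  then have "\<bar>b\<bar> \<le> a" using re(1) by (intro base_le_if_powers_le[of "\<bar>b\<bar>" a "2 ^ k"]) simp_all
  moreover have "(\<Sum>i = 0..k. \<alpha> i i) = of_real (a + b)"
    using re by (subst sum.atLeast_Suc_atMost) auto
  ultimately show ?thesis by (simp add: less_eq_complex_def)
qed

subsection \<open>Tensor powers of annihilating maps\<close>

lemma of_real_nonneg: "0 \<le> c \<Longrightarrow> 0 \<le> complex_of_real c"
  by (simp add: less_eq_complex_def)

text \<open>The functional Tr(C^T X), without conjugation, hence linear in \<open>C\<close> and in
  \<open>X\<close>.\<close>

definition coeff_sum :: "nat \<Rightarrow> (nat \<Rightarrow> nat \<Rightarrow> complex) \<Rightarrow> complex mat \<Rightarrow> complex" where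
  "coeff_sum d C X = (\<Sum>r<d. \<Sum>s<d. C r s * X $$ (r, s))"

lemma coeff_sum_smult:
  "X \<in> carrier_mat d d \<Longrightarrow> coeff_sum d C (z \<cdot>\<^sub>m X) = z * coeff_sum d C X"
  by (simp add: coeff_sum_def sum_distrib_left mult.left_commute)

lemma coeff_sum_scale: "coeff_sum d (\<lambda>r s. z * C r s) X = z * coeff_sum d C X"
  by (simp add: coeff_sum_def sum_distrib_left mult.assoc)

lemma coeff_sum_msum:
  "coeff_sum d C (msum d L f) = (\<Sum>l\<in>L. coeff_sum d C (f l))"
proof -
  have "coeff_sum d C (msum d L f) = (\<Sum>r<d. \<Sum>s<d. \<Sum>l\<in>L. C r s * f l $$ (r, s))"
    unfolding coeff_sum_def by (intro sum.cong refl) (simp add: msum_def sum_distrib_left)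
  then show ?thesis unfolding coeff_sum_def by (rule trans) (rule sum_swap_inner[symmetric])
qed

lemma mat_trace_mult:
  assumes "X \<in> carrier_mat d d" "Y \<in> carrier_mat d d"
  shows "mat_trace (X * Y) = coeff_sum d (\<lambda>r s. X $$ (s, r)) Y"
proof -
  have "mat_trace (X * Y) = (\<Sum>i<d. \<Sum>j<d. X $$ (i, j) * Y $$ (j, i))"
    using assms by (auto simp: mat_trace_def scalar_prod_def atLeast0LessThan intro!: sum.cong)
  then show ?thesis unfolding coeff_sum_def by (subst sum.swap)
qed

lemma coeff_sum_swap:
  "coeff_sum d (\<lambda>r s. X $$ (s, r)) Y = coeff_sum d (\<lambda>r s. Y $$ (s, r)) X"
  unfolding coeff_sum_def by (subst sum.swap) (simp add: mult.commute)

text \<open>\<open>K\<close> has to factor only on the index range; this covers both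
  \<open>kron_coeff\<close> and the transpose of a Kronecker product.\<close>

lemma coeff_sum_kron:
  assumes X: "X \<in> carrier_mat c c" and Y: "Y \<in> carrier_mat d d"
    and CD: "\<And>r s. r < c * d \<Longrightarrow> s < c * d \<Longrightarrow> K r s = C (r div d) (s div d) * D (r mod d) (s mod d)"
  shows "coeff_sum (c * d) K (kron X Y) = coeff_sum c C X * coeff_sum d D Y"
proof -
  let ?f = "\<lambda>i j i' j'. (C i i' * X $$ (i, i')) * (D j j' * Y $$ (j, j'))"
  have "coeff_sum (c * d) K (kron X Y)
      = (\<Sum>r<c * d. \<Sum>s<c * d. ?f (r div d) (r mod d) (s div d) (s mod d))"
    unfolding coeff_sum_def using X Y by (intro sum.cong refl) (simp add: CD kron_def)
  also have "\<dots> = (\<Sum>i<c. \<Sum>j<d. \<Sum>i'<c. \<Sum>j'<d. ?f i j i' j')"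
    by (subst sum_digits, subst sum_digits[where f = "\<lambda>i j. \<Sum>i'<c. \<Sum>j'<d. ?f i j i' j'"]) (rule refl)
  also have "\<dots> = (\<Sum>i<c. \<Sum>i'<c. \<Sum>j<d. \<Sum>j'<d. ?f i j i' j')"
    by (intro sum.cong refl sum.swap)
  finally show ?thesis
    unfolding coeff_sum_def sum_distrib_right by (simp only: sum_distrib_left)
qed

text \<open>The tensor product of functionals, with digits read as in
  \<open>kron_list\<close>.\<close>

fun kron_coeff :: "nat \<Rightarrow> (nat \<Rightarrow> nat \<Rightarrow> complex) list \<Rightarrow> nat \<Rightarrow> nat \<Rightarrow> complex" where
  "kron_coeff d [] = (\<lambda>_ _. 1)"
| "kron_coeff d (C # Cs) = (\<lambda>r s. C (r div d ^ length Cs) (s div d ^ length Cs) *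
      kron_coeff d Cs (r mod d ^ length Cs) (s mod d ^ length Cs))"

lemma kron_carrier:
  "X \<in> carrier_mat c c \<Longrightarrow> Y \<in> carrier_mat d d \<Longrightarrow> kron X Y \<in> carrier_mat (c * d) (c * d)"
  by (auto simp: kron_def)

lemma kron_list_carrier:
  "set xs \<subseteq> carrier_mat d d \<Longrightarrow> kron_list xs \<in> carrier_mat (d ^ length xs) (d ^ length xs)"
  by (induction xs) (auto intro: kron_carrier)

lemma coeff_sum_kron_list:
  assumes "length Cs = length xs" "set xs \<subseteq> carrier_mat d d"
  shows "coeff_sum (d ^ length xs) (kron_coeff d Cs) (kron_list xs) = prod_list (map2 (coeff_sum d) Cs xs)"
  using assms
proof (induction Cs xs rule: list_induct2)
  case Nil
  then show ?case by (simp add: coeff_sum_def)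
next
  case (Cons C Cs x xs)
  then show ?case
    using coeff_sum_kron[of x d "kron_list xs" "d ^ length xs" "kron_coeff d (C # Cs)" C "kron_coeff d Cs"]
      kron_list_carrier[of xs d] by simp
qed

lemma mat_trace_kron_list:
  assumes "length xs = length ys" "set xs \<subseteq> carrier_mat d d" "set ys \<subseteq> carrier_mat d d"
  shows "mat_trace (kron_list xs * kron_list ys) = prod_list (map2 (\<lambda>x y. mat_trace (x * y)) xs ys)"
  using assms
proof (induction xs ys rule: list_induct2)
  case Nil
  then show ?case by (simp add: mat_trace_def)
next
  case (Cons x xs y ys)
  let ?e = "d ^ length ys"
  have c: "x \<in> carrier_mat d d" "y \<in> carrier_mat d d"
    "kron_list xs \<in> carrier_mat ?e ?e" "kron_list ys \<in> carrier_mat ?e ?e"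
    using Cons kron_list_carrier[of xs d] kron_list_carrier[of ys d] by auto
  have "mat_trace (kron x (kron_list xs) * kron y (kron_list ys))
      = coeff_sum (d * ?e) (\<lambda>r s. kron x (kron_list xs) $$ (s, r)) (kron y (kron_list ys))"
    using c by (intro mat_trace_mult kron_carrier)
  also have "\<dots> = coeff_sum d (\<lambda>r s. x $$ (s, r)) y * coeff_sum ?e (\<lambda>r s. kron_list xs $$ (s, r)) (kron_list ys)"
    using c by (intro coeff_sum_kron) (auto simp: kron_def)
  also have "\<dots> = mat_trace (x * y) * mat_trace (kron_list xs * kron_list ys)"
    using c by (simp add: mat_trace_mult)
  finally show ?case using Cons by simp
qed

lemma prod_list_upt: "prod_list (map f [0..<m]) = (\<Prod>t<m. f t)" for f :: "nat \<Rightarrow> 'a :: comm_monoid_mult"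
  by (simp add: prod.distinct_set_conv_list[symmetric] atLeast0LessThan)

lemma map2_upt: "map2 f (map g [0..<m]) (map h [0..<m]) = map (\<lambda>t. f (g t) (h t)) [0..<m]"
  by (simp add: zip_map_map zip_same_conv_map)

lemma mat_linear_msum:
  assumes T: "mat_linear p q T" and fin: "finite L" and f: "\<And>l. l \<in> L \<Longrightarrow> f l \<in> carrier_mat p p"
  shows "T (msum p L f) = msum q L (\<lambda>l. T (f l))"
  using fin f
proof (induction L)
  case empty
  have "T (0 \<cdot>\<^sub>m 0\<^sub>m p p) = 0 \<cdot>\<^sub>m T (0\<^sub>m p p)" "T (0\<^sub>m p p) \<in> carrier_mat q q"
    using T zero_carrier_mat[of p p] unfolding mat_linear_def by blast+
  moreover have "msum p {} f = 0 \<cdot>\<^sub>m 0\<^sub>m p p" by (auto simp: msum_def)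
  ultimately show ?case by (intro eq_matI) (auto simp: msum_def simp del: smult_zero_mat)
next
  case (insert l L)
  have c: "f l \<in> carrier_mat p p" "msum p L f \<in> carrier_mat p p" "T (f l) \<in> carrier_mat q q"
    using insert T by (auto simp: msum_def mat_linear_def)
  have "msum p (insert l L) f = f l + msum p L f"
    using insert c by (auto simp: msum_def)
  then have "T (msum p (insert l L) f) = T (f l) + T (msum p L f)"
    using T c by (simp add: mat_linear_def)
  also have "\<dots> = T (f l) + msum q L (\<lambda>l. T (f l))" using insert by simp
  also have "\<dots> = msum q (insert l L) (\<lambda>l. T (f l))" using insert c by (auto simp: msum_def)
  finally show ?case .
qed

lemma smult_herm:
  assumes "A \<in> herm d"
  shows "complex_of_real c \<cdot>\<^sub>m A \<in> herm d"
proof (rule hermI)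
  have A: "A \<in> carrier_mat d d" using assms by (simp add: herm_def)
  then show "complex_of_real c \<cdot>\<^sub>m A \<in> carrier_mat d d" by simp
  show "(complex_of_real c \<cdot>\<^sub>m A) $$ (j, i) = cnj ((complex_of_real c \<cdot>\<^sub>m A) $$ (i, j))"
    if "i < d" "j < d" for i j
    using A that hermD[OF assms that] by simp
qed

lemma kron_herm:
  assumes "X \<in> herm c" "Y \<in> herm d"
  shows "kron X Y \<in> herm (c * d)"
proof (rule hermI)
  have c: "X \<in> carrier_mat c c" "Y \<in> carrier_mat d d" using assms by (simp_all add: herm_def)
  then show "kron X Y \<in> carrier_mat (c * d) (c * d)" by (rule kron_carrier)
  fix i j assume ij: "i < c * d" "j < c * d"
  show "kron X Y $$ (j, i) = cnj (kron X Y $$ (i, j))"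
    using c ij hermD[OF assms(1), of "i div d" "j div d"] hermD[OF assms(2), of "i mod d" "j mod d"]
    by (simp add: kron_def digit_bounds)
qed

lemma kron_list_herm: "set xs \<subseteq> herm d \<Longrightarrow> kron_list xs \<in> herm (d ^ length xs)"
proof (induction xs)
  case Nil
  show ?case by (rule hermI) auto
qed (auto intro: kron_herm)

section \<open>Lorentz-positive maps and the maximal tensor power\<close>

definition lorentz :: "nat \<Rightarrow> (nat \<Rightarrow> real) \<Rightarrow> bool" where
  "lorentz k x \<longleftrightarrow> sqrt (\<Sum>i = 1..k. (x i)\<^sup>2) \<le> x 0"

text \<open>The trace against a product of positive matrices y_t evaluates the form with
  coefficients \<open>z\<close> at the vectors with coordinates Tr(B_t,j y_t). These are Lorentz
  vectors by hypothesis, and the minimal tensor power consists of combinations of such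
  products.\<close>

lemma tensor_in_max_tensor_pow:
  fixes m :: nat and B :: "nat \<Rightarrow> nat \<Rightarrow> complex mat"
  assumes herm: "\<And>t j. t < m \<Longrightarrow> B t j \<in> herm a"
    and B: "\<And>t y. t < m \<Longrightarrow> y \<in> PSD a \<Longrightarrow> \<exists>x. lorentz k x \<and> (\<forall>j\<le>k. mat_trace (B t j * y) = of_real (x j))"
    and z: "\<And>x. (\<And>t. t < m \<Longrightarrow> lorentz k (x t)) \<Longrightarrow>
      0 \<le> (\<Sum>I\<in>PiE {..<m} (\<lambda>_. {0..k}). z I * (\<Prod>t<m. x t (I t)))"
  shows "msum (a ^ m) (PiE {..<m} (\<lambda>_. {0..k})) (\<lambda>J. complex_of_real (z J) \<cdot>\<^sub>m kron_list (map (\<lambda>t. B t (J t)) [0..<m]))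
    \<in> max_tensor_pow a m" (is "?Z \<in> _")
proof -
  let ?P = "PiE {..<m} (\<lambda>_. {0..k})" and ?K = "\<lambda>J. kron_list (map (\<lambda>t. B t (J t)) [0..<m])"
  have Bc: "B t j \<in> carrier_mat a a" if "t < m" for t j using herm[OF that] by (simp add: herm_def)
  have Kh: "?K J \<in> herm (a ^ m)" for J
  proof -
    have "set (map (\<lambda>t. B t (J t)) [0..<m]) \<subseteq> herm a" using herm by auto
    from kron_list_herm[OF this] show ?thesis by simp
  qed
  then have Kc: "?K J \<in> carrier_mat (a ^ m) (a ^ m)" for J by (simp add: herm_def)
  have Zc: "?Z \<in> carrier_mat (a ^ m) (a ^ m)" by (simp add: msum_def)
  have "?Z \<in> herm (a ^ m)"
  proof (rule hermI[OF Zc])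
    fix i j assume ij: "i < a ^ m" "j < a ^ m"
    have "of_real (z J) * ?K J $$ (j, i) = cnj (of_real (z J) * ?K J $$ (i, j))" for J
      using hermD[OF Kh ij, of J] by simp
    moreover have "?Z $$ (r, s) = (\<Sum>J\<in>?P. of_real (z J) * ?K J $$ (r, s))" if "r < a ^ m" "s < a ^ m" for r s
      using that carrier_matD[OF Kc] by (simp add: msum_def)
    ultimately show "?Z $$ (j, i) = cnj (?Z $$ (i, j))"
      using ij by (simp only: cnj_sum)
  qed
  moreover have "0 \<le> mat_trace (?Z * y)" if "y \<in> min_tensor_pow a m" for y
  proof -
    from that obtain N :: nat and c A where c: "\<And>l. l < N \<Longrightarrow> 0 \<le> c l"
      and A: "\<And>l. l < N \<Longrightarrow> A l \<in> {kron_list xs | xs. length xs = m \<and> set xs \<subseteq> PSD a}"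
      and y: "y = msum (a ^ m) {..<N} (\<lambda>l. complex_of_real (c l) \<cdot>\<^sub>m A l)"
      unfolding min_tensor_pow_def mconv_def by blast
    have "mat_trace (?Z * y) = coeff_sum (a ^ m) (\<lambda>r s. ?Z $$ (s, r)) y"
      by (rule mat_trace_mult[OF Zc]) (simp add: y msum_def)
    also have "\<dots> = (\<Sum>l<N. coeff_sum (a ^ m) (\<lambda>r s. ?Z $$ (s, r)) (complex_of_real (c l) \<cdot>\<^sub>m A l))"
      unfolding y by (rule coeff_sum_msum)
    also have "0 \<le> \<dots>"
    proof (rule sum_nonneg)
      fix l assume "l \<in> {..<N}"
      then have l: "l < N" by simp
      from A[OF l] obtain xs where xs: "A l = kron_list xs" "length xs = m" "set xs \<subseteq> PSD a" by blast
      have nth: "xs ! t \<in> PSD a" if "t < m" for t using xs that nth_mem by blast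
      have xc: "set xs \<subseteq> carrier_mat a a" using xs PSD_carrier by blast
      then have Ac: "A l \<in> carrier_mat (a ^ m) (a ^ m)" using xs kron_list_carrier[of xs a] by simp
      have "\<forall>t. \<exists>x. t < m \<longrightarrow> lorentz k x \<and> (\<forall>j\<le>k. mat_trace (B t j * xs ! t) = of_real (x j))"
        using B nth by blast
      then obtain x where x: "\<And>t. t < m \<Longrightarrow> lorentz k (x t)"
        "\<And>t j. t < m \<Longrightarrow> j \<le> k \<Longrightarrow> mat_trace (B t j * xs ! t) = of_real (x t j)" by metis
      have tr: "mat_trace (?K J * A l) = of_real (\<Prod>t<m. x t (J t))" if "J \<in> ?P" for J
      proof -
        have "mat_trace (?K J * A l)
            = prod_list (map2 (\<lambda>x y. mat_trace (x * y)) (map (\<lambda>t. B t (J t)) [0..<m]) xs)"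
          unfolding xs(1) using xs xc Bc by (intro mat_trace_kron_list) auto
        also have "\<dots> = (\<Prod>t<m. mat_trace (B t (J t) * xs ! t))"
        proof -
          have "map2 (\<lambda>x y. mat_trace (x * y)) (map (\<lambda>t. B t (J t)) [0..<m]) xs
              = map (\<lambda>t. mat_trace (B t (J t) * xs ! t)) [0..<m]"
            using xs(2) by (intro nth_equalityI) auto
          then show ?thesis by (simp only: prod_list_upt)
        qed
        also have "\<dots> = (\<Prod>t<m. of_real (x t (J t)))"
          using that by (intro prod.cong refl) (auto simp: x PiE_iff)
        finally show ?thesis by simp
      qed
      have "coeff_sum (a ^ m) (\<lambda>r s. ?Z $$ (s, r)) (A l) = coeff_sum (a ^ m) (\<lambda>r s. A l $$ (s, r)) ?Z"
        by (rule coeff_sum_swap)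
      also have "\<dots> = (\<Sum>J\<in>?P. of_real (z J) * coeff_sum (a ^ m) (\<lambda>r s. A l $$ (s, r)) (?K J))"
        unfolding coeff_sum_msum using Kc by (simp add: coeff_sum_smult)
      also have "\<dots> = (\<Sum>J\<in>?P. of_real (z J) * mat_trace (?K J * A l))"
        unfolding mat_trace_mult[OF Kc Ac] by (subst coeff_sum_swap) (rule refl)
      also have "\<dots> = of_real (\<Sum>J\<in>?P. z J * (\<Prod>t<m. x t (J t)))" by (simp add: tr)
      finally have "coeff_sum (a ^ m) (\<lambda>r s. ?Z $$ (s, r)) (complex_of_real (c l) \<cdot>\<^sub>m A l)
          = of_real (c l * (\<Sum>J\<in>?P. z J * (\<Prod>t<m. x t (J t))))"
        using Ac by (simp add: coeff_sum_smult)
      moreover have "0 \<le> c l * (\<Sum>J\<in>?P. z J * (\<Prod>t<m. x t (J t)))"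
        using c[OF l] z[OF x(1)] by (intro mult_nonneg_nonneg) auto
      ultimately show "0 \<le> coeff_sum (a ^ m) (\<lambda>r s. ?Z $$ (s, r)) (complex_of_real (c l) \<cdot>\<^sub>m A l)"
        by (simp only: of_real_nonneg)
    qed
    finally show ?thesis .
  qed
  ultimately show ?thesis by (simp add: max_tensor_pow_def)
qed

text \<open>The annihilation hypothesis enters here: it makes the image of the tensor built from
  \<open>z\<close> a combination of products, and on each product the functional built from
  \<open>w\<close> is a form evaluated at Lorentz vectors. \<open>B\<close> and \<open>C\<close> may
  depend on the factor \<open>t\<close>, which leaves room for independent sign flips.\<close>

lemma annihilating_pairing_nonneg:
  fixes m :: nat and B :: "nat \<Rightarrow> nat \<Rightarrow> complex mat"
  assumes m: "0 < m" and P: "entanglement_annihilating a b P"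
    and herm: "\<And>t j. t < m \<Longrightarrow> B t j \<in> herm a"
    and B: "\<And>t y. t < m \<Longrightarrow> y \<in> PSD a \<Longrightarrow> \<exists>x. lorentz k x \<and> (\<forall>j\<le>k. mat_trace (B t j * y) = of_real (x j))"
    and C: "\<And>t y. t < m \<Longrightarrow> y \<in> PSD b \<Longrightarrow> \<exists>x. lorentz k x \<and> (\<forall>i\<le>k. coeff_sum b (C t i) y = of_real (x i))"
    and w: "\<And>x. (\<And>t. t < m \<Longrightarrow> lorentz k (x t)) \<Longrightarrow>
      0 \<le> (\<Sum>I\<in>PiE {..<m} (\<lambda>_. {0..k}). w I * (\<Prod>t<m. x t (I t)))"
    and z: "\<And>x. (\<And>t. t < m \<Longrightarrow> lorentz k (x t)) \<Longrightarrow>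
      0 \<le> (\<Sum>I\<in>PiE {..<m} (\<lambda>_. {0..k}). z I * (\<Prod>t<m. x t (I t)))"
  shows "0 \<le> (\<Sum>I\<in>PiE {..<m} (\<lambda>_. {0..k}). \<Sum>J\<in>PiE {..<m} (\<lambda>_. {0..k}).
    of_real (w I * z J) * (\<Prod>t<m. coeff_sum b (C t (I t)) (P (B t (J t)))))"
proof -
  let ?P = "PiE {..<m} (\<lambda>_. {0..k})" and ?K = "\<lambda>J. kron_list (map (\<lambda>t. B t (J t)) [0..<m])"
  let ?K' = "\<lambda>J. kron_list (map (\<lambda>t. P (B t (J t))) [0..<m])"
  let ?C = "\<lambda>I. kron_coeff b (map (\<lambda>t. C t (I t)) [0..<m])"
  let ?Z = "msum (a ^ m) ?P (\<lambda>J. complex_of_real (z J) \<cdot>\<^sub>m ?K J)"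
  have lin: "mat_linear a b P" using P by (simp add: entanglement_annihilating_def)
  note linm = mat_linear_tensor_pow[OF lin, of m]
  have Bc: "B t j \<in> carrier_mat a a" if "t < m" for t j using herm[OF that] by (simp add: herm_def)
  have Kc: "?K J \<in> carrier_mat (a ^ m) (a ^ m)" for J
  proof -
    have "set (map (\<lambda>t. B t (J t)) [0..<m]) \<subseteq> carrier_mat a a" using Bc by auto
    from kron_list_carrier[OF this] show ?thesis by simp
  qed
  have K'c: "?K' J \<in> carrier_mat (b ^ m) (b ^ m)" for J
  proof -
    have "set (map (\<lambda>t. P (B t (J t))) [0..<m]) \<subseteq> carrier_mat b b"
      using Bc lin by (auto simp: mat_linear_def)
    from kron_list_carrier[OF this] show ?thesis by simp
  qed
  have "?Z \<in> max_tensor_pow a m" by (rule tensor_in_max_tensor_pow[OF herm B z])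
  moreover have "tensor_pow a b P m ` max_tensor_pow a m \<subseteq> min_tensor_pow b m"
    using P m by (simp add: entanglement_annihilating_def)
  ultimately have "tensor_pow a b P m ?Z \<in> min_tensor_pow b m" by blast
  then obtain N :: nat and c A where c: "\<And>l. l < N \<Longrightarrow> 0 \<le> c l"
    and A: "\<And>l. l < N \<Longrightarrow> A l \<in> {kron_list xs | xs. length xs = m \<and> set xs \<subseteq> PSD b}"
    and y: "tensor_pow a b P m ?Z = msum (b ^ m) {..<N} (\<lambda>l. complex_of_real (c l) \<cdot>\<^sub>m A l)"
    unfolding min_tensor_pow_def mconv_def by blast
  have K: "tensor_pow a b P m (?K J) = ?K' J" for J
  proof -
    have "set (map (\<lambda>t. B t (J t)) [0..<m]) \<subseteq> carrier_mat a a" using Bc by auto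
    from tensor_pow_kron_list(2)[OF lin this] show ?thesis by (simp add: comp_def)
  qed
  have "tensor_pow a b P m ?Z = msum (b ^ m) ?P (\<lambda>J. tensor_pow a b P m (complex_of_real (z J) \<cdot>\<^sub>m ?K J))"
    using Kc by (intro mat_linear_msum[OF linm]) (auto simp: finite_PiE)
  also have "\<dots> = msum (b ^ m) ?P (\<lambda>J. complex_of_real (z J) \<cdot>\<^sub>m ?K' J)"
    using linm Kc by (simp add: mat_linear_def K)
  finally have y': "tensor_pow a b P m ?Z = msum (b ^ m) ?P (\<lambda>J. complex_of_real (z J) \<cdot>\<^sub>m ?K' J)" .
  have Cprod: "coeff_sum (b ^ m) (?C I) (kron_list (map X [0..<m])) = (\<Prod>t<m. coeff_sum b (C t (I t)) (X t))"
    if "\<And>t. t < m \<Longrightarrow> X t \<in> carrier_mat b b" for I X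
  proof -
    have "coeff_sum (b ^ length (map X [0..<m])) (?C I) (kron_list (map X [0..<m]))
        = prod_list (map2 (coeff_sum b) (map (\<lambda>t. C t (I t)) [0..<m]) (map X [0..<m]))"
      using that by (intro coeff_sum_kron_list) auto
    then show ?thesis by (simp only: map2_upt prod_list_upt length_map length_upt diff_zero)
  qed
  have "(\<Sum>I\<in>?P. \<Sum>J\<in>?P. of_real (w I * z J) * (\<Prod>t<m. coeff_sum b (C t (I t)) (P (B t (J t)))))
      = (\<Sum>I\<in>?P. of_real (w I) * (\<Sum>J\<in>?P. of_real (z J) * coeff_sum (b ^ m) (?C I) (?K' J)))"
    using Bc lin by (simp add: Cprod mat_linear_def sum_distrib_left mult.assoc)
  also have "\<dots> = (\<Sum>I\<in>?P. of_real (w I) * coeff_sum (b ^ m) (?C I) (tensor_pow a b P m ?Z))"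
    unfolding y' coeff_sum_msum using K'c by (simp add: coeff_sum_smult)
  also have "\<dots> = (\<Sum>I\<in>?P. \<Sum>l<N. of_real (w I) * coeff_sum (b ^ m) (?C I) (complex_of_real (c l) \<cdot>\<^sub>m A l))"
    unfolding y coeff_sum_msum by (simp only: sum_distrib_left)
  also have "\<dots> = (\<Sum>l<N. \<Sum>I\<in>?P. of_real (w I) * coeff_sum (b ^ m) (?C I) (complex_of_real (c l) \<cdot>\<^sub>m A l))"
    by (rule sum.swap)
  also have "0 \<le> \<dots>"
  proof (rule sum_nonneg)
    fix l assume "l \<in> {..<N}"
    then have l: "l < N" by simp
    from A[OF l] obtain xs where xs: "A l = kron_list xs" "length xs = m" "set xs \<subseteq> PSD b" by blast
    have nth: "xs ! t \<in> PSD b" if "t < m" for t using xs that nth_mem by blast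
    have map_xs: "xs = map ((!) xs) [0..<m]" using xs(2) by (simp add: list_eq_iff_nth_eq)
    have "set xs \<subseteq> carrier_mat b b" using xs PSD_carrier by blast
    then have Ac: "A l \<in> carrier_mat (b ^ m) (b ^ m)" using xs kron_list_carrier[of xs b] by simp
    have "\<forall>t. \<exists>x. t < m \<longrightarrow> lorentz k x \<and> (\<forall>j\<le>k. coeff_sum b (C t j) (xs ! t) = of_real (x j))"
      using C nth by blast
    then obtain x where x: "\<And>t. t < m \<Longrightarrow> lorentz k (x t)"
      "\<And>t j. t < m \<Longrightarrow> j \<le> k \<Longrightarrow> coeff_sum b (C t j) (xs ! t) = of_real (x t j)" by metis
    have "coeff_sum (b ^ m) (?C I) (A l) = of_real (\<Prod>t<m. x t (I t))" if "I \<in> ?P" for I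
    proof -
      have "coeff_sum (b ^ m) (?C I) (A l) = (\<Prod>t<m. coeff_sum b (C t (I t)) (xs ! t))"
        unfolding xs(1) by (subst map_xs) (intro Cprod PSD_carrier nth)
      also have "\<dots> = (\<Prod>t<m. of_real (x t (I t)))"
        using that by (intro prod.cong refl) (auto simp: x PiE_iff)
      finally show ?thesis by simp
    qed
    then have "(\<Sum>I\<in>?P. of_real (w I) * coeff_sum (b ^ m) (?C I) (complex_of_real (c l) \<cdot>\<^sub>m A l))
        = of_real (c l * (\<Sum>I\<in>?P. w I * (\<Prod>t<m. x t (I t))))"
      using Ac by (simp add: coeff_sum_smult sum_distrib_left mult.left_commute)
    moreover have "0 \<le> c l * (\<Sum>I\<in>?P. w I * (\<Prod>t<m. x t (I t)))"
      using c[OF l] w[OF x(1)] by (intro mult_nonneg_nonneg) auto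
    ultimately show "0 \<le> (\<Sum>I\<in>?P. of_real (w I) * coeff_sum (b ^ m) (?C I) (complex_of_real (c l) \<cdot>\<^sub>m A l))"
      by (simp only: of_real_nonneg)
  qed
  finally show ?thesis .
qed

lemma lorentz_flip:
  assumes "lorentz k x" "E \<subseteq> {1..k}"
  shows "lorentz k (\<lambda>i. flip E i * x i)"
proof -
  have "(flip E i * x i)\<^sup>2 = (x i)\<^sup>2" for i by (simp add: flip_def power2_eq_square)
  moreover have "flip E 0 = 1" using assms(2) by (auto simp: flip_def)
  ultimately show ?thesis using assms(1) by (simp add: lorentz_def)
qed

lemma annihilating_trace_nonneg:
  assumes P: "entanglement_annihilating a b P"
    and herm: "\<And>j. B j \<in> herm a"
    and B: "\<And>y. y \<in> PSD a \<Longrightarrow> \<exists>x. lorentz k x \<and> (\<forall>j\<le>k. mat_trace (B j * y) = of_real (x j))"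
    and C: "\<And>y. y \<in> PSD b \<Longrightarrow> \<exists>x. lorentz k x \<and> (\<forall>i\<le>k. coeff_sum b (C i) y = of_real (x i))"
  shows "0 \<le> (\<Sum>i = 0..k. coeff_sum b (C i) (P (B i)))"
proof (rule trace_nonneg_if_tensor_powers_nonneg[where \<alpha> = "\<lambda>i j. coeff_sum b (C i) (P (B j))"])
  fix m s U and E :: "nat \<Rightarrow> nat set"
  assume m: "0 < m" and s: "\<bar>s :: real\<bar> = 1" and U: "U \<subseteq> {1..k}" and E: "\<And>t. t < m \<Longrightarrow> E t \<subseteq> {1..k}"
  have lin: "mat_linear a b P" using P by (simp add: entanglement_annihilating_def)
  have Bc: "B j \<in> carrier_mat a a" for j using herm by (simp add: herm_def)
  \<comment> \<open>The flips act diagonally and can be moved into \<open>B\<close> and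
    \<open>C\<close>, which still yield Lorentz vectors by \<open>lorentz_flip\<close>. Each summand
    of the average is thus a pairing covered by \<open>annihilating_pairing_nonneg\<close>.\<close>
  let ?B = "\<lambda>t j. complex_of_real (flip (E t) j) \<cdot>\<^sub>m B j"
  let ?C = "\<lambda>t i r s. complex_of_real (flip (E t) i) * C i r s"
  have nonneg: "0 \<le> (\<Sum>I\<in>PiE {..<m} (\<lambda>_. {0..k}). clifford_tensor k m s U I * (\<Prod>t<m. x t (I t)))"
    if "\<And>t. t < m \<Longrightarrow> lorentz k (x t)" "\<bar>s\<bar> = 1" for s x
    using that U by (intro clifford_tensor_nonneg) (auto simp: lorentz_def)
  have "0 \<le> (\<Sum>I\<in>PiE {..<m} (\<lambda>_. {0..k}). \<Sum>J\<in>PiE {..<m} (\<lambda>_. {0..k}).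
    of_real (clifford_tensor k m 1 U I * clifford_tensor k m s U J) *
    (\<Prod>t<m. coeff_sum b (?C t (I t)) (P (?B t (J t)))))"
  proof (rule annihilating_pairing_nonneg[OF m P])
    show "?B t j \<in> herm a" for t j
      by (rule smult_herm[OF herm])
    show "\<exists>x. lorentz k x \<and> (\<forall>j\<le>k. mat_trace (?B t j * y) = of_real (x j))"
      if ty: "t < m" "y \<in> PSD a" for t y
    proof -
      obtain x where x: "lorentz k x" "\<And>j. j \<le> k \<Longrightarrow> mat_trace (B j * y) = of_real (x j)"
        using B[OF ty(2)] by blast
      have "mat_trace (?B t j * y) = of_real (flip (E t) j) * mat_trace (B j * y)" for j
        using Bc[of j] PSD_carrier[OF ty(2)]
        by (simp add: mat_trace_mult[of _ a] coeff_sum_swap[of _ _ y] coeff_sum_smult)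
      then show ?thesis using x lorentz_flip[OF x(1) E[OF ty(1)]] by auto
    qed
    show "\<exists>x. lorentz k x \<and> (\<forall>i\<le>k. coeff_sum b (?C t i) y = of_real (x i))"
      if ty: "t < m" "y \<in> PSD b" for t y
    proof -
      obtain x where x: "lorentz k x" "\<And>i. i \<le> k \<Longrightarrow> coeff_sum b (C i) y = of_real (x i)"
        using C[OF ty(2)] by blast
      then show ?thesis using lorentz_flip[OF x(1) E[OF ty(1)]] by (auto simp: coeff_sum_scale)
    qed
  qed (use nonneg s in auto)
  moreover have "coeff_sum b (?C t i) (P (?B t j))
      = of_real (flip (E t) i * flip (E t) j) * coeff_sum b (C i) (P (B j))" for t i j
  proof -
    have "P (?B t j) = of_real (flip (E t) j) \<cdot>\<^sub>m P (B j)" "P (B j) \<in> carrier_mat b b"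
      using lin Bc by (simp_all add: mat_linear_def)
    then show ?thesis by (simp add: coeff_sum_scale coeff_sum_smult)
  qed
  ultimately show "0 \<le> (\<Sum>I\<in>PiE {..<m} (\<lambda>_. {0..k}). \<Sum>J\<in>PiE {..<m} (\<lambda>_. {0..k}).
      of_real (clifford_tensor k m 1 U I * clifford_tensor k m s U J) *
      (\<Prod>t<m. of_real (flip (E t) (I t) * flip (E t) (J t)) * coeff_sum b (C (I t)) (P (B (J t)))))"
    by (simp only:)
qed

subsection \<open>Factorization through the Lorentz cone\<close>

text \<open>The real part in the sense of the decomposition X = H + \<i> K with self-adjoint H and
  K, not entrywise; \<open>mat_im\<close> gives K.\<close>

definition mat_re :: "nat \<Rightarrow> complex mat \<Rightarrow> complex mat" where
  "mat_re d X = mat d d (\<lambda>(r, s). (X $$ (r, s) + cnj (X $$ (s, r))) / 2)"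

definition mat_im :: "nat \<Rightarrow> complex mat \<Rightarrow> complex mat" where
  "mat_im d X = mat d d (\<lambda>(r, s). \<i> / 2 * (cnj (X $$ (s, r)) - X $$ (r, s)))"

lemma mat_re_herm: "mat_re d X \<in> herm d"
  by (rule hermI) (simp_all add: mat_re_def add.commute)

lemma mat_im_herm: "mat_im d X \<in> herm d"
  by (rule hermI) (simp_all add: mat_im_def complex_eq_iff field_simps)

lemma mat_re_im:
  assumes "X \<in> carrier_mat d d"
  shows "X = mat_re d X + \<i> \<cdot>\<^sub>m mat_im d X"
  using assms by (intro eq_matI) (auto simp: mat_re_def mat_im_def complex_eq_iff field_simps)

text \<open>The complexification F(H + \<i> K) = f(H) + \<i> f(K) is complex linear, so its
  coefficients are its values at the matrix units. These need not be self-adjoint, so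
  \<open>f\<close> itself could not be evaluated there.\<close>

lemma real_functional_coeff:
  assumes add: "\<And>X Y. X \<in> herm d \<Longrightarrow> Y \<in> herm d \<Longrightarrow> f (X + Y) = f X + f Y"
    and smult: "\<And>t X. X \<in> herm d \<Longrightarrow> f (complex_of_real t \<cdot>\<^sub>m X) = t * f X"
  obtains C where "\<And>X. X \<in> herm d \<Longrightarrow> coeff_sum d C X = of_real (f X)"
proof -
  define F where "F X = of_real (f (mat_re d X)) + \<i> * of_real (f (mat_im d X))" for X
  note h = mat_re_herm mat_im_herm
  have c: "mat_re d X \<in> carrier_mat d d" "mat_im d X \<in> carrier_mat d d" for X
    by (simp_all add: mat_re_def mat_im_def)
  \<comment> \<open>A scalar functional is viewed as a map into 1 x 1 matrices, so that
    \<open>mat_linear_expand\<close> provides its coefficients.\<close>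
  have "mat_linear d 1 (\<lambda>X. mat 1 1 (\<lambda>_. F X))"
    unfolding mat_linear_def
  proof (intro conjI ballI allI)
    fix X Y :: "complex mat" assume XY: "X \<in> carrier_mat d d" "Y \<in> carrier_mat d d"
    have "mat_re d (X + Y) = mat_re d X + mat_re d Y" "mat_im d (X + Y) = mat_im d X + mat_im d Y"
      using XY by (auto simp: mat_re_def mat_im_def complex_eq_iff field_simps intro!: eq_matI)
    then have "F (X + Y) = F X + F Y" by (simp add: F_def add h algebra_simps)
    then show "mat 1 1 (\<lambda>_. F (X + Y)) = mat 1 1 (\<lambda>_. F X) + mat 1 1 (\<lambda>_. F Y)"
      by (intro eq_matI) auto
  next
    fix z and X :: "complex mat" assume X: "X \<in> carrier_mat d d"
    let ?a = "\<lambda>t. complex_of_real t \<cdot>\<^sub>m mat_re d X" and ?b = "\<lambda>t. complex_of_real t \<cdot>\<^sub>m mat_im d X"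
    have "mat_re d (z \<cdot>\<^sub>m X) = ?a (Re z) + ?b (- Im z)" "mat_im d (z \<cdot>\<^sub>m X) = ?a (Im z) + ?b (Re z)"
      using X by (auto simp: mat_re_def mat_im_def complex_eq_iff field_simps intro!: eq_matI)
    then have "F (z \<cdot>\<^sub>m X) = z * F X"
      by (simp add: F_def add smult h smult_herm complex_eq_iff algebra_simps del: of_real_minus)
    then show "mat 1 1 (\<lambda>_. F (z \<cdot>\<^sub>m X)) = z \<cdot>\<^sub>m mat 1 1 (\<lambda>_. F X)"
      by (intro eq_matI) auto
  qed simp
  note expand = mat_linear_expand[OF this]
  have "coeff_sum d (\<lambda>i j. F (munit d i j)) X = of_real (f X)" if X: "X \<in> herm d" for X
  proof -
    have Xc: "X \<in> carrier_mat d d" using X by (simp add: herm_def)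
    have "F X = mat 1 1 (\<lambda>_. F X) $$ (0, 0)" by simp
    also have "\<dots> = coeff_sum d (\<lambda>i j. F (munit d i j)) X"
      unfolding coeff_sum_def
      by (subst expand[OF Xc]) (simp add: msum_def split_def sum.cartesian_product mult.commute)
    finally have FX: "F X = coeff_sum d (\<lambda>i j. F (munit d i j)) X" .
    have re: "mat_re d X = X"
    proof (rule eq_matI)
      fix i j assume "i < dim_row X" "j < dim_col X"
      then have ij: "j < d" "i < d" using Xc by auto
      show "mat_re d X $$ (i, j) = X $$ (i, j)" using hermD[OF X ij] ij by (simp add: mat_re_def)
    qed (use Xc in \<open>auto simp: mat_re_def\<close>)
    \<comment> \<open>The zero matrix is written as 0 times a self-adjoint matrix, because
      homogeneity then gives the value 0 of \<open>f\<close>.\<close>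
    have zero: "mat_im d X = complex_of_real 0 \<cdot>\<^sub>m mat_im d X"
    proof (rule eq_matI)
      fix i j assume "i < dim_row (complex_of_real 0 \<cdot>\<^sub>m mat_im d X)" "j < dim_col (complex_of_real 0 \<cdot>\<^sub>m mat_im d X)"
      then have ij: "j < d" "i < d" by (auto simp: mat_im_def)
      show "mat_im d X $$ (i, j) = (complex_of_real 0 \<cdot>\<^sub>m mat_im d X) $$ (i, j)"
        using hermD[OF X ij] ij by (simp add: mat_im_def)
    qed (auto simp: mat_im_def)
    have "f (mat_im d X) = 0" using arg_cong[OF zero, of f] smult[OF h(2), of 0 X] by simp
    with re show ?thesis using FX by (simp add: F_def)
  qed
  then show ?thesis by (rule that)
qed

lemma vec_herm_linear_expand:
  assumes S: "vec_herm_linear n d S" and v: "v \<in> carrier_vec n"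
  shows "S v = msum d {..<n} (\<lambda>i. complex_of_real (v $ i) \<cdot>\<^sub>m S (unit_vec n i))"
proof -
  have Sc: "S w \<in> carrier_mat d d" if "w \<in> carrier_vec n" for w
    using S that by (auto simp: vec_herm_linear_def herm_def)
  have add: "S (v + w) = S v + S w" if "v \<in> carrier_vec n" "w \<in> carrier_vec n" for v w
    using S that by (simp add: vec_herm_linear_def)
  have smult: "S (t \<cdot>\<^sub>v w) = complex_of_real t \<cdot>\<^sub>m S w" if "w \<in> carrier_vec n" for t w
    using S that by (simp add: vec_herm_linear_def)
  have partial: "S (vec n (\<lambda>i. if i < m then v $ i else 0))
      = msum d {..<m} (\<lambda>i. complex_of_real (v $ i) \<cdot>\<^sub>m S (unit_vec n i))" if "m \<le> n" for m
    using that
  proof (induction m)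
    case 0
    have "vec n (\<lambda>i. if i < 0 then v $ i else 0) = 0 \<cdot>\<^sub>v 0\<^sub>v n" by (intro eq_vecI) auto
    then have "S (vec n (\<lambda>i. if i < 0 then v $ i else 0)) = 0 \<cdot>\<^sub>m S (0\<^sub>v n)"
      using smult[of "0\<^sub>v n" 0] by simp
    then show ?case using Sc[of "0\<^sub>v n"] by (intro eq_matI) (auto simp: msum_def)
  next
    case (Suc m)
    have "vec n (\<lambda>i. if i < Suc m then v $ i else 0)
        = vec n (\<lambda>i. if i < m then v $ i else 0) + v $ m \<cdot>\<^sub>v unit_vec n m"
      using Suc.prems by (intro eq_vecI) (auto simp: less_Suc_eq)
    then have "S (vec n (\<lambda>i. if i < Suc m then v $ i else 0))
        = S (vec n (\<lambda>i. if i < m then v $ i else 0)) + complex_of_real (v $ m) \<cdot>\<^sub>m S (unit_vec n m)"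
      by (simp add: add smult)
    then show ?case
      using Suc carrier_matD[OF Sc[OF unit_vec_carrier, of m]]
      by (auto simp: msum_def intro!: eq_matI)
  qed
  have v': "vec n (\<lambda>i. if i < n then v $ i else 0) = v" using v by (intro eq_vecI) auto
  from partial[OF le_refl] show ?thesis unfolding v' .
qed

text \<open>The factorization in coordinates: \<open>C l i\<close> represents the i-th component of
  the map R_l, and \<open>\<sigma> l i\<close> is the image of the i-th unit vector under S_l. The
  factorization is given on self-adjoint matrices; splitting \<open>X\<close> by
  \<open>mat_re\<close> and \<open>mat_im\<close> extends the formula to all matrices.\<close>

lemma Lorentz_factorization:
  assumes Q: "mat_linear b a Q" and fac: "factors_through_Lorentz k b a Q"
  obtains N :: nat and C \<sigma> where
    "\<And>l y. l < N \<Longrightarrow> y \<in> PSD b \<Longrightarrow> \<exists>x. lorentz k x \<and> (\<forall>i\<le>k. coeff_sum b (C l i) y = of_real (x i))"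
    "\<And>l x. l < N \<Longrightarrow> lorentz k x \<Longrightarrow> msum a {0..k} (\<lambda>i. complex_of_real (x i) \<cdot>\<^sub>m \<sigma> l i) \<in> PSD a"
    "\<And>l i. l < N \<Longrightarrow> \<sigma> l i \<in> carrier_mat a a"
    "\<And>X. X \<in> carrier_mat b b \<Longrightarrow> Q X = msum a {..<N} (\<lambda>l. msum a {0..k} (\<lambda>i. coeff_sum b (C l i) X \<cdot>\<^sub>m \<sigma> l i))"
proof -
  from fac obtain N :: nat and R S where
    RS: "\<forall>l<N. herm_vec_linear b (k + 1) (R l) \<and> R l ` PSD b \<subseteq> Lorentz k \<and>
      vec_herm_linear (k + 1) a (S l) \<and> S l ` Lorentz k \<subseteq> PSD a"
    and QRS: "\<forall>X\<in>herm b. Q X = msum a {..<N} (\<lambda>l. S l (R l X))"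
    unfolding factors_through_Lorentz_def by (elim exE conjE) (rule that; assumption)
  have R: "herm_vec_linear b (k + 1) (R l)" "R l ` PSD b \<subseteq> Lorentz k"
    and S: "vec_herm_linear (k + 1) a (S l)" "S l ` Lorentz k \<subseteq> PSD a" if "l < N" for l
    using RS that by simp_all
  have Qh: "Q X = msum a {..<N} (\<lambda>l. S l (R l X))" if "X \<in> herm b" for X
    using QRS that by simp
  have Rc: "R l X \<in> carrier_vec (k + 1)" if "l < N" "X \<in> herm b" for l X
    using R(1)[OF that(1)] that(2) by (simp add: herm_vec_linear_def)
  have "\<exists>D. l < N \<longrightarrow> i \<le> k \<longrightarrow> (\<forall>X\<in>herm b. coeff_sum b D X = of_real (R l X $ i))" for l i
  proof (cases "l < N \<and> i \<le> k")
    case True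
    then have l: "l < N" and i: "i < k + 1" by auto
    obtain D where "\<And>X. X \<in> herm b \<Longrightarrow> coeff_sum b D X = of_real (R l X $ i)"
    proof (rule real_functional_coeff[of b "\<lambda>X. R l X $ i"])
      show "R l (X + Y) $ i = R l X $ i + R l Y $ i" if "X \<in> herm b" "Y \<in> herm b" for X Y
      proof -
        have "R l (X + Y) = R l X + R l Y" using R(1)[OF l] that by (simp add: herm_vec_linear_def)
        then show ?thesis using i Rc[OF l that(2)] by simp
      qed
      show "R l (complex_of_real t \<cdot>\<^sub>m X) $ i = t * R l X $ i" if "X \<in> herm b" for t X
      proof -
        have "R l (complex_of_real t \<cdot>\<^sub>m X) = t \<cdot>\<^sub>v R l X" using R(1)[OF l] that by (simp add: herm_vec_linear_def)
        then show ?thesis using i Rc[OF l that] by simp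
      qed
    qed (use that in blast)
    then show ?thesis by blast
  qed auto
  then obtain C where C: "\<And>l i X. l < N \<Longrightarrow> i \<le> k \<Longrightarrow> X \<in> herm b \<Longrightarrow> coeff_sum b (C l i) X = of_real (R l X $ i)"
    by metis
  define \<sigma> where "\<sigma> l i = S l (unit_vec (k + 1) i)" for l i
  have \<sigma>: "\<sigma> l i \<in> carrier_mat a a" if "l < N" for l i
    using S(1)[OF that] unit_vec_carrier[of "k + 1" i] unfolding \<sigma>_def vec_herm_linear_def herm_def by blast
  have range: "{..<k + 1} = {0..k}" by auto
  have Sx: "S l v = msum a {0..k} (\<lambda>i. complex_of_real (v $ i) \<cdot>\<^sub>m \<sigma> l i)" if "l < N" "v \<in> carrier_vec (k + 1)" for l v
    using vec_herm_linear_expand[OF S(1)[OF that(1)] that(2)] unfolding range \<sigma>_def .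
  show ?thesis
  proof (rule that)
    show "\<exists>x. lorentz k x \<and> (\<forall>i\<le>k. coeff_sum b (C l i) y = of_real (x i))" if ly: "l < N" "y \<in> PSD b" for l y
    proof -
      have "y \<in> herm b" using ly by (simp add: PSD_def)
      moreover have "lorentz k (($) (R l y))" using R(2) ly by (auto simp: Lorentz_def lorentz_def)
      ultimately show ?thesis using C[OF ly(1)] by blast
    qed
    show "msum a {0..k} (\<lambda>i. complex_of_real (x i) \<cdot>\<^sub>m \<sigma> l i) \<in> PSD a" if l: "l < N" "lorentz k x" for l x
    proof -
      let ?v = "vec (k + 1) x"
      have "(\<Sum>i = 1..k. (?v $ i)\<^sup>2) = (\<Sum>i = 1..k. (x i)\<^sup>2)" by (intro sum.cong) auto
      then have "?v \<in> Lorentz k" using l(2) by (simp add: Lorentz_def lorentz_def)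
      then have "S l ?v \<in> PSD a" using S(2)[OF l(1)] by blast
      moreover have "msum a {0..k} (\<lambda>i. complex_of_real (?v $ i) \<cdot>\<^sub>m \<sigma> l i)
          = msum a {0..k} (\<lambda>i. complex_of_real (x i) \<cdot>\<^sub>m \<sigma> l i)"
        unfolding msum_def by (intro cong_mat) (auto intro!: sum.cong)
      ultimately show ?thesis using Sx[OF l(1), of ?v] by simp
    qed
    show "Q X = msum a {..<N} (\<lambda>l. msum a {0..k} (\<lambda>i. coeff_sum b (C l i) X \<cdot>\<^sub>m \<sigma> l i))"
      if X: "X \<in> carrier_mat b b" for X
    proof -
      let ?T = "\<lambda>X. msum a {..<N} (\<lambda>l. msum a {0..k} (\<lambda>i. coeff_sum b (C l i) X \<cdot>\<^sub>m \<sigma> l i))"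
      have QT: "Q Y = ?T Y" if Y: "Y \<in> herm b" for Y
      proof -
        have "S l (R l Y) = msum a {0..k} (\<lambda>i. coeff_sum b (C l i) Y \<cdot>\<^sub>m \<sigma> l i)" if "l < N" for l
          unfolding Sx[OF that Rc[OF that Y]] msum_def using that Y
          by (intro cong_mat) (auto simp: C intro!: sum.cong)
        then show ?thesis unfolding Qh[OF Y] msum_def by (intro cong_mat) (auto intro!: sum.cong)
      qed
      have c: "mat_re b X \<in> carrier_mat b b" "mat_im b X \<in> carrier_mat b b"
        by (simp_all add: mat_re_def mat_im_def)
      have "coeff_sum b D (mat_re b X + \<i> \<cdot>\<^sub>m mat_im b X)
          = coeff_sum b D (mat_re b X) + \<i> * coeff_sum b D (mat_im b X)" for D
        using c by (simp add: coeff_sum_def sum_distrib_left distrib_left sum.distrib mult.left_commute)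
      then have cX: "coeff_sum b D X = coeff_sum b D (mat_re b X) + \<i> * coeff_sum b D (mat_im b X)" for D
        using mat_re_im[OF X] by simp
      have "Q X = Q (mat_re b X) + \<i> \<cdot>\<^sub>m Q (mat_im b X)"
      proof -
        have "Q X = Q (mat_re b X + \<i> \<cdot>\<^sub>m mat_im b X)" using mat_re_im[OF X] by simp
        then show ?thesis using Q c by (simp add: mat_linear_def)
      qed
      also have "\<dots> = ?T (mat_re b X) + \<i> \<cdot>\<^sub>m ?T (mat_im b X)"
        using QT mat_re_herm mat_im_herm by simp
      also have "\<dots> = ?T X"
      proof (rule eq_matI)
        fix r s assume "r < dim_row (?T X)" "s < dim_col (?T X)"
        then have rs: "r < a" "s < a" by (simp_all add: msum_def)
        have ent: "?T Y $$ (r, s) = (\<Sum>l<N. \<Sum>i = 0..k. coeff_sum b (C l i) Y * \<sigma> l i $$ (r, s))" for Y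
          unfolding msum_def using rs carrier_matD[OF \<sigma>] by (auto intro!: sum.cong)
        have "(?T (mat_re b X) + \<i> \<cdot>\<^sub>m ?T (mat_im b X)) $$ (r, s)
            = ?T (mat_re b X) $$ (r, s) + \<i> * ?T (mat_im b X) $$ (r, s)"
          using rs by (simp add: msum_def)
        also have "\<dots> = ?T X $$ (r, s)"
          unfolding ent unfolding cX by (simp add: distrib_right sum.distrib sum_distrib_left mult.assoc)
        finally show "(?T (mat_re b X) + \<i> \<cdot>\<^sub>m ?T (mat_im b X)) $$ (r, s) = ?T X $$ (r, s)" .
      qed (simp_all add: msum_def)
      finally show ?thesis .
    qed
  qed (rule \<sigma>)
qed

section \<open>Self-duality of the Lorentz cone\<close>

lemma lorentz_axis: "lorentz k (\<lambda>i. if i = 0 then 1 else 0)"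
proof -
  have "(\<Sum>i = 1..k. (if i = 0 then 1 else 0 :: real)\<^sup>2) = 0" by (intro sum.neutral) auto
  then show ?thesis by (simp add: lorentz_def)
qed

lemma lorentz_two_point:
  assumes "1 \<le> p" "p \<le> k" "\<bar>e\<bar> = 1"
  shows "lorentz k (\<lambda>i. if i = 0 then 1 else if i = p then e else 0)"
proof -
  have "(\<Sum>i = 1..k. (if i = 0 then 1 else if i = p then e else 0)\<^sup>2) = (\<Sum>i = 1..k. if i = p then 1 else 0)"
    using assms by (intro sum.cong) (auto simp: abs_square_eq_1)
  then show ?thesis using assms by (simp add: lorentz_def)
qed

lemma sum_axis: "(\<Sum>i = 0..k. of_real (if i = 0 then 1 else 0) * c i) = c 0" for c :: "nat \<Rightarrow> complex"
  by (simp add: sum.atLeast_Suc_atMost)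

lemma sum_two_point:
  fixes c :: "nat \<Rightarrow> complex"
  assumes "1 \<le> p" "p \<le> k"
  shows "(\<Sum>i = 0..k. of_real (if i = 0 then 1 else if i = p then e else 0) * c i) = c 0 + of_real e * c p"
proof -
  have "(\<Sum>i = 0..k. of_real (if i = 0 then 1 else if i = p then e else 0) * c i)
      = (\<Sum>i\<in>{0, p}. of_real (if i = 0 then 1 else if i = p then e else 0) * c i)"
    using assms by (intro sum.mono_neutral_right) auto
  then show ?thesis using assms by simp
qed

text \<open>Testing with e_0 and e_0 + e_i shows that the coefficients are real. Testing with (r,
  -c'), where c' is the spatial part of c and r its norm, gives r^2 \<le> r c_0.\<close>

lemma lorentz_self_dual:
  fixes c :: "nat \<Rightarrow> complex"
  assumes nonneg: "\<And>x. lorentz k x \<Longrightarrow> 0 \<le> (\<Sum>i = 0..k. of_real (x i) * c i)"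
  shows "\<exists>x. lorentz k x \<and> (\<forall>i\<le>k. c i = of_real (x i))"
proof -
  have c0: "0 \<le> c 0" using nonneg[OF lorentz_axis] unfolding sum_axis .
  have real: "c i = of_real (Re (c i))" if "i \<le> k" for i
  proof (cases "i = 0")
    case True
    then show ?thesis using c0 by (simp add: less_eq_complex_def complex_eq_iff)
  next
    case False
    then have "0 \<le> c 0 + of_real 1 * c i"
      using nonneg[OF lorentz_two_point[of i k 1]] sum_two_point[of i k 1 c] that by simp
    then show ?thesis using c0 by (simp add: less_eq_complex_def complex_eq_iff)
  qed
  let ?r = "sqrt (\<Sum>i = 1..k. (Re (c i))\<^sup>2)"
  have r: "0 \<le> ?r" "?r\<^sup>2 = (\<Sum>i = 1..k. (Re (c i))\<^sup>2)" by (simp_all add: sum_nonneg)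
  let ?x = "\<lambda>i. if i = 0 then ?r else - Re (c i)"
  have "(\<Sum>i = 1..k. (?x i)\<^sup>2) = (\<Sum>i = 1..k. (Re (c i))\<^sup>2)" by (intro sum.cong) auto
  then have "0 \<le> (\<Sum>i = 0..k. of_real (?x i) * c i)" by (intro nonneg) (simp add: lorentz_def)
  also have "(\<Sum>i = 0..k. of_real (?x i) * c i) = of_real (\<Sum>i = 0..k. ?x i * Re (c i))"
    unfolding of_real_sum of_real_mult by (intro sum.cong refl) (simp add: real[symmetric])
  also have "(\<Sum>i = 0..k. ?x i * Re (c i)) = ?r * Re (c 0) + (\<Sum>i = 1..k. ?x i * Re (c i))"
    by (simp add: sum.atLeast_Suc_atMost)
  also have "(\<Sum>i = 1..k. ?x i * Re (c i)) = (\<Sum>i = 1..k. - ((Re (c i))\<^sup>2))"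
    by (intro sum.cong) (auto simp: power2_eq_square)
  also have "\<dots> = - ?r * ?r" using r(2) by (simp add: sum_negf power2_eq_square)
  finally have "0 \<le> complex_of_real (?r * Re (c 0) + - ?r * ?r)" .
  then have "0 \<le> ?r * Re (c 0) + - ?r * ?r" by (simp only: less_eq_complex_def) simp
  then have le: "?r * ?r \<le> ?r * Re (c 0)" by linarith
  have "?r \<le> Re (c 0)"
  proof (cases "?r = 0")
    case True
    then show ?thesis using c0 by (simp only: less_eq_complex_def) simp
  next
    case False
    then have "0 < ?r" using r(1) by linarith
    with le show ?thesis by (rule mult_left_le_imp_le)
  qed
  then have "lorentz k (\<lambda>i. Re (c i))" by (simp add: lorentz_def)
  with real show ?thesis by blast
qed

section \<open>Witnesses on block matrices\<close>

lemma coeff_sum_kron_block: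
  assumes A: "A \<in> carrier_mat n n" and Y: "Y \<in> carrier_mat d d"
  shows "coeff_sum (n * d) \<Phi> (kron A Y) =
    (\<Sum>i<n. \<Sum>i'<n. A $$ (i, i') * coeff_sum d (\<lambda>j j'. \<Phi> (i * d + j) (i' * d + j')) Y)"
proof -
  let ?f = "\<lambda>i j i' j'. \<Phi> (i * d + j) (i' * d + j') * (A $$ (i, i') * Y $$ (j, j'))"
  have "coeff_sum (n * d) \<Phi> (kron A Y)
      = (\<Sum>r<n * d. \<Sum>s<n * d. ?f (r div d) (r mod d) (s div d) (s mod d))"
    unfolding coeff_sum_def using A Y by (intro sum.cong refl) (simp add: kron_def)
  also have "\<dots> = (\<Sum>i<n. \<Sum>j<d. \<Sum>i'<n. \<Sum>j'<d. ?f i j i' j')"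
    by (subst sum_digits, subst sum_digits[where f = "\<lambda>i j. \<Sum>i'<n. \<Sum>j'<d. ?f i j i' j'"]) (rule refl)
  also have "\<dots> = (\<Sum>i<n. \<Sum>i'<n. \<Sum>j<d. \<Sum>j'<d. ?f i j i' j')"
    by (intro sum.cong refl sum.swap)
  also have "\<dots> = (\<Sum>i<n. \<Sum>i'<n. A $$ (i, i') * coeff_sum d (\<lambda>j j'. \<Phi> (i * d + j) (i' * d + j')) Y)"
    unfolding coeff_sum_def sum_distrib_left by (intro sum.cong refl) (simp add: mult_ac)
  finally show ?thesis .
qed

text \<open>The witness is controlled only on product vectors; rank-one decompositions of both
  factors reduce the claim to these.\<close>

lemma coeff_sum_kron_PSD_nonneg:
  assumes pos: "\<And>u v. 0 \<le> (\<Sum>r<n * d. \<Sum>s<n * d. \<Phi> r s * (pure_vec d u v r * cnj (pure_vec d u v s)))"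
    and x: "x \<in> PSD n" and y: "y \<in> PSD d"
  shows "0 \<le> coeff_sum (n * d) \<Phi> (kron x y)"
proof -
  obtain u where u: "\<And>r s. r < n \<Longrightarrow> s < n \<Longrightarrow> x $$ (r, s) = (\<Sum>l<n. u l r * cnj (u l s))"
    using PSD_rank_one_sum[OF x] by blast
  obtain v where v: "\<And>r s. r < d \<Longrightarrow> s < d \<Longrightarrow> y $$ (r, s) = (\<Sum>l<d. v l r * cnj (v l s))"
    using PSD_rank_one_sum[OF y] by blast
  let ?K = "\<lambda>l l' r s. \<Phi> r s * (pure_vec d (u l) (v l') r * cnj (pure_vec d (u l) (v l') s))"
  have "kron x y $$ (r, s) = (\<Sum>l<n. \<Sum>l'<d. pure_vec d (u l) (v l') r * cnj (pure_vec d (u l) (v l') s))"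
    if "r < n * d" "s < n * d" for r s
    using that PSD_carrier[OF x] PSD_carrier[OF y]
    by (simp add: kron_def digit_bounds u v sum_product pure_vec_def mult_ac)
  then have "coeff_sum (n * d) \<Phi> (kron x y) = (\<Sum>r<n * d. \<Sum>s<n * d. \<Sum>l<n. \<Sum>l'<d. ?K l l' r s)"
    unfolding coeff_sum_def by (intro sum.cong refl) (simp add: sum_distrib_left)
  also have "\<dots> = (\<Sum>l<n. \<Sum>l'<d. \<Sum>r<n * d. \<Sum>s<n * d. ?K l l' r s)"
    by (rule sum_swap_pairs)
  also have "0 \<le> \<dots>" by (intro sum_nonneg pos)
  finally show ?thesis .
qed

text \<open>The form of the contracted matrix at \<open>t\<close> is the form of \<open>X\<close> at
  the product vector of \<open>t\<close> and \<open>u\<close>.\<close>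

lemma block_contraction_PSD:
  assumes X: "X \<in> PSD (n * d)"
  shows "mat n n (\<lambda>(i, i'). \<Sum>j<d. \<Sum>j'<d. X $$ (i * d + j, i' * d + j') * u j' * cnj (u j)) \<in> PSD n"
    (is "?Y \<in> _")
proof -
  have "0 \<le> qform n (\<lambda>i j. ?Y $$ (i, j)) t" for t
  proof -
    let ?f = "\<lambda>i j i' j'. X $$ (i * d + j, i' * d + j') * (t i' * u j') * cnj (t i * u j)"
    have "qform n (\<lambda>i j. ?Y $$ (i, j)) t = (\<Sum>i<n. \<Sum>i'<n. \<Sum>j<d. \<Sum>j'<d. ?f i j i' j')"
      unfolding qform_def
      by (intro sum.cong refl) (simp add: sum_distrib_left mult_ac)
    also have "\<dots> = (\<Sum>i<n. \<Sum>j<d. \<Sum>i'<n. \<Sum>j'<d. ?f i j i' j')"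
      by (intro sum.cong refl sum.swap)
    also have "\<dots> = (\<Sum>r<n * d. \<Sum>s<n * d. ?f (r div d) (r mod d) (s div d) (s mod d))"
      by (subst sum_digits, subst sum_digits[where f = "\<lambda>i j. \<Sum>i'<n. \<Sum>j'<d. ?f i j i' j'"]) (rule refl)
    also have "\<dots> = qform (n * d) (\<lambda>r s. X $$ (r, s)) (pure_vec d t u)"
      by (simp add: qform_def pure_vec_def)
    also have "0 \<le> \<dots>" using X by (simp add: PSD_iff)
    finally show ?thesis .
  qed
  then show ?thesis by (simp add: PSD_iff)
qed

lemma munit_carrier: "munit d i j \<in> carrier_mat d d"
  by (simp add: munit_def)

lemma coeff_sum_kron_munit:
  assumes Y: "Y \<in> carrier_mat d d" and i: "i < n" "i' < n"
  shows "coeff_sum (n * d) \<Phi> (kron (munit n i i') Y) = coeff_sum d (\<lambda>j j'. \<Phi> (i * d + j) (i' * d + j')) Y"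
proof -
  let ?g = "\<lambda>i i'. coeff_sum d (\<lambda>j j'. \<Phi> (i * d + j) (i' * d + j')) Y"
  have "coeff_sum (n * d) \<Phi> (kron (munit n i i') Y) = (\<Sum>h<n. \<Sum>h'<n. munit n i i' $$ (h, h') * ?g h h')"
    by (rule coeff_sum_kron_block[OF munit_carrier Y])
  also have "\<dots> = (\<Sum>h<n. \<Sum>h'<n. if h = i then if h' = i' then ?g i i' else 0 else 0)"
    by (intro sum.cong refl) (auto simp: munit_def)
  also have "\<dots> = (\<Sum>h<n. if h = i then ?g i i' else 0)" using i by (intro sum.cong refl) auto
  also have "\<dots> = ?g i i'" using i by simp
  finally show ?thesis .
qed

lemma coeff_sum_tensor_map:
  "coeff_sum (b * e) \<Phi> (tensor_map a b P c e R X) =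
    (\<Sum>i<a. \<Sum>i'<a. \<Sum>j<c. \<Sum>j'<c. coeff_sum (b * e) \<Phi>
      (X $$ (i * c + j, i' * c + j') \<cdot>\<^sub>m kron (P (munit a i i')) (R (munit c j j'))))"
  unfolding tensor_map_def coeff_sum_msum by (simp only: sum.cartesian_product' prod.case)

lemma coeff_sum_mat_linear:
  assumes P: "mat_linear a b P" and X: "X \<in> carrier_mat a a"
  shows "coeff_sum b C (P X) = (\<Sum>j<a. \<Sum>j'<a. X $$ (j, j') * coeff_sum b C (P (munit a j j')))"
proof -
  have c: "P (munit a j j') \<in> carrier_mat b b" for j j'
    using P munit_carrier by (simp add: mat_linear_def)
  show ?thesis
    by (subst mat_linear_expand[OF P X])
      (simp add: coeff_sum_msum coeff_sum_smult c sum.cartesian_product split_def)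
qed

lemma mat_linear_comp: "mat_linear a b P \<Longrightarrow> mat_linear b c Q \<Longrightarrow> mat_linear a c (Q \<circ> P)"
  by (simp add: mat_linear_def)

text \<open>Membership is tested on witnesses, and the witness value is rearranged into traces to
  which \<open>annihilating_trace_nonneg\<close> applies. The auxiliary dimension \<open>n\<close>
  stays arbitrary because its factor is contracted away when \<open>B\<close> is formed.\<close>

lemma tensor_in_min_tensor:
  assumes Q: "mat_linear b a Q" and fac: "factors_through_Lorentz k b a Q"
    and P: "entanglement_annihilating a b P" and X: "X \<in> PSD (n * a)"
  shows "tensor_map n n (\<lambda>X. X) a a (Q \<circ> P) X \<in> min_tensor n a" (is "?T \<in> _")
proof (rule min_tensorI)
  show "?T \<in> carrier_mat (n * a) (n * a)" by (simp add: tensor_map_def msum_def)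
  fix \<Phi>
  assume pos: "\<And>u v. 0 \<le> (\<Sum>r<n * a. \<Sum>s<n * a. \<Phi> r s * (pure_vec a u v r * cnj (pure_vec a u v s)))"
  have lin: "mat_linear a b P" using P by (simp add: entanglement_annihilating_def)
  obtain N :: nat and C \<sigma> where
    C: "\<And>l y. l < N \<Longrightarrow> y \<in> PSD b \<Longrightarrow> \<exists>x. lorentz k x \<and> (\<forall>i\<le>k. coeff_sum b (C l i) y = of_real (x i))" and
    \<sigma>P: "\<And>l x. l < N \<Longrightarrow> lorentz k x \<Longrightarrow> msum a {0..k} (\<lambda>i. complex_of_real (x i) \<cdot>\<^sub>m \<sigma> l i) \<in> PSD a" and
    \<sigma>c: "\<And>l i. l < N \<Longrightarrow> \<sigma> l i \<in> carrier_mat a a" and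
    Qx: "\<And>X. X \<in> carrier_mat b b \<Longrightarrow>
      Q X = msum a {..<N} (\<lambda>l. msum a {0..k} (\<lambda>i. coeff_sum b (C l i) X \<cdot>\<^sub>m \<sigma> l i))"
    by (rule Lorentz_factorization[OF Q fac]) (rule that; assumption)
  define g where "g i i' = coeff_sum a (\<lambda>j j'. \<Phi> (i * a + j) (i' * a + j'))" for i i'
  \<comment> \<open>\<open>g i i'\<close> is the functional given by the block
    \<open>(i, i')\<close> of the witness; \<open>B l p\<close> contracts the first factor of
    \<open>X\<close> against the values of these functionals at \<open>\<sigma> l p\<close>. The
    default 0 beyond \<open>k\<close> makes self-adjointness hold at every index, as
    \<open>annihilating_trace_nonneg\<close> requires.\<close>
  define B where "B l p = mat a a (\<lambda>(j, j'). if p \<le> k then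
      \<Sum>i<n. \<Sum>i'<n. X $$ (i * a + j, i' * a + j') * g i i' (\<sigma> l p) else 0)" for l p
  have Bc: "B l p \<in> carrier_mat a a" for l p by (simp add: B_def)
  have BP: "msum a {0..k} (\<lambda>p. complex_of_real (x p) \<cdot>\<^sub>m B l p) \<in> PSD a" (is "?V \<in> _")
    if l: "l < N" and x: "lorentz k x" for l x
  proof -
    let ?S = "msum a {0..k} (\<lambda>i. complex_of_real (x i) \<cdot>\<^sub>m \<sigma> l i)"
    have gS: "g i i' ?S = (\<Sum>p = 0..k. of_real (x p) * g i i' (\<sigma> l p))" for i i'
      unfolding g_def coeff_sum_msum by (simp add: coeff_sum_smult \<sigma>c[OF l])
    have V: "?V $$ (j, j') = (\<Sum>i<n. \<Sum>i'<n. X $$ (i * a + j, i' * a + j') * g i i' ?S)"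
      if "j < a" "j' < a" for j j'
    proof -
      have "?V $$ (j, j') = (\<Sum>p = 0..k. \<Sum>i<n. \<Sum>i'<n.
          X $$ (i * a + j, i' * a + j') * (of_real (x p) * g i i' (\<sigma> l p)))"
        using that by (simp add: msum_def B_def sum_distrib_left mult.left_commute)
      also have "\<dots> = (\<Sum>i<n. \<Sum>i'<n. \<Sum>p = 0..k.
          X $$ (i * a + j, i' * a + j') * (of_real (x p) * g i i' (\<sigma> l p)))"
        by (rule sum_swap_inner)
      finally show ?thesis unfolding gS sum_distrib_left .
    qed
    \<comment> \<open>Contracting the second factor of \<open>X\<close> with \<open>u\<close>
      instead exhibits the form as the value of the witness at the product of \<open>?Y\<close>,
      positive because \<open>X\<close> is, and \<open>?S\<close>, positive because \<open>x\<close>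
      is a Lorentz vector.\<close>
    have "0 \<le> qform a (\<lambda>j j'. ?V $$ (j, j')) u" for u
    proof -
      let ?Y = "mat n n (\<lambda>(i, i'). \<Sum>j<a. \<Sum>j'<a. X $$ (i * a + j, i' * a + j') * u j' * cnj (u j))"
      have "qform a (\<lambda>j j'. ?V $$ (j, j')) u = (\<Sum>j<a. \<Sum>j'<a. \<Sum>i<n. \<Sum>i'<n.
          X $$ (i * a + j, i' * a + j') * u j' * cnj (u j) * g i i' ?S)"
        unfolding qform_def by (intro sum.cong refl) (simp add: V sum_distrib_left mult_ac)
      also have "\<dots> = (\<Sum>i<n. \<Sum>i'<n. \<Sum>j<a. \<Sum>j'<a.
          X $$ (i * a + j, i' * a + j') * u j' * cnj (u j) * g i i' ?S)"
        by (rule sum_swap_pairs)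
      also have "\<dots> = (\<Sum>i<n. \<Sum>i'<n. ?Y $$ (i, i') * g i i' ?S)"
        by (intro sum.cong refl) (simp add: sum_distrib_right)
      also have "\<dots> = coeff_sum (n * a) \<Phi> (kron ?Y ?S)"
        unfolding g_def by (rule coeff_sum_kron_block[symmetric]) (simp_all add: msum_def)
      also have "0 \<le> \<dots>"
        by (intro coeff_sum_kron_PSD_nonneg pos block_contraction_PSD X \<sigma>P l x)
      finally show ?thesis .
    qed
    then show ?thesis by (simp add: PSD_iff msum_def)
  qed
  \<comment> \<open>A unit vector e_p with p \<ge> 1 is not a Lorentz vector, so
    \<open>B l p\<close> need not be positive. It is the difference of the positive matrices
    obtained at e_0 + e_p and at e_0, hence self-adjoint.\<close>
  have Bh: "B l p \<in> herm a" if "l < N" for l p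
  proof -
    define V where "V x = msum a {0..k} (\<lambda>p. complex_of_real (x p) \<cdot>\<^sub>m B l p)" for x :: "nat \<Rightarrow> real"
    have ent: "V x $$ (i, j) = (\<Sum>p = 0..k. of_real (x p) * B l p $$ (i, j))" if "i < a" "j < a" for x i j
      using that carrier_matD[OF Bc] by (simp add: V_def msum_def)
    have h: "V x $$ (j, i) = cnj (V x $$ (i, j))" if "lorentz k x" "i < a" "j < a" for x i j
      using BP[OF \<open>l < N\<close> that(1)] that unfolding V_def[symmetric] by (intro hermD[of _ a]) (simp_all add: PSD_def)
    show ?thesis
    proof (rule hermI[OF Bc])
      fix i j assume ij: "i < a" "j < a"
      have h0: "B l 0 $$ (j, i) = cnj (B l 0 $$ (i, j))"
        using h[OF lorentz_axis ij] unfolding ent[OF ij] ent[OF ij(2,1)] sum_axis .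
      consider "p = 0" | "1 \<le> p" "p \<le> k" | "k < p" by linarith
      then show "B l p $$ (j, i) = cnj (B l p $$ (i, j))"
      proof cases
        case 1
        then show ?thesis using h0 by simp
      next
        case 2
        have "\<bar>1 :: real\<bar> = 1" by simp
        from h[OF lorentz_two_point[OF 2 this] ij] show ?thesis
          unfolding ent[OF ij] ent[OF ij(2,1)] sum_two_point[OF 2] using h0 by simp
      next
        case 3
        then show ?thesis using ij by (simp add: B_def)
      qed
    qed
  qed
  have Btr: "\<exists>x. lorentz k x \<and> (\<forall>p\<le>k. mat_trace (B l p * y) = of_real (x p))"
    if l: "l < N" and y: "y \<in> PSD a" for l y
  proof (rule lorentz_self_dual)
    fix x assume x: "lorentz k x"
    let ?V = "msum a {0..k} (\<lambda>p. complex_of_real (x p) \<cdot>\<^sub>m B l p)"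
    have yc: "y \<in> carrier_mat a a" by (rule PSD_carrier[OF y])
    have tr: "mat_trace (Z * y) = coeff_sum a (\<lambda>r s. y $$ (s, r)) Z" if "Z \<in> carrier_mat a a" for Z
      unfolding mat_trace_mult[OF that yc] by (rule coeff_sum_swap)
    have "0 \<le> mat_trace (?V * y)" by (rule PSD_mult_trace_nonneg[OF BP[OF l x] y])
    also have "\<dots> = coeff_sum a (\<lambda>r s. y $$ (s, r)) ?V" by (rule tr) (simp add: msum_def)
    also have "\<dots> = (\<Sum>p = 0..k. of_real (x p) * mat_trace (B l p * y))"
      unfolding coeff_sum_msum by (simp add: coeff_sum_smult Bc tr)
    finally show "0 \<le> (\<Sum>p = 0..k. of_real (x p) * mat_trace (B l p * y))" .
  qed
  let ?D = "\<lambda>l p j j'. coeff_sum b (C l p) (P (munit a j j'))"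
  let ?h = "\<lambda>i i' j j' l p. X $$ (i * a + j, i' * a + j') * (?D l p j j' * g i i' (\<sigma> l p))"
  have QP: "(Q \<circ> P) (munit a j j') \<in> carrier_mat a a" for j j'
    using mat_linear_comp[OF lin Q] munit_carrier by (simp add: mat_linear_def)
  have gQ: "g i i' ((Q \<circ> P) (munit a j j')) = (\<Sum>l<N. \<Sum>p = 0..k. ?D l p j j' * g i i' (\<sigma> l p))" for i i' j j'
  proof -
    have "P (munit a j j') \<in> carrier_mat b b" using lin munit_carrier by (simp add: mat_linear_def)
    from Qx[OF this] show ?thesis
      unfolding g_def by (simp add: coeff_sum_msum coeff_sum_smult \<sigma>c)
  qed
  have "coeff_sum (n * a) \<Phi> ?T = (\<Sum>i<n. \<Sum>i'<n. \<Sum>j<a. \<Sum>j'<a.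
      X $$ (i * a + j, i' * a + j') * g i i' ((Q \<circ> P) (munit a j j')))"
    unfolding coeff_sum_tensor_map
  proof (intro sum.cong refl)
    fix i i' j j' assume "i \<in> {..<n}" "i' \<in> {..<n}"
    then show "coeff_sum (n * a) \<Phi> (X $$ (i * a + j, i' * a + j') \<cdot>\<^sub>m kron (munit n i i') ((Q \<circ> P) (munit a j j')))
        = X $$ (i * a + j, i' * a + j') * g i i' ((Q \<circ> P) (munit a j j'))"
      using kron_carrier[OF munit_carrier QP]
      by (simp add: coeff_sum_smult coeff_sum_kron_munit[OF QP] g_def del: o_apply)
  qed
  \<comment> \<open>The reordering brings the sums over the auxiliary indices \<open>i\<close>,
    \<open>i'\<close> innermost, where they form the entries of \<open>B l p\<close>; the sums over
    \<open>j\<close>, \<open>j'\<close> then expand \<open>P (B l p)\<close> in matrix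
    units.\<close>
  also have "\<dots> = (\<Sum>i<n. \<Sum>i'<n. \<Sum>j<a. \<Sum>j'<a. \<Sum>l<N. \<Sum>p = 0..k. ?h i i' j j' l p)"
    unfolding gQ sum_distrib_left ..
  also have "\<dots> = (\<Sum>i<n. \<Sum>i'<n. \<Sum>l<N. \<Sum>p = 0..k. \<Sum>j<a. \<Sum>j'<a. ?h i i' j j' l p)"
    by (intro sum.cong refl sum_swap_pairs)
  also have "\<dots> = (\<Sum>l<N. \<Sum>p = 0..k. \<Sum>i<n. \<Sum>i'<n. \<Sum>j<a. \<Sum>j'<a. ?h i i' j j' l p)"
    by (rule sum_swap_pairs)
  also have "\<dots> = (\<Sum>l<N. \<Sum>p = 0..k. \<Sum>j<a. \<Sum>j'<a. \<Sum>i<n. \<Sum>i'<n. ?h i i' j j' l p)"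
    by (intro sum.cong refl sum_swap_pairs)
  also have "\<dots> = (\<Sum>l<N. \<Sum>p = 0..k. coeff_sum b (C l p) (P (B l p)))"
  proof (intro sum.cong refl)
    fix l p assume "p \<in> {0..k}"
    then show "(\<Sum>j<a. \<Sum>j'<a. \<Sum>i<n. \<Sum>i'<n. ?h i i' j j' l p) = coeff_sum b (C l p) (P (B l p))"
      unfolding coeff_sum_mat_linear[OF lin Bc]
      by (intro sum.cong refl) (simp add: B_def sum_distrib_left sum_distrib_right mult_ac)
  qed
  also have "0 \<le> \<dots>"
    by (intro sum_nonneg annihilating_trace_nonneg[OF P] Bh Btr C) simp_all
  finally show "0 \<le> (\<Sum>r<n * a. \<Sum>s<n * a. \<Phi> r s * ?T $$ (r, s))" by (simp only: coeff_sum_def)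
qed

theorem theorem5p6:
  fixes dA dB k :: nat and P Q :: "complex mat \<Rightarrow> complex mat"
  assumes "mat_linear dB dA Q"
    and "factors_through_Lorentz k dB dA Q"
    and "entanglement_annihilating dA dB P"
  shows "entanglement_breaking dA dA (Q \<circ> P)"
proof -
  have "mat_linear dA dB P" using assms(3) by (simp add: entanglement_annihilating_def)
  then show ?thesis
    using mat_linear_comp[OF _ assms(1)] tensor_in_min_tensor[OF assms]
    unfolding entanglement_breaking_def by blast
qed

end
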